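(* Consider the linear parabolic SPDE, the hypotheses, the estimators, the conditions [A1], [A2], [A3], [C] and the test statistic $$T_n = \frac{1}{\widehat \beta_{\ell}^2} \sqrt{\frac{n}{2}} \max_{1 \le k \le n} \biggl| \sum_{i=1}^k (\Delta_i^n \widehat x_{\ell})^2 -\frac{k}{n} \sum_{i=1}^n (\Delta_i^n \widehat x_{\ell})^2 \biggr|$$ described in the context. Assume that [A1], [A2], [A3] and [C] hold. Then, under $H_1$, for any $\epsilon>0$, $$\lim_{n\to\infty}P(T_n\ge\epsilon)=1.$$
   Context: SPDE. $\mathbb N=\{1,2,\dots\}$, $d\in\mathbb N$, $D=(0,1)^d$. Consider $dX_t(y)=-A_\theta X_t(y)\,dt+\sigma(t)\,dW^Q_t(y)$, $(t,y)\in[0,1]\times D$, with initial value $X_0$ and Dirichlet boundary condition $X_t(y)=0$ for $(t,y)\in[0,1]\times\partial D$, where $-A_\theta=\theta_2\triangle+\theta_1\cdot\nabla+\theta_0$, $\theta_0\in\mathbb R$, $\theta_1\in\mathbb R^d$, $\theta_2\in(0,\infty)$ are unknown parameters, $\sigma:[0,1]\to(0,\infty)$ is the volatility function, and $X_0$ is an $L^2(D)$-valued random variable independent of $W^Q$. Put $\kappa=\theta_1/\theta_2\in\mathbb R^d$ (true value $\kappa^*$, assumed to lie in the interior of a compact convex subset of $\mathbb R^d$). For $l=(l_1,\dots,l_d)\in\mathbb N^d$ let $e_l(y)=e_l(y;\kappa)=2^{d/2}\exp(-\frac12\kappa^{\mathsf T}y)\prod_{k=1}^d\sin(\pi l_ky^{(k)})$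 and $\lambda_l=\theta_2\pi^2|l|_2^2+\frac{|\theta_1|_2^2}{4\theta_2}-\theta_0$ be the eigenpairs of $A_\theta$ ($|\cdot|_2$ the Euclidean norm); $\{e_l\}$ is orthonormal for $\langle u,v\rangle=\int_Du(y)v(y)\exp(\kappa^{\mathsf T}y)\,dy$, with norm $\|u\|=\sqrt{\langle u,u\rangle}$. Assume $\lambda_{(1,\dots,1)}>0$. The $Q$-Wiener process is $W^Q_t=\sum_{l\in\mathbb N^d}\gamma_l^{-\alpha/2}w_l(t)e_l$, with independent standard real Brownian motions $w_l$, $\alpha\in[0,\infty)\cap(d/2-1,\infty)$, and $(0,\infty)$-valued $\gamma_l$ with $c_1|l|_2^2\le\gamma_l\le c_2|l|_2^2$ for universal constants $c_1,c_2\in(0,\infty)$ ($\gamma_l$ and $\alpha$ may be unknown). The unique mild solution is $X_t(y)=\sum_{l}x_l(t)e_l(y)$, where $x_l(t)=\langle X_t,e_l\rangle=e^{-\lambda_lt}\langle X_0,e_l\rangle+\gamma_l^{-\alpha/2}\int_0^t\sigma(s)e^{-\lambda_l(t-s)}\,dw_l(s)$. Put $\beta_l(t)=\sigma(t)\gamma_l^{-\alpha/2}$. Hypotheses. $H_0$: there is $\sigma^*\in(0,\infty)$ with $\sigma(t)=\sigma^*$ on $[0,1]$ (then $\beta_\ell^*=\sigma^*\gamma_\ell^{-\alpha/2}$). $H_1$: there exist $r\in\mathbb N$ and $0=\tau_0<\tau_1<\dots<\tau_r<\tau_{r+1}=1$ such that $\sigma(t)=\sum_{j=1}^{r+1}\sigma_j^\dagger\mathbf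 1_{[\tau_{j-1},\tau_j)}(t)$, where $\sigma_1^\dagger,\dots,\sigma_{r+1}^\dagger\in(0,\infty)$, $\sigma_j^\dagger\ne\sigma_{j+1}^\dagger$ for $j\in\{1,\dots,r\}$, and by convention $[\tau_r,\tau_{r+1})$ denotes $[\tau_r,1]$. There is no change over time in the parameters other than $\sigma(t)$. Observations. $N\in\mathbb N$, $M=(M_1,\dots,M_d)\in\mathbb N^d$, $M_{(1)}=\min_kM_k$. One observes $X_{t_i}(y_j)$ at $t_i=i/N$, $0\le i\le N$, and $y_j=(j_1/M_1,\dots,j_d/M_d)$, $0\le j_k\le M_k$. For $n\in\{1,\dots,N\}$ let $\Delta_n=\frac1N\lfloor N/n\rfloor$, $t_i^n=i\Delta_n$ ($0\le i\le n$) and $\Delta_i^nZ=Z_{t_i^n}-Z_{t_{i-1}^n}$ for a process $Z$. Notation. For $h\in(0,1)$, $a,b>0$: $h^{a\,\widetilde\land\, b}=h^a$ if $a<b$, $-h^b\log h$ if $a=b$, $h^b$ if $a>b$. For $L\in(1,\infty)$: $L^{a\,\widetilde\land\, b}=1/(1/L)^{a\,\widetilde\land\, b}$, i.e. $L^a$ if $a<b$, $L^b/\log L$ if $a=b$, $L^b$ if $a>b$. Conditions. [A1]: (i) either (a) $E[\langle X_0,e_l\rangle]=0$ for all $l\in\mathbb N^d$ and $\sup_{l}\lambda_l^{1+\alpha}E[\langle X_0,e_l\rangle^2]<\infty$, or (b) $E[\|A_\theta^{(1+\alpha)/2}X_0\|^2]<\infty$; (ii) $\{\langle X_0,e_l\rangle\}_{l\in\mathbb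 N^d}$ are independent; (iii) there exists $\ell\in\mathbb N^d$ with $E[\langle X_0,e_\ell\rangle^4]<\infty$. This $\ell$ is fixed. [A2]: there exist a positive sequence $R=R_{M,N}$ and an estimator $\widehat\kappa$ such that $R\to\infty$ and $R(\widehat\kappa-\kappa^* )=O_p(1)$ as $N\to\infty$ and $M_{(1)}\to\infty$. [A3]: for this $R$, $\frac{n^2\Delta_n^{(1+\alpha-d/2)\,\widetilde\land\,1}}{R^2}\to0$ and $\frac{n^{3/2}}{M_{(1)}^{(2(1+\alpha)-d)\,\widetilde\land\,2}}\to0$ as $n\to\infty$, $M_{(1)}\to\infty$ and $R\to\infty$. [C]: for the estimator $\widehat\beta_\ell^2$ used in $T_n$ (the one which under $H_0$ converges in probability to $(\beta_\ell^* )^2$), there exists $\beta_\ell^\dagger\in(0,\infty)$ such that $\widehat\beta_\ell^2\to(\beta_\ell^\dagger)^2$ in probability under $H_1$. Approximate coordinate process. With $\widehat\kappa$ from [A2], $\mathbb M_d=\prod_{k=1}^d\{1,\dots,M_k\}$ and $D_j=\prod_{k=1}^d[\frac{j_k-1}{M_k},\frac{j_k}{M_k}]$ for $j\in\mathbb M_d$, define $\widehat x_l(t)=\sum_{j\in\mathbb M_d}X_t(y_j)\int_{D_j}e_l(y;\widehat\kappa)\exp(\widehat\kappa^{\mathsf T}y)\,dy$. The statistic $T_n$ uses $\widehat x_\ell$.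
   Formalization: The formal theorem additionally assumes that the thinned grid's end point nΔ_n eventually exceeds the first change point τ_1 by a fixed δ>0; without it the claim fails (N=3m, n=2m gives nΔ_n=2/3, so a single change at τ_1=0.9 is never observed). *)

theory Defs
  imports "HOL-Probability.Probability"
begin

section \<open>Stochastic convergence along a filter\<close>

definition conv_in_prob ::
  "'w measure \<Rightarrow> 'i filter \<Rightarrow> ('i \<Rightarrow> 'w \<Rightarrow> real) \<Rightarrow> real \<Rightarrow> bool" where
  "conv_in_prob P F Z c \<longleftrightarrow>
     (\<forall>e>0. ((\<lambda>i. measure P {\<omega>\<in>space P. \<bar>Z i \<omega> - c\<bar> > e}) \<longlongrightarrow> 0) F)"

text \<open>\<open>Z = O\<^sub>p(1)\<close> along \<open>F\<close>.\<close>

definition bounded_in_prob ::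
  "'w measure \<Rightarrow> 'i filter \<Rightarrow> ('i \<Rightarrow> 'w \<Rightarrow> 'b::real_normed_vector) \<Rightarrow> bool" where
  "bounded_in_prob P F Z \<longleftrightarrow>
     (\<forall>e>0. \<exists>K. eventually (\<lambda>i. measure P {\<omega>\<in>space P. norm (Z i \<omega>) > K} < e) F)"


section \<open>Brownian motion and the Wiener integral\<close>

text \<open>The time horizon of the equation is \<open>[0,1]\<close>.\<close>

definition std_brownian :: "'w measure \<Rightarrow> (real \<Rightarrow> 'w \<Rightarrow> real) \<Rightarrow> bool" where
  "std_brownian P w \<longleftrightarrow>
     (\<forall>t\<in>{0..1}. w t \<in> borel_measurable P) \<and>
     (AE \<omega> in P. w 0 \<omega> = 0) \<and>
     (AE \<omega> in P. continuous_on {0..1} (\<lambda>t. w t \<omega>)) \<and>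
     (\<forall>s t. 0 \<le> s \<and> s < t \<and> t \<le> 1 \<longrightarrow>
        distributed P lborel (\<lambda>\<omega>. w t \<omega> - w s \<omega>) (normal_density 0 (sqrt (t - s)))) \<and>
     (\<forall>(m::nat) u. (\<forall>i\<le>m. u i \<in> {0..1}) \<and> (\<forall>i<m. u i < u (Suc i)) \<longrightarrow>
        prob_space.indep_vars P (\<lambda>_. borel) (\<lambda>i \<omega>. w (u (Suc i)) \<omega> - w (u i) \<omega>) {..<m})"

definition step_fun :: "nat \<Rightarrow> (nat \<Rightarrow> real) \<Rightarrow> (nat \<Rightarrow> real) \<Rightarrow> real \<Rightarrow> real" where
  "step_fun m u c s = (\<Sum>i<m. c i * indicator {u i..<u (Suc i)} s)"

definition step_integral ::
  "(real \<Rightarrow> 'w \<Rightarrow> real) \<Rightarrow> nat \<Rightarrow> (nat \<Rightarrow> real) \<Rightarrow> (nat \<Rightarrow> real) \<Rightarrow> 'w \<Rightarrow> real" where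
  "step_integral w m u c \<omega> = (\<Sum>i<m. c i * (w (u (Suc i)) \<omega> - w (u i) \<omega>))"

text \<open>\<open>I\<close> is a version of \<open>\<integral>\<^sub>0\<^sup>t f(s) dw(s)\<close> for a deterministic \<open>f \<in> L\<^sup>2[0,t]\<close>: the \<open>L\<^sup>2(P)\<close>-limit
  of the elementary integrals of step functions that converge to \<open>f\<close> in \<open>L\<^sup>2[0,t]\<close>. By the isometry
  the limit does not depend on the approximating sequence, up to null sets.\<close>

definition is_wiener_integral ::
  "'w measure \<Rightarrow> (real \<Rightarrow> 'w \<Rightarrow> real) \<Rightarrow> real \<Rightarrow> (real \<Rightarrow> real) \<Rightarrow> ('w \<Rightarrow> real) \<Rightarrow> bool" where
  "is_wiener_integral P w t f I \<longleftrightarrow>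
     set_borel_measurable borel {0..t} f \<and> I \<in> borel_measurable P \<and>
     (\<exists>(m :: nat \<Rightarrow> nat) (u :: nat \<Rightarrow> nat \<Rightarrow> real) (c :: nat \<Rightarrow> nat \<Rightarrow> real).
        (\<forall>k. u k 0 = 0 \<and> u k (m k) = t \<and> (\<forall>i<m k. u k i \<le> u k (Suc i))) \<and>
        (\<lambda>k. \<integral>\<^sup>+s\<in>{0..t}. ennreal ((step_fun (m k) (u k) (c k) s - f s)\<^sup>2) \<partial>lborel) \<longlonglongrightarrow> 0 \<and>
        (\<lambda>k. \<integral>\<^sup>+\<omega>. ennreal ((step_integral w (m k) (u k) (c k) \<omega> - I \<omega>)\<^sup>2) \<partial>P) \<longlonglongrightarrow> 0)"


section \<open>The weighted space \<open>L\<^sup>2(D)\<close> and the spectral decomposition of the operator\<close>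

definition dom :: "(real ^ 'd::finite) set" where
  "dom = {y. \<forall>k. 0 < y $ k \<and> y $ k < 1}"

text \<open>The weight \<open>exp(\<kappa>\<^sup>T y)\<close> is bounded above and away from zero on \<open>D\<close>, so it does not
  affect which functions are square integrable. Functions are not identified almost everywhere.\<close>

definition L2D :: "(real ^ 'd::finite \<Rightarrow> real) set" where
  "L2D = {u. set_borel_measurable lborel dom u \<and> set_integrable lborel dom (\<lambda>y. (u y)\<^sup>2)}"

definition ip :: "real ^ 'd::finite \<Rightarrow> (real ^ 'd \<Rightarrow> real) \<Rightarrow> (real ^ 'd \<Rightarrow> real) \<Rightarrow> real" where
  "ip \<kappa> u v = (LINT y:dom|lborel. u y * v y * exp (\<kappa> \<bullet> y))"

definition ip_norm :: "real ^ 'd::finite \<Rightarrow> (real ^ 'd \<Rightarrow> real) \<Rightarrow> real" where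
  "ip_norm \<kappa> u = sqrt (ip \<kappa> u u)"

definition multi_idx :: "(nat ^ 'd::finite) set" where
  "multi_idx = {l. \<forall>k. 1 \<le> l $ k}"

definition sqlen :: "nat ^ 'd::finite \<Rightarrow> real" where
  "sqlen l = (\<Sum>k\<in>UNIV. (real (l $ k))\<^sup>2)"

definition eigfun :: "real ^ 'd::finite \<Rightarrow> nat ^ 'd \<Rightarrow> real ^ 'd \<Rightarrow> real" where
  "eigfun \<kappa> l y = 2 powr (real CARD('d) / 2) * exp (- (\<kappa> \<bullet> y) / 2) *
     (\<Prod>k\<in>UNIV. sin (pi * real (l $ k) * y $ k))"

definition eigval :: "real \<Rightarrow> real ^ 'd::finite \<Rightarrow> real \<Rightarrow> nat ^ 'd \<Rightarrow> real" where
  "eigval \<theta>0 \<theta>1 \<theta>2 l = \<theta>2 * pi\<^sup>2 * sqlen l + (norm \<theta>1)\<^sup>2 / (4 * \<theta>2) - \<theta>0"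

text \<open>\<open>v = A\<^sub>\<theta>\<^sup>s u\<close>, i.e. \<open>u\<close> is in the domain of the fractional power and
  \<open>v = \<Sum>\<^sub>l \<lambda>\<^sub>l\<^sup>s \<langle>u,e\<^sub>l\<rangle> e\<^sub>l\<close> in \<open>L\<^sup>2(D)\<close>.\<close>

definition is_frac_power ::
  "real \<Rightarrow> real ^ 'd::finite \<Rightarrow> real \<Rightarrow> real \<Rightarrow> (real ^ 'd \<Rightarrow> real) \<Rightarrow> (real ^ 'd \<Rightarrow> real) \<Rightarrow> bool" where
  "is_frac_power \<theta>0 \<theta>1 \<theta>2 s u v \<longleftrightarrow>
     (let \<kappa> = \<theta>1 /\<^sub>R \<theta>2 in
      u \<in> L2D \<and> v \<in> L2D \<and>
      ((\<lambda>F. ip_norm \<kappa> (\<lambda>y. v y -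
          (\<Sum>l\<in>F. eigval \<theta>0 \<theta>1 \<theta>2 l powr s * ip \<kappa> u (eigfun \<kappa> l) * eigfun \<kappa> l y))) \<longlongrightarrow> 0)
        (finite_subsets_at_top multi_idx))"

text \<open>\<open>L\<^sup>2(D)\<close>-valued random variables; the space is separable, so weak measurability is
  Borel measurability, and the functionals below generate the Borel sets.\<close>

definition L2D_rv ::
  "'w measure \<Rightarrow> real ^ 'd::finite \<Rightarrow> ('w \<Rightarrow> real ^ 'd \<Rightarrow> real) \<Rightarrow> bool" where
  "L2D_rv P \<kappa> Y \<longleftrightarrow> (\<forall>\<omega>\<in>space P. Y \<omega> \<in> L2D) \<and>
     (\<forall>\<phi>\<in>L2D. (\<lambda>\<omega>. ip \<kappa> (Y \<omega>) \<phi>) \<in> borel_measurable P)"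


section \<open>The equation and its mild solution\<close>

text \<open>\<open>w l\<close> are the Brownian motions driving \<open>W\<^sup>Q\<^sub>t = \<Sum>\<^sub>l \<gamma>\<^sub>l\<^sup>-\<^sup>\<alpha>\<^sup>/\<^sup>2 w\<^sub>l(t) e\<^sub>l\<close>; for \<open>\<alpha> \<le> d/2\<close> this series
  is only formal, and independence of \<open>W\<^sup>Q\<close> means independence of all the \<open>w l\<close>.
  \<open>X t \<omega>\<close> is the solution at time \<open>t\<close> and \<open>X 0\<close> the initial value. An element of \<open>L\<^sup>2(D)\<close>
  has no point values, so \<open>X t \<omega> y\<close> is pinned down at every single point by the eigenfunction
  expansion, converging in \<open>L\<^sup>2(P)\<close>; on the boundary this gives the Dirichlet condition, since
  all \<open>eigfun\<close> vanish there.\<close>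

locale spde_model = prob_space P for P :: "'w measure" +
  fixes \<theta>0 :: real and \<theta>1 :: "real ^ 'd::finite" and \<theta>2 :: real
    and \<alpha> :: real and \<gamma> :: "nat ^ 'd \<Rightarrow> real" and \<sigma> :: "real \<Rightarrow> real"
    and w :: "nat ^ 'd \<Rightarrow> real \<Rightarrow> 'w \<Rightarrow> real"
    and X :: "real \<Rightarrow> 'w \<Rightarrow> real ^ 'd \<Rightarrow> real"
  assumes theta2_pos: "0 < \<theta>2"
    and eigval_pos: "0 < eigval \<theta>0 \<theta>1 \<theta>2 (\<chi> k. 1)"
    and alpha_nonneg: "0 \<le> \<alpha>" and alpha_gt: "real CARD('d) / 2 - 1 < \<alpha>"
    and gamma_pos: "\<And>l. l \<in> multi_idx \<Longrightarrow> 0 < \<gamma> l"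
    and gamma_order: "\<exists>c1>0. \<exists>c2>0. \<forall>l\<in>multi_idx. c1 * sqlen l \<le> \<gamma> l \<and> \<gamma> l \<le> c2 * sqlen l"
    and sigma_pos: "\<And>t. t \<in> {0..1} \<Longrightarrow> 0 < \<sigma> t"
    and brownian: "\<And>l. l \<in> multi_idx \<Longrightarrow> std_brownian P (w l)"
    and brownian_indep:
      "indep_vars (\<lambda>_. PiM {0..1} (\<lambda>_. borel)) (\<lambda>l \<omega>. \<lambda>t\<in>{0..1}. w l t \<omega>) multi_idx"
    and X_rv: "\<And>t. t \<in> {0..1} \<Longrightarrow> L2D_rv P (\<theta>1 /\<^sub>R \<theta>2) (X t)"
    and initial_indep:
      "indep_set
         (sets (vimage_algebra (space P) (\<lambda>\<omega>. \<lambda>\<phi>\<in>L2D. ip (\<theta>1 /\<^sub>R \<theta>2) (X 0 \<omega>) \<phi>)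
            (PiM L2D (\<lambda>_. borel))))
         (sets (vimage_algebra (space P) (\<lambda>\<omega>. \<lambda>(l, t)\<in>multi_idx \<times> {0..1}. w l t \<omega>)
            (PiM (multi_idx \<times> {0..1}) (\<lambda>_. borel))))"
    and mild_coord:
      "\<And>l t. l \<in> multi_idx \<Longrightarrow> t \<in> {0..1} \<Longrightarrow>
         \<exists>I. is_wiener_integral P (w l) t (\<lambda>s. \<sigma> s * exp (- eigval \<theta>0 \<theta>1 \<theta>2 l * (t - s))) I \<and>
           (AE \<omega> in P. ip (\<theta>1 /\<^sub>R \<theta>2) (X t \<omega>) (eigfun (\<theta>1 /\<^sub>R \<theta>2) l) =
              exp (- eigval \<theta>0 \<theta>1 \<theta>2 l * t) * ip (\<theta>1 /\<^sub>R \<theta>2) (X 0 \<omega>) (eigfun (\<theta>1 /\<^sub>R \<theta>2) l)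
              + \<gamma> l powr (- \<alpha> / 2) * I \<omega>)"
    and X_point_rv: "\<And>t y. t \<in> {0..1} \<Longrightarrow> y \<in> closure dom \<Longrightarrow>
         (\<lambda>\<omega>. X t \<omega> y) \<in> borel_measurable P"
    and X_point_series: "\<And>t y. t \<in> {0..1} \<Longrightarrow> y \<in> closure dom \<Longrightarrow>
         ((\<lambda>F. \<integral>\<^sup>+\<omega>. ennreal ((X t \<omega> y -
             (\<Sum>l\<in>F. ip (\<theta>1 /\<^sub>R \<theta>2) (X t \<omega>) (eigfun (\<theta>1 /\<^sub>R \<theta>2) l) * eigfun (\<theta>1 /\<^sub>R \<theta>2) l y))\<^sup>2) \<partial>P)
           \<longlongrightarrow> 0) (finite_subsets_at_top multi_idx)"

definition H0 :: "(real \<Rightarrow> real) \<Rightarrow> real \<Rightarrow> bool" where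
  "H0 \<sigma> \<sigma>s \<longleftrightarrow> 0 < \<sigma>s \<and> (\<forall>t\<in>{0..1}. \<sigma> t = \<sigma>s)"

definition H1 :: "(real \<Rightarrow> real) \<Rightarrow> nat \<Rightarrow> (nat \<Rightarrow> real) \<Rightarrow> (nat \<Rightarrow> real) \<Rightarrow> bool" where
  "H1 \<sigma> r \<tau> \<sigma>d \<longleftrightarrow>
     1 \<le> r \<and> \<tau> 0 = 0 \<and> \<tau> (r + 1) = 1 \<and> (\<forall>j\<le>r. \<tau> j < \<tau> (j + 1)) \<and>
     (\<forall>j\<in>{1..r+1}. 0 < \<sigma>d j) \<and> (\<forall>j\<in>{1..r}. \<sigma>d j \<noteq> \<sigma>d (j + 1)) \<and>
     (\<forall>t\<in>{0..1}. \<sigma> t = (\<Sum>j=1..r+1. \<sigma>d j *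
         indicator (if j = r + 1 then {\<tau> r..1} else {\<tau> (j - 1)..<\<tau> j}) t))"


section \<open>Observations and the statistic\<close>

definition min_comp :: "nat ^ 'd::finite \<Rightarrow> nat" where
  "min_comp M = Min (range (\<lambda>k. M $ k))"

definition space_pt :: "nat ^ 'd::finite \<Rightarrow> nat ^ 'd \<Rightarrow> real ^ 'd" where
  "space_pt M j = (\<chi> k. real (j $ k) / real (M $ k))"

definition obs_idx :: "nat \<Rightarrow> nat ^ 'd::finite \<Rightarrow> (nat \<times> (nat ^ 'd)) set" where
  "obs_idx N M = {..N} \<times> {j. \<forall>k. j $ k \<le> M $ k}"

text \<open>Estimators are measurable functions of the observed array.\<close>

definition obs_space :: "nat \<Rightarrow> nat ^ 'd::finite \<Rightarrow> (nat \<times> (nat ^ 'd) \<Rightarrow> real) measure" where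
  "obs_space N M = PiM (obs_idx N M) (\<lambda>_. borel)"

definition obs ::
  "(real \<Rightarrow> 'w \<Rightarrow> real ^ 'd::finite \<Rightarrow> real) \<Rightarrow> nat \<Rightarrow> nat ^ 'd \<Rightarrow> 'w \<Rightarrow> nat \<times> (nat ^ 'd) \<Rightarrow> real" where
  "obs X N M \<omega> = (\<lambda>(i, j)\<in>obs_idx N M. X (real i / real N) \<omega> (space_pt M j))"

text \<open>\<open>\<Delta>\<^sub>n\<close>. The thinned time grid ends at \<open>n \<Delta>\<^sub>n \<in> (1/2, 1]\<close>, which need not be (close to) \<open>1\<close>:
  for \<open>N = 3m\<close>, \<open>n = 2m\<close> it is \<open>2/3\<close>, and changes of \<open>\<sigma>\<close> after that time are not seen.\<close>

definition mesh :: "nat \<Rightarrow> nat \<Rightarrow> real" where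
  "mesh N n = real_of_int \<lfloor>real N / real n\<rfloor> / real N"

definition cell :: "nat ^ 'd::finite \<Rightarrow> nat ^ 'd \<Rightarrow> (real ^ 'd) set" where
  "cell M j = {y. \<forall>k. (real (j $ k) - 1) / real (M $ k) \<le> y $ k \<and> y $ k \<le> real (j $ k) / real (M $ k)}"

text \<open>The argument \<open>x\<close> is the spatial profile \<open>X\<^sub>t\<close> and \<open>\<kappa>\<close> the estimated value.\<close>

definition approx_coord ::
  "nat ^ 'd::finite \<Rightarrow> nat ^ 'd \<Rightarrow> real ^ 'd \<Rightarrow> (real ^ 'd \<Rightarrow> real) \<Rightarrow> real" where
  "approx_coord M l \<kappa> x =
     (\<Sum>j\<in>{j. \<forall>k. 1 \<le> j $ k \<and> j $ k \<le> M $ k}.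
        x (space_pt M j) * (LINT y:cell M j|lborel. eigfun \<kappa> l y * exp (\<kappa> \<bullet> y)))"

definition sq_incr ::
  "(real \<Rightarrow> 'w \<Rightarrow> real ^ 'd::finite \<Rightarrow> real) \<Rightarrow>
   (nat \<Rightarrow> nat ^ 'd \<Rightarrow> (nat \<times> (nat ^ 'd) \<Rightarrow> real) \<Rightarrow> real ^ 'd) \<Rightarrow>
   nat ^ 'd \<Rightarrow> nat \<Rightarrow> nat ^ 'd \<Rightarrow> nat \<Rightarrow> nat \<Rightarrow> 'w \<Rightarrow> real" where
  "sq_incr X \<kappa>hat l N M n i \<omega> =
     (approx_coord M l (\<kappa>hat N M (obs X N M \<omega>)) (X (real i * mesh N n) \<omega>) -
      approx_coord M l (\<kappa>hat N M (obs X N M \<omega>)) (X ((real i - 1) * mesh N n) \<omega>))\<^sup>2"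

text \<open>\<open>bhat\<close> estimates the square \<open>\<beta>\<^sub>l\<^sup>2\<close> itself.\<close>

definition T_stat ::
  "(real \<Rightarrow> 'w \<Rightarrow> real ^ 'd::finite \<Rightarrow> real) \<Rightarrow>
   (nat \<Rightarrow> nat ^ 'd \<Rightarrow> (nat \<times> (nat ^ 'd) \<Rightarrow> real) \<Rightarrow> real ^ 'd) \<Rightarrow>
   (nat \<Rightarrow> nat ^ 'd \<Rightarrow> nat \<Rightarrow> (nat \<times> (nat ^ 'd) \<Rightarrow> real) \<Rightarrow> real) \<Rightarrow>
   nat ^ 'd \<Rightarrow> nat \<Rightarrow> nat ^ 'd \<Rightarrow> nat \<Rightarrow> 'w \<Rightarrow> real" where
  "T_stat X \<kappa>hat bhat l N M n \<omega> =
     1 / bhat N M n (obs X N M \<omega>) * sqrt (real n / 2) *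
     (MAX k\<in>{1..n}. \<bar>(\<Sum>i=1..k. sq_incr X \<kappa>hat l N M n i \<omega>)
        - real k / real n * (\<Sum>i=1..n. sq_incr X \<kappa>hat l N M n i \<omega>)\<bar>)"


section \<open>Asymptotic regime and conditions\<close>

definition wedge_small :: "real \<Rightarrow> real \<Rightarrow> real \<Rightarrow> real" where
  "wedge_small h a b = (if a < b then h powr a else if a = b then - (h powr b) * ln h else h powr b)"

definition wedge_large :: "real \<Rightarrow> real \<Rightarrow> real \<Rightarrow> real" where
  "wedge_large L a b = 1 / wedge_small (1 / L) a b"

text \<open>The joint limit \<open>N \<rightarrow> \<infinity>\<close>, \<open>min M \<rightarrow> \<infinity>\<close>.\<close>

definition obs_filter :: "(nat \<times> (nat ^ 'd::finite)) filter" where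
  "obs_filter = at_top \<times>\<^sub>F filtercomap min_comp at_top"

text \<open>A filter on the triples \<open>(N, M, n)\<close> describes how the three tend to infinity together;
  sequences \<open>(N\<^sub>k, M\<^sub>k, n\<^sub>k)\<close> and a choice \<open>n = n(N, M)\<close> are both special cases. Since \<open>n \<le> N\<close>,
  also \<open>N \<rightarrow> \<infinity>\<close>.\<close>

definition regime :: "(nat \<times> (nat ^ 'd::finite) \<times> nat) filter \<Rightarrow> bool" where
  "regime F \<longleftrightarrow>
     eventually (\<lambda>(N, M, n). 1 \<le> n \<and> n \<le> N) F \<and>
     filterlim (\<lambda>(N, M, n). n) at_top F \<and>
     filterlim (\<lambda>(N, M, n). min_comp M) at_top F"

definition cond_A1 ::
  "'w measure \<Rightarrow> real \<Rightarrow> real ^ 'd::finite \<Rightarrow> real \<Rightarrow> real \<Rightarrow>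
   ('w \<Rightarrow> real ^ 'd \<Rightarrow> real) \<Rightarrow> nat ^ 'd \<Rightarrow> bool" where
  "cond_A1 P \<theta>0 \<theta>1 \<theta>2 \<alpha> X0 l0 \<longleftrightarrow>
     (let \<kappa> = \<theta>1 /\<^sub>R \<theta>2; c = (\<lambda>l \<omega>. ip \<kappa> (X0 \<omega>) (eigfun \<kappa> l)) in
      ((\<forall>l\<in>multi_idx. integrable P (\<lambda>\<omega>. (c l \<omega>)\<^sup>2) \<and> integral\<^sup>L P (c l) = 0) \<and>
       bdd_above ((\<lambda>l. eigval \<theta>0 \<theta>1 \<theta>2 l powr (1 + \<alpha>) * (LINT \<omega>|P. (c l \<omega>)\<^sup>2)) ` multi_idx)
       \<or>
       (\<exists>V. (AE \<omega> in P. is_frac_power \<theta>0 \<theta>1 \<theta>2 ((1 + \<alpha>) / 2) (X0 \<omega>) (V \<omega>)) \<and>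
            integrable P (\<lambda>\<omega>. (ip_norm \<kappa> (V \<omega>))\<^sup>2))) \<and>
      prob_space.indep_vars P (\<lambda>_. borel) c multi_idx \<and>
      l0 \<in> multi_idx \<and> integrable P (\<lambda>\<omega>. (c l0 \<omega>) ^ 4))"

definition cond_A2 ::
  "'w measure \<Rightarrow> real ^ 'd::finite \<Rightarrow> (real \<Rightarrow> 'w \<Rightarrow> real ^ 'd \<Rightarrow> real) \<Rightarrow>
   (nat \<Rightarrow> nat ^ 'd \<Rightarrow> real) \<Rightarrow>
   (nat \<Rightarrow> nat ^ 'd \<Rightarrow> (nat \<times> (nat ^ 'd) \<Rightarrow> real) \<Rightarrow> real ^ 'd) \<Rightarrow> bool" where
  "cond_A2 P \<kappa> X R \<kappa>hat \<longleftrightarrow>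
     (\<forall>N M. 1 \<le> N \<and> M \<in> multi_idx \<longrightarrow> 0 < R N M) \<and>
     filterlim (\<lambda>(N, M). R N M) at_top obs_filter \<and>
     (\<forall>N M. \<kappa>hat N M \<in> borel_measurable (obs_space N M)) \<and>
     bounded_in_prob P obs_filter
       (\<lambda>(N, M) \<omega>. R N M *\<^sub>R (\<kappa>hat N M (obs X N M \<omega>) - \<kappa>))"

definition cond_A3 ::
  "real \<Rightarrow> (nat \<Rightarrow> nat ^ 'd::finite \<Rightarrow> real) \<Rightarrow> (nat \<times> (nat ^ 'd) \<times> nat) filter \<Rightarrow> bool" where
  "cond_A3 \<alpha> R F \<longleftrightarrow>
     ((\<lambda>(N, M, n). (real n)\<^sup>2 * wedge_small (mesh N n) (1 + \<alpha> - real CARD('d) / 2) 1 / (R N M)\<^sup>2)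
        \<longlongrightarrow> 0) F \<and>
     ((\<lambda>(N, M, n). real n powr (3 / 2) /
          wedge_large (real (min_comp M)) (2 * (1 + \<alpha>) - real CARD('d)) 2)
        \<longlongrightarrow> 0) F"

text \<open>Consistency of \<open>bhat\<close> for \<open>\<sigma>*\<^sup>2 \<gamma>\<^bsub>l0\<^esub>\<^sup>-\<^sup>\<alpha>\<close> whenever the data come from a model with constant
  volatility and the same remaining parameters.\<close>

definition consistent_under_H0 ::
  "'w itself \<Rightarrow> real \<Rightarrow> real ^ 'd::finite \<Rightarrow> real \<Rightarrow> real \<Rightarrow> (nat ^ 'd \<Rightarrow> real) \<Rightarrow> nat ^ 'd \<Rightarrow>
   (nat \<Rightarrow> nat ^ 'd \<Rightarrow> real) \<Rightarrow>
   (nat \<Rightarrow> nat ^ 'd \<Rightarrow> (nat \<times> (nat ^ 'd) \<Rightarrow> real) \<Rightarrow> real ^ 'd) \<Rightarrow>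
   (nat \<Rightarrow> nat ^ 'd \<Rightarrow> nat \<Rightarrow> (nat \<times> (nat ^ 'd) \<Rightarrow> real) \<Rightarrow> real) \<Rightarrow>
   (nat \<times> (nat ^ 'd) \<times> nat) filter \<Rightarrow> bool" where
  "consistent_under_H0 TYPE('w) \<theta>0 \<theta>1 \<theta>2 \<alpha> \<gamma> l0 R \<kappa>hat bhat F \<longleftrightarrow>
     (\<forall>(P :: 'w measure) \<sigma> w X \<sigma>s.
        spde_model P \<theta>0 \<theta>1 \<theta>2 \<alpha> \<gamma> \<sigma> w X \<and> H0 \<sigma> \<sigma>s \<and>
        cond_A1 P \<theta>0 \<theta>1 \<theta>2 \<alpha> (X 0) l0 \<and> cond_A2 P (\<theta>1 /\<^sub>R \<theta>2) X R \<kappa>hat \<longrightarrow>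
        conv_in_prob P F (\<lambda>(N, M, n) \<omega>. bhat N M n (obs X N M \<omega>))
          ((\<sigma>s * \<gamma> l0 powr (- \<alpha> / 2))\<^sup>2))"

definition cond_C ::
  "'w measure \<Rightarrow> (real \<Rightarrow> 'w \<Rightarrow> real ^ 'd::finite \<Rightarrow> real) \<Rightarrow>
   (nat \<Rightarrow> nat ^ 'd \<Rightarrow> nat \<Rightarrow> (nat \<times> (nat ^ 'd) \<Rightarrow> real) \<Rightarrow> real) \<Rightarrow>
   (nat \<times> (nat ^ 'd) \<times> nat) filter \<Rightarrow> bool" where
  "cond_C P X bhat F \<longleftrightarrow>
     (\<exists>\<beta>d>0. conv_in_prob P F (\<lambda>(N, M, n) \<omega>. bhat N M n (obs X N M \<omega>)) (\<beta>d\<^sup>2))"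

end

theory Submission
  imports Defs
begin

text \<open>The statistic diverges because the sum of squared increments of a coordinate process estimates its
  integrated squared volatility, and under a change of volatility that estimate is not linear in
  time. Write \<open>S\<^sub>k\<close> for the sum of the first \<open>k\<close> squared increments of the approximate coordinate and
  \<open>D\<^sub>k = S\<^sub>k - k/n S\<^sub>n\<close>. With several changes \<open>D\<^sub>k\<close> may be small at the first change point itself,
  so \<open>D\<close> is compared on two blocks of \<open>m\<close> consecutive increments, one ending just before
  and one starting just after the first change point \<open>\<tau> 1\<close>. In the difference of the two block
  increments of \<open>D\<close> the linear term cancels, hence \<open>max\<^sub>k \<bar>D\<^sub>k\<bar>\<close> is at least a quarter of the difference
  of the two block sums of squares (\<open>max_bridge_ge_second_difference\<close>). The blocks have the same
  length in time, bounded below, and on each of them the volatility is constant. Therefore the two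
  sums converge to different multiples of the common length \<open>m \<Delta>\<close> (\<open>block_whp\<close>), and the
  factor \<open>sqrt (n/2)\<close> drives the statistic to infinity.

  On a block with volatility \<open>v\<close> an increment of the approximate coordinate is
  \<open>v \<gamma>\<^sup>-\<^sup>\<alpha>\<^sup>/\<^sup>2\<close> times the increment of the driving Brownian motion plus three errors. The squares of
  the Brownian increments obey a law of large numbers with an explicit variance
  (\<open>brownian_quadratic_variation\<close>). By \<open>sum_squares_perturb\<close> the errors are harmless once
  the sum of their squares over the block tends to zero in probability:

  \<^item> The mean reversion and the initial value change the coordinate by a quantity of order \<open>\<Delta>\<close> in
    \<open>L\<^sup>2\<close> (\<open>coord_increment_sq_mom\<close>), and \<open>n \<Delta>\<^sup>2 \<le> \<Delta>\<close>.
  \<^item> The spatial discretisation is a linear functional of the solution that is small on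
    every eigenfunction (\<open>approx_coord_eigfun\<close>). Linear combinations of the coordinates of the
    solution have second moments as small as if the coordinates were uncorrelated with variances
    of order \<open>\<bar>l\<bar>\<^sup>-\<^sup>2\<^sup>(\<^sup>1\<^sup>+\<^sup>\<alpha>\<^sup>)\<close> (\<open>coord_sum_sq_mom\<close>), hence the second moment of this
    functional is of order \<open>h\<^sup>2\<^sup>s\<close>, with \<open>1/h\<close> the smallest component of \<open>M\<close>, for every admissible Hoelder exponent \<open>s\<close>
    (\<open>discretisation_sq_mom\<close>). For one such \<open>s\<close> eventually \<open>n h\<^sup>2\<^sup>s\<close> is at most the power \<open>2/3\<close> of the
    quantity that the second part of \<open>cond_A3\<close> controls.
  \<^item> The estimated drift parameter changes the coefficients of the approximate coordinate by a
    relative amount of order \<open>1/R\<close>. A uniform bound on the second moment of the solution makes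
    the sum of the squared errors of order \<open>n/R\<^sup>2\<close>, and this tends to zero by the first part of
    \<open>cond_A3\<close>, because \<open>\<Delta> \<ge> 1/(2n)\<close>.

  The stochastic integrals enter through second moments only. They are treated as \<open>L\<^sup>2\<close>
  limits of linear combinations of values of the Brownian motions, for which the Ito isometry is a
  bilinear identity (\<open>elementary_isometry\<close>).\<close>

section \<open>Second moments and events of high probability\<close>

definition sq_mom :: "'w measure \<Rightarrow> ('w \<Rightarrow> real) \<Rightarrow> ennreal" where
  "sq_mom P Z = (\<integral>\<^sup>+\<omega>. ennreal ((Z \<omega>)\<^sup>2) \<partial>P)"

lemma sq_mom_cong_AE: "AE \<omega> in P. Y \<omega> = Z \<omega> \<Longrightarrow> sq_mom P Y = sq_mom P Z"
  unfolding sq_mom_def by (intro nn_integral_cong_AE) auto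

lemma sq_mom_cmult:
  "Z \<in> borel_measurable P \<Longrightarrow> sq_mom P (\<lambda>\<omega>. c * Z \<omega>) = ennreal (c\<^sup>2) * sq_mom P Z"
  unfolding sq_mom_def by (simp add: power_mult_distrib ennreal_mult nn_integral_cmult)

lemma sq_mom_sum_le:
  assumes "finite A" "\<And>i. i \<in> A \<Longrightarrow> Z i \<in> borel_measurable P"
  shows "sq_mom P (\<lambda>\<omega>. \<Sum>i\<in>A. Z i \<omega>) \<le> of_nat (card A) * (\<Sum>i\<in>A. sq_mom P (Z i))"
proof -
  have cs: "(\<Sum>i\<in>A. Z i \<omega>)\<^sup>2 \<le> real (card A) * (\<Sum>i\<in>A. (Z i \<omega>)\<^sup>2)" for \<omega>
    using Cauchy_Schwarz_ineq_sum[of "\<lambda>_. 1" "\<lambda>i. Z i \<omega>" A] by simp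
  have "sq_mom P (\<lambda>\<omega>. \<Sum>i\<in>A. Z i \<omega>) \<le> (\<integral>\<^sup>+\<omega>. ennreal (real (card A) * (\<Sum>i\<in>A. (Z i \<omega>)\<^sup>2)) \<partial>P)"
    unfolding sq_mom_def by (intro nn_integral_mono ennreal_leI cs)
  also have "\<dots> = (\<integral>\<^sup>+\<omega>. of_nat (card A) * (\<Sum>i\<in>A. ennreal ((Z i \<omega>)\<^sup>2)) \<partial>P)"
    by (intro nn_integral_cong) (simp add: ennreal_mult sum_nonneg ennreal_of_nat_eq_real_of_nat)
  also have "\<dots> = of_nat (card A) * (\<Sum>i\<in>A. sq_mom P (Z i))"
    unfolding sq_mom_def using assms by (subst nn_integral_cmult) (auto simp: nn_integral_sum simp del: sum_ennreal)
  finally show ?thesis .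
qed

lemma sq_mom_add_le:
  assumes "Y \<in> borel_measurable P" "Z \<in> borel_measurable P"
  shows "sq_mom P (\<lambda>\<omega>. Y \<omega> + Z \<omega>) \<le> 2 * sq_mom P Y + 2 * sq_mom P Z"
proof -
  have "sq_mom P (\<lambda>\<omega>. \<Sum>i\<in>UNIV. (if i then Y else Z) \<omega>)
      \<le> of_nat (card (UNIV :: bool set)) * (\<Sum>i\<in>UNIV. sq_mom P (if i then Y else Z))"
    by (rule sq_mom_sum_le) (use assms in auto)
  then show ?thesis by (simp add: UNIV_bool distrib_left add.commute)
qed

text \<open>A bound on second moments passes to an \<open>L\<^sup>2\<close> limit. The factor \<open>2\<close> comes from
  \<open>(a + b)\<^sup>2 \<le> 2 a\<^sup>2 + 2 b\<^sup>2\<close>, which serves here instead of the triangle inequality in \<open>L\<^sup>2\<close>, so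
  that the whole argument stays with extended nonnegative integrals; constants are irrelevant
  below.\<close>

lemma sq_mom_limit_le:
  assumes "\<And>i. Z i \<in> borel_measurable P" "Y \<in> borel_measurable P"
    and lim: "((\<lambda>i. sq_mom P (\<lambda>\<omega>. Z i \<omega> - Y \<omega>)) \<longlongrightarrow> 0) F"
    and bd: "eventually (\<lambda>i. sq_mom P (Z i) \<le> C i) F" and C: "(C \<longlongrightarrow> c) F" and F: "F \<noteq> bot"
  shows "sq_mom P Y \<le> 2 * c"
proof -
  have "((\<lambda>i. 2 * sq_mom P (\<lambda>\<omega>. Z i \<omega> - Y \<omega>) + 2 * C i) \<longlongrightarrow> 2 * 0 + 2 * c) F"
    by (intro tendsto_add ennreal_tendsto_cmult lim C) auto
  moreover have "eventually (\<lambda>i. sq_mom P Y \<le> 2 * sq_mom P (\<lambda>\<omega>. Z i \<omega> - Y \<omega>) + 2 * C i) F"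
    using bd
  proof eventually_elim
    case (elim i)
    have "sq_mom P Y = sq_mom P (\<lambda>\<omega>. (Y \<omega> - Z i \<omega>) + Z i \<omega>)" by simp
    also have "\<dots> \<le> 2 * sq_mom P (\<lambda>\<omega>. Y \<omega> - Z i \<omega>) + 2 * sq_mom P (Z i)"
      by (rule sq_mom_add_le) (use assms in auto)
    also have "\<dots> \<le> 2 * sq_mom P (\<lambda>\<omega>. Z i \<omega> - Y \<omega>) + 2 * C i"
      using elim unfolding sq_mom_def by (intro add_mono mult_left_mono) (auto simp: power2_commute)
    finally show ?case .
  qed
  ultimately have "sq_mom P Y \<le> 2 * 0 + 2 * c" by (rule tendsto_lowerbound[OF _ _ F])
  then show ?thesis by simp
qed

lemma (in prob_space) sum_uncorrelated:
  fixes Z :: "'i \<Rightarrow> 'a \<Rightarrow> real"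
  assumes "finite A"
    and int: "\<And>i j. i \<in> A \<Longrightarrow> j \<in> A \<Longrightarrow> integrable M (\<lambda>\<omega>. Z i \<omega> * Z j \<omega>)"
    and orth: "\<And>i j. i \<in> A \<Longrightarrow> j \<in> A \<Longrightarrow> i \<noteq> j \<Longrightarrow> expectation (\<lambda>\<omega>. Z i \<omega> * Z j \<omega>) = 0"
  shows "sq_mom M (\<lambda>\<omega>. \<Sum>i\<in>A. Z i \<omega>) = ennreal (\<Sum>i\<in>A. expectation (\<lambda>\<omega>. (Z i \<omega>)\<^sup>2))"
proof -
  have eq: "(\<Sum>i\<in>A. Z i \<omega>)\<^sup>2 = (\<Sum>i\<in>A. \<Sum>j\<in>A. Z i \<omega> * Z j \<omega>)" for \<omega>
    by (simp add: power2_eq_square sum_product)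
  have "sq_mom M (\<lambda>\<omega>. \<Sum>i\<in>A. Z i \<omega>) = ennreal (expectation (\<lambda>\<omega>. (\<Sum>i\<in>A. Z i \<omega>)\<^sup>2))"
    unfolding sq_mom_def
  proof (rule nn_integral_eq_integral)
    show "integrable M (\<lambda>\<omega>. (\<Sum>i\<in>A. Z i \<omega>)\<^sup>2)"
      unfolding eq by (intro Bochner_Integration.integrable_sum int)
  qed simp
  also have "expectation (\<lambda>\<omega>. (\<Sum>i\<in>A. Z i \<omega>)\<^sup>2) = (\<Sum>i\<in>A. \<Sum>j\<in>A. expectation (\<lambda>\<omega>. Z i \<omega> * Z j \<omega>))"
    unfolding eq by (simp add: int Bochner_Integration.integral_sum)
  also have "\<dots> = (\<Sum>i\<in>A. \<Sum>j\<in>A. if j = i then expectation (\<lambda>\<omega>. (Z i \<omega>)\<^sup>2) else 0)"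
    by (intro sum.cong refl) (auto simp: orth power2_eq_square)
  also have "\<dots> = (\<Sum>i\<in>A. expectation (\<lambda>\<omega>. (Z i \<omega>)\<^sup>2))"
    using \<open>finite A\<close> by (simp add: sum.delta')
  finally show ?thesis .
qed

text \<open>\<open>Q\<close> holds with probability tending to one. The exceptional sets, not \<open>Q\<close>, are required to be
  measurable: such statements can be intersected and weakened freely, and measurability of the
  event enters only when \<open>whp_tendsto\<close> turns the final one into a limit of probabilities.\<close>

definition whp :: "'w measure \<Rightarrow> 'i filter \<Rightarrow> ('i \<Rightarrow> 'w \<Rightarrow> bool) \<Rightarrow> bool" where
  "whp P F Q \<longleftrightarrow> (\<forall>e>0. eventually (\<lambda>i. \<exists>B\<in>sets P. measure P B \<le> e \<and> (\<forall>\<omega>\<in>space P - B. Q i \<omega>)) F)"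

context prob_space begin

lemma whp_mono:
  assumes "whp M F Q" "eventually (\<lambda>i. \<forall>\<omega>\<in>space M. Q i \<omega> \<longrightarrow> Q' i \<omega>) F"
  shows "whp M F Q'"
  unfolding whp_def
proof (intro allI impI)
  fix e :: real assume "e > 0"
  then have "eventually (\<lambda>i. \<exists>B\<in>sets M. measure M B \<le> e \<and> (\<forall>\<omega>\<in>space M - B. Q i \<omega>)) F"
    using assms(1) by (auto simp: whp_def)
  with assms(2) show "eventually (\<lambda>i. \<exists>B\<in>sets M. measure M B \<le> e \<and> (\<forall>\<omega>\<in>space M - B. Q' i \<omega>)) F"
    by eventually_elim blast
qed

lemma whp_conj:
  assumes "whp M F Q" "whp M F Q'"
  shows "whp M F (\<lambda>i \<omega>. Q i \<omega> \<and> Q' i \<omega>)"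
  unfolding whp_def
proof (intro allI impI)
  fix e :: real assume "e > 0"
  then have "eventually (\<lambda>i. \<exists>B\<in>sets M. measure M B \<le> e/2 \<and> (\<forall>\<omega>\<in>space M - B. Q i \<omega>)) F"
    "eventually (\<lambda>i. \<exists>B\<in>sets M. measure M B \<le> e/2 \<and> (\<forall>\<omega>\<in>space M - B. Q' i \<omega>)) F"
    using assms[unfolded whp_def, rule_format, of "e/2"] \<open>e > 0\<close> by simp_all
  then show "eventually (\<lambda>i. \<exists>B\<in>sets M. measure M B \<le> e \<and> (\<forall>\<omega>\<in>space M - B. Q i \<omega> \<and> Q' i \<omega>)) F"
  proof eventually_elim
    case (elim i)
    then obtain B B' where B: "B \<in> sets M" "measure M B \<le> e/2" "\<forall>\<omega>\<in>space M - B. Q i \<omega>"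
      "B' \<in> sets M" "measure M B' \<le> e/2" "\<forall>\<omega>\<in>space M - B'. Q' i \<omega>" by blast
    then have "measure M (B \<union> B') \<le> e"
      using measure_Un_le[of B M B'] by simp
    with B show ?case by (intro bexI[of _ "B \<union> B'"]) auto
  qed
qed

lemma whp_tendsto:
  assumes "whp M F (\<lambda>i \<omega>. Z i \<omega> \<ge> c)" and "eventually (\<lambda>i. Z i \<in> borel_measurable M) F"
  shows "((\<lambda>i. measure M {\<omega>\<in>space M. Z i \<omega> \<ge> (c::real)}) \<longlongrightarrow> 1) F"
proof (rule tendstoI)
  fix e :: real assume "e > 0"
  then have "eventually (\<lambda>i. \<exists>B\<in>sets M. measure M B \<le> e/2 \<and> (\<forall>\<omega>\<in>space M - B. Z i \<omega> \<ge> c)) F"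
    using assms(1)[unfolded whp_def, rule_format, of "e/2"] \<open>e > 0\<close> by simp
  with assms(2) show "eventually (\<lambda>i. dist (measure M {\<omega>\<in>space M. Z i \<omega> \<ge> c}) 1 < e) F"
  proof eventually_elim
    case (elim i)
    then obtain B where B: "B \<in> sets M" "measure M B \<le> e/2" "\<forall>\<omega>\<in>space M - B. Z i \<omega> \<ge> c" by blast
    have "1 - e/2 \<le> measure M (space M - B)" using B by (simp add: prob_compl)
    also have "\<dots> \<le> measure M {\<omega>\<in>space M. Z i \<omega> \<ge> c}"
      using B elim(1) by (intro finite_measure_mono) auto
    finally show ?case
      using \<open>e > 0\<close> prob_le_1[of "{\<omega>\<in>space M. Z i \<omega> \<ge> c}"] by (simp add: dist_real_def)
  qed
qed

lemma whp_conv_in_prob: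
  assumes "conv_in_prob M F Z c" "\<And>i. Z i \<in> borel_measurable M" "e > 0"
  shows "whp M F (\<lambda>i \<omega>. \<bar>Z i \<omega> - c\<bar> \<le> e)"
  unfolding whp_def
proof (intro allI impI)
  fix d :: real assume "d > 0"
  have "((\<lambda>i. measure M {\<omega>\<in>space M. \<bar>Z i \<omega> - c\<bar> > e}) \<longlongrightarrow> 0) F"
    using assms by (auto simp: conv_in_prob_def)
  then have "eventually (\<lambda>i. measure M {\<omega>\<in>space M. \<bar>Z i \<omega> - c\<bar> > e} < d) F"
    using \<open>d > 0\<close> by (rule order_tendstoD)
  then show "eventually (\<lambda>i. \<exists>B\<in>sets M. measure M B \<le> d \<and> (\<forall>\<omega>\<in>space M - B. \<bar>Z i \<omega> - c\<bar> \<le> e)) F"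
  proof eventually_elim
    case (elim i)
    have "{\<omega>\<in>space M. \<bar>Z i \<omega> - c\<bar> > e} \<in> sets M" using assms(2)[of i] by measurable
    with elim show ?case by (intro bexI[of _ "{\<omega>\<in>space M. \<bar>Z i \<omega> - c\<bar> > e}"]) auto
  qed
qed

lemma whp_first_moment:
  fixes Z :: "'i \<Rightarrow> 'a \<Rightarrow> real"
  assumes "(C \<longlongrightarrow> 0) F"
    and "eventually (\<lambda>i. Z i \<in> borel_measurable M \<and> (\<integral>\<^sup>+\<omega>. ennreal (Z i \<omega>) \<partial>M) \<le> ennreal (C i)) F"
    and "(e::real) > 0"
  shows "whp M F (\<lambda>i \<omega>. Z i \<omega> \<le> e)"
  unfolding whp_def
proof (intro allI impI)
  fix d :: real assume "d > 0"
  then have "eventually (\<lambda>i. C i < d * e) F" using assms by (intro order_tendstoD(2)[of C 0]) auto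
  with assms(2) show "eventually (\<lambda>i. \<exists>B\<in>sets M. measure M B \<le> d \<and> (\<forall>\<omega>\<in>space M - B. Z i \<omega> \<le> e)) F"
  proof eventually_elim
    case (elim i)
    then have [measurable]: "Z i \<in> borel_measurable M" by simp
    let ?B = "{\<omega>\<in>space M. 1 \<le> ennreal (1/e) * ennreal (Z i \<omega>)}"
    have B: "?B \<in> sets M" by measurable
    have "emeasure M ?B \<le> ennreal (1/e) * (\<integral>\<^sup>+\<omega>. ennreal (Z i \<omega>) * indicator (space M) \<omega> \<partial>M)"
      using nn_integral_Markov_inequality[of "\<lambda>\<omega>. ennreal (Z i \<omega>)" "space M" M "ennreal (1/e)"]
      by simp
    also have "(\<integral>\<^sup>+\<omega>. ennreal (Z i \<omega>) * indicator (space M) \<omega> \<partial>M) = (\<integral>\<^sup>+\<omega>. ennreal (Z i \<omega>) \<partial>M)"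
      by (intro nn_integral_cong) auto
    also have "ennreal (1/e) * (\<integral>\<^sup>+\<omega>. ennreal (Z i \<omega>) \<partial>M) \<le> ennreal (1/e) * ennreal (d * e)"
      using elim by (intro mult_left_mono order_trans[OF conjunct2[OF elim(1)]] ennreal_leI) auto
    also have "\<dots> = ennreal d" using \<open>e > 0\<close> \<open>d > 0\<close> by (simp add: ennreal_mult[symmetric])
    finally have "measure M ?B \<le> d"
      using \<open>d > 0\<close> by (simp add: emeasure_eq_measure)
    moreover have "Z i \<omega> \<le> e" if "\<omega> \<in> space M - ?B" for \<omega>
    proof (rule ccontr)
      assume "\<not> Z i \<omega> \<le> e"
      then have "ennreal 1 \<le> ennreal (1/e * Z i \<omega>)" using \<open>e > 0\<close> by (intro ennreal_leI) auto
      then have "\<omega> \<in> ?B" using that \<open>e > 0\<close> \<open>\<not> Z i \<omega> \<le> e\<close> by (subst (asm) ennreal_mult) auto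
      with that show False by blast
    qed
    ultimately show ?case using B by blast
  qed
qed

text \<open>The error estimates below bound each summand in \<open>L\<^sup>2\<close>; Markov's inequality for the sum of
  squares converts them into statements about probabilities.\<close>

lemma whp_sum_squares:
  fixes Z :: "'i \<Rightarrow> nat \<Rightarrow> 'a \<Rightarrow> real"
  assumes C: "((\<lambda>i. real (card (A i)) * C i) \<longlongrightarrow> 0) F"
    and ev: "eventually (\<lambda>i. finite (A i) \<and> 0 \<le> C i \<and>
        (\<forall>k\<in>A i. Z i k \<in> borel_measurable M \<and> sq_mom M (Z i k) \<le> ennreal (C i))) F"
    and "(e::real) > 0"
  shows "whp M F (\<lambda>i \<omega>. (\<Sum>k\<in>A i. (Z i k \<omega>)\<^sup>2) \<le> e)"
proof (rule whp_first_moment[OF C _ \<open>e > 0\<close>])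
  show "eventually (\<lambda>i. (\<lambda>\<omega>. \<Sum>k\<in>A i. (Z i k \<omega>)\<^sup>2) \<in> borel_measurable M \<and>
      (\<integral>\<^sup>+\<omega>. ennreal (\<Sum>k\<in>A i. (Z i k \<omega>)\<^sup>2) \<partial>M) \<le> ennreal (real (card (A i)) * C i)) F"
    using ev
  proof eventually_elim
    case (elim i)
    have "(\<integral>\<^sup>+\<omega>. ennreal (\<Sum>k\<in>A i. (Z i k \<omega>)\<^sup>2) \<partial>M) = (\<Sum>k\<in>A i. sq_mom M (Z i k))"
      unfolding sq_mom_def using elim
      by (subst nn_integral_sum[symmetric]) (auto intro!: nn_integral_cong simp: sum_nonneg)
    also have "\<dots> \<le> (\<Sum>k\<in>A i. ennreal (C i))" using elim by (intro sum_mono) auto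
    also have "\<dots> = ennreal (real (card (A i)) * C i)"
      using elim by (simp add: ennreal_mult ennreal_of_nat_eq_real_of_nat)
    finally show ?case using elim by (auto intro!: borel_measurable_sum borel_measurable_power)
  qed
qed

end

section \<open>Brownian motion and Wiener integrals\<close>

context prob_space begin

lemma indep_vars_pair:
  fixes Z :: "'i \<Rightarrow> 'a \<Rightarrow> real"
  assumes "indep_vars (\<lambda>_. borel) Z I" "i \<in> I" "j \<in> I" "i \<noteq> j" "integrable M (Z i)" "integrable M (Z j)"
  shows "integrable M (\<lambda>\<omega>. Z i \<omega> * Z j \<omega>)"
    and "expectation (\<lambda>\<omega>. Z i \<omega> * Z j \<omega>) = expectation (Z i) * expectation (Z j)"
proof -
  have ind: "indep_vars (\<lambda>_. borel) Z {i, j}"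
    by (rule indep_vars_subset[OF assms(1)]) (use assms in auto)
  show "integrable M (\<lambda>\<omega>. Z i \<omega> * Z j \<omega>)"
    using indep_vars_integrable[OF _ ind] assms by auto
  show "expectation (\<lambda>\<omega>. Z i \<omega> * Z j \<omega>) = expectation (Z i) * expectation (Z j)"
    using indep_vars_lebesgue_integral[OF _ ind] assms by auto
qed

lemma brownian_measurable: "std_brownian M b \<Longrightarrow> t \<in> {0..1} \<Longrightarrow> b t \<in> borel_measurable M"
  by (auto simp: std_brownian_def)

lemma brownian_increment:
  assumes b: "std_brownian M b" and st: "0 \<le> s" "s < t" "t \<le> 1"
  shows "integrable M (\<lambda>\<omega>. (b t \<omega> - b s \<omega>) ^ k)"
    and "expectation (\<lambda>\<omega>. b t \<omega> - b s \<omega>) = 0"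
    and "expectation (\<lambda>\<omega>. (b t \<omega> - b s \<omega>)\<^sup>2) = t - s"
    and "expectation (\<lambda>\<omega>. (b t \<omega> - b s \<omega>) ^ 4) = 3 * (t - s)\<^sup>2"
proof -
  let ?D = "\<lambda>\<omega>. b t \<omega> - b s \<omega>" and ?sd = "sqrt (t - s)"
  have D: "distributed M lborel ?D (normal_density 0 ?sd)"
    using b st by (auto simp: std_brownian_def)
  have pos: "0 < ?sd" using st by simp
  show "integrable M (\<lambda>\<omega>. (?D \<omega>) ^ k)"
    using distributed_integrable[OF D, of "\<lambda>x. x ^ k"] integrable_normal_moment[OF pos, of 0 k] by simp
  have E: "expectation (\<lambda>\<omega>. (?D \<omega>) ^ k) = (\<integral>x. normal_density 0 ?sd x * x ^ k \<partial>lborel)" for k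
    using distributed_integral[OF D, of "\<lambda>x. x ^ k"] by simp
  show "expectation ?D = 0"
    using E[of 1] integral_normal_moment_odd[OF pos, of 0 0] by simp
  show "expectation (\<lambda>\<omega>. (?D \<omega>)\<^sup>2) = t - s"
    using E[of 2] integral_normal_moment_even[OF pos, of 0 1] st by simp
  show "expectation (\<lambda>\<omega>. (?D \<omega>) ^ 4) = 3 * (t - s)\<^sup>2"
    using E[of 4] integral_normal_moment_even[OF pos, of 0 2] st
    by (simp add: fact_numeral power_divide field_simps)
qed

lemma brownian_start: "std_brownian M b \<Longrightarrow> AE \<omega> in M. b 0 \<omega> = 0"
  by (auto simp: std_brownian_def)

lemma brownian_value:
  assumes b: "std_brownian M b" and t: "t \<in> {0..1}"
  shows "integrable M (b t)" and "expectation (b t) = 0"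
    and "integrable M (\<lambda>\<omega>. (b t \<omega>)\<^sup>2)" and "expectation (\<lambda>\<omega>. (b t \<omega>)\<^sup>2) = t"
proof -
  have m [measurable]: "b t \<in> borel_measurable M" "b 0 \<in> borel_measurable M"
    using brownian_measurable[OF b] t by auto
  have AE: "AE \<omega> in M. b t \<omega> = b t \<omega> - b 0 \<omega>" "AE \<omega> in M. (b t \<omega>)\<^sup>2 = (b t \<omega> - b 0 \<omega>)\<^sup>2"
    using brownian_start[OF b] by auto
  have "integrable M (b t) \<and> expectation (b t) = 0 \<and>
      integrable M (\<lambda>\<omega>. (b t \<omega>)\<^sup>2) \<and> expectation (\<lambda>\<omega>. (b t \<omega>)\<^sup>2) = t"
  proof (cases "t = 0")
    case True
    have z: "AE \<omega> in M. b t \<omega> = 0" "AE \<omega> in M. (b t \<omega>)\<^sup>2 = 0" using brownian_start[OF b] True by auto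
    have "integrable M (b t) \<longleftrightarrow> integrable M (\<lambda>_. 0 :: real)"
      "integrable M (\<lambda>\<omega>. (b t \<omega>)\<^sup>2) \<longleftrightarrow> integrable M (\<lambda>_. 0 :: real)"
      using z by (intro integrable_cong_AE; simp)+
    moreover have "expectation (b t) = expectation (\<lambda>_. 0)"
      "expectation (\<lambda>\<omega>. (b t \<omega>)\<^sup>2) = expectation (\<lambda>_. 0)"
      using z by (intro integral_cong_AE; simp)+
    ultimately show ?thesis using True by simp
  next
    case False
    then have st: "0 < t" "t \<le> 1" using t by auto
    have "integrable M (b t) \<longleftrightarrow> integrable M (\<lambda>\<omega>. b t \<omega> - b 0 \<omega>)"
      "integrable M (\<lambda>\<omega>. (b t \<omega>)\<^sup>2) \<longleftrightarrow> integrable M (\<lambda>\<omega>. (b t \<omega> - b 0 \<omega>)\<^sup>2)"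
      using AE by (intro integrable_cong_AE; simp)+
    moreover have "expectation (b t) = expectation (\<lambda>\<omega>. b t \<omega> - b 0 \<omega>)"
      "expectation (\<lambda>\<omega>. (b t \<omega>)\<^sup>2) = expectation (\<lambda>\<omega>. (b t \<omega> - b 0 \<omega>)\<^sup>2)"
      using AE by (intro integral_cong_AE; simp)+
    ultimately show ?thesis
      using brownian_increment(1)[OF b order_refl st, of 1] brownian_increment(1)[OF b order_refl st, of 2]
        brownian_increment(2,3)[OF b order_refl st] by simp
  qed
  then show "integrable M (b t)" "expectation (b t) = 0"
    "integrable M (\<lambda>\<omega>. (b t \<omega>)\<^sup>2)" "expectation (\<lambda>\<omega>. (b t \<omega>)\<^sup>2) = t" by auto
qed

text \<open>By polarisation, \<open>2 b\<^sub>s b\<^sub>t = b\<^sub>s\<^sup>2 + b\<^sub>t\<^sup>2 - (b\<^sub>t - b\<^sub>s)\<^sup>2\<close>, the covariance is determined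
  by the variances of the increments alone.\<close>

lemma brownian_covariance:
  assumes b: "std_brownian M b" and s: "s \<in> {0..1}" and t: "t \<in> {0..1}"
  shows "integrable M (\<lambda>\<omega>. b s \<omega> * b t \<omega>)" and "expectation (\<lambda>\<omega>. b s \<omega> * b t \<omega>) = min s t"
proof -
  have *: "integrable M (\<lambda>\<omega>. b s \<omega> * b t \<omega>) \<and> expectation (\<lambda>\<omega>. b s \<omega> * b t \<omega>) = s"
    if "s \<in> {0..1}" "t \<in> {0..1}" "s \<le> t" for s t
  proof (cases "s = t")
    case True
    then show ?thesis using brownian_value[OF b that(1)] by (simp add: power2_eq_square)
  next
    case False
    then have st: "0 \<le> s" "s < t" "t \<le> 1" using that by auto
    have eq: "b s \<omega> * b t \<omega> = ((b s \<omega>)\<^sup>2 + (b t \<omega>)\<^sup>2 - (b t \<omega> - b s \<omega>)\<^sup>2) / 2" for \<omega>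
      by (simp add: power2_eq_square algebra_simps)
    note int = brownian_value(3)[OF b that(1)] brownian_value(3)[OF b that(2)] brownian_increment(1)[OF b st, of 2]
    show ?thesis
      unfolding eq using int brownian_value(4)[OF b that(1)] brownian_value(4)[OF b that(2)]
        brownian_increment(3)[OF b st] by simp
  qed
  show "integrable M (\<lambda>\<omega>. b s \<omega> * b t \<omega>)" and "expectation (\<lambda>\<omega>. b s \<omega> * b t \<omega>) = min s t"
    using *[of s t] *[of t s] s t by (cases "s \<le> t"; simp add: mult.commute min_def)+
qed

text \<open>The centred squares of the increments are independent, and each has variance
  \<open>3 h\<^sup>2 - h\<^sup>2 = 2 h\<^sup>2\<close> by the fourth moment of the normal distribution.\<close>

lemma brownian_quadratic_variation:
  assumes b: "std_brownian M b" and "0 \<le> s" "0 < h" and le: "s + real m * h \<le> 1"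
  shows "sq_mom M (\<lambda>\<omega>. (\<Sum>i<m. (b (s + real (Suc i) * h) \<omega> - b (s + real i * h) \<omega>)\<^sup>2) - real m * h)
     \<le> ennreal (2 * real m * h\<^sup>2)"
proof -
  define u where "u i = s + real i * h" for i :: nat
  define D where "D i \<omega> = b (u (Suc i)) \<omega> - b (u i) \<omega>" for i \<omega>
  define Z where "Z i \<omega> = (D i \<omega>)\<^sup>2 - h" for i \<omega>
  have u1: "u i \<le> 1" if "i \<le> m" for i
  proof -
    have "real i * h \<le> real m * h" using that \<open>0 < h\<close> by (intro mult_right_mono) auto
    then show ?thesis using le by (simp add: u_def)
  qed
  have u: "0 \<le> u i" "u i < u (Suc i)" "u (Suc i) - u i = h" for i
    using assms by (auto simp: u_def algebra_simps)
  have u': "u i \<in> {0..1}" if "i \<le> m" for i using u1[OF that] u(1)[of i] by auto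
  have inc: "0 \<le> u i" "u i < u (Suc i)" "u (Suc i) \<le> 1" if "i < m" for i
    using u1[of "Suc i"] u that by auto
  have "indep_vars (\<lambda>_. borel) D {..<m}"
    using b u u' unfolding std_brownian_def D_def by blast
  then have "indep_vars (\<lambda>_. borel) (\<lambda>i x. (\<lambda>y. y\<^sup>2 - h) (D i x)) {..<m}"
    by (rule indep_vars_compose2) measurable
  then have ind: "indep_vars (\<lambda>_. borel) Z {..<m}" by (simp add: Z_def[abs_def])
  have int: "integrable M (\<lambda>\<omega>. (D i \<omega>) ^ k)" if "i < m" for i k
    unfolding D_def by (rule brownian_increment(1)[OF b inc[OF that]])
  have intZ: "integrable M (Z i)" if "i < m" for i
    unfolding Z_def using int[OF that, of 2] by simp
  have EZ: "expectation (Z i) = 0" if "i < m" for i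
    unfolding Z_def using int[OF that, of 2] brownian_increment(3)[OF b inc[OF that]] u(3)[of i]
    by (simp add: D_def prob_space)
  have Zsq: "(Z i \<omega>)\<^sup>2 = (D i \<omega>) ^ 4 - 2 * h * (D i \<omega>)\<^sup>2 + h\<^sup>2" for i \<omega>
  proof -
    have "(D i \<omega>) ^ 4 = ((D i \<omega>)\<^sup>2)\<^sup>2" by simp
    then show ?thesis unfolding Z_def by (simp only: power2_diff) simp
  qed
  have intZ2: "integrable M (\<lambda>\<omega>. (Z i \<omega>)\<^sup>2)" if "i < m" for i
    unfolding Zsq using int[OF that] by simp
  have EZ2: "expectation (\<lambda>\<omega>. (Z i \<omega>)\<^sup>2) = 2 * h\<^sup>2" if "i < m" for i
  proof -
    have "expectation (\<lambda>\<omega>. (D i \<omega>)\<^sup>2) = h" "expectation (\<lambda>\<omega>. (D i \<omega>) ^ 4) = 3 * h\<^sup>2"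
      using brownian_increment(3,4)[OF b inc[OF that]] u(3)[of i] by (simp_all add: D_def)
    moreover have "expectation (\<lambda>\<omega>. (D i \<omega>) ^ 4 - 2 * h * (D i \<omega>)\<^sup>2 + h\<^sup>2) =
        expectation (\<lambda>\<omega>. (D i \<omega>) ^ 4) - 2 * h * expectation (\<lambda>\<omega>. (D i \<omega>)\<^sup>2) + h\<^sup>2"
      using int[OF that] by (simp add: prob_space)
    ultimately show ?thesis unfolding Zsq by (simp add: power2_eq_square)
  qed
  have "sq_mom M (\<lambda>\<omega>. \<Sum>i<m. Z i \<omega>) = ennreal (\<Sum>i<m. expectation (\<lambda>\<omega>. (Z i \<omega>)\<^sup>2))"
  proof (rule sum_uncorrelated)
    fix i j assume ij: "i \<in> {..<m}" "j \<in> {..<m}"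
    show "integrable M (\<lambda>\<omega>. Z i \<omega> * Z j \<omega>)"
      using intZ2[of i] indep_vars_pair(1)[OF ind ij] intZ ij
      by (cases "i = j") (auto simp: power2_eq_square)
    assume "i \<noteq> j"
    then show "expectation (\<lambda>\<omega>. Z i \<omega> * Z j \<omega>) = 0"
      using indep_vars_pair(2)[OF ind ij] intZ EZ ij by auto
  qed simp
  also have "\<dots> = ennreal (2 * real m * h\<^sup>2)" by (simp add: EZ2)
  finally show ?thesis
    by (simp add: Z_def D_def u_def sum_subtractf)
qed

end

text \<open>Pairs of an integrand and its stochastic integral, for the noise with components \<open>w l\<close>,
  \<open>l \<in> G\<close>: the integrand is a function of the component and of time, and the indicator of
  \<open>{l} \<times> [0,t)\<close> has integral \<open>w l t\<close>. Closing these pairs under linear combinations gives an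
  isometry by bilinearity, whatever partitions the step functions use.\<close>

inductive elementary ::
  "('l \<Rightarrow> real \<Rightarrow> 'w \<Rightarrow> real) \<Rightarrow> 'l set \<Rightarrow> ('l \<Rightarrow> real \<Rightarrow> real) \<Rightarrow> ('w \<Rightarrow> real) \<Rightarrow> bool"
  for w G where
  point: "l \<in> G \<Longrightarrow> 0 \<le> t \<Longrightarrow> t \<le> 1 \<Longrightarrow>
    elementary w G (\<lambda>l' s. if l' = l then indicator {0..<t} s else 0) (w l t)"
| lin: "elementary w G f J \<Longrightarrow> elementary w G g K \<Longrightarrow>
    elementary w G (\<lambda>l s. a * f l s + c * g l s) (\<lambda>\<omega>. a * J \<omega> + c * K \<omega>)"

definition brownian_family :: "'w measure \<Rightarrow> ('l \<Rightarrow> real \<Rightarrow> 'w \<Rightarrow> real) \<Rightarrow> 'l set \<Rightarrow> bool" where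
  "brownian_family P w L \<longleftrightarrow> (\<forall>l\<in>L. std_brownian P (w l)) \<and>
     prob_space.indep_vars P (\<lambda>_. PiM {0..1} (\<lambda>_. borel)) (\<lambda>l \<omega>. \<lambda>t\<in>{0..1}. w l t \<omega>) L"

context prob_space begin

lemma brownian_family_uncorrelated:
  assumes fam: "brownian_family M w L" and l: "l \<in> L" "l' \<in> L" "l \<noteq> l'" and s: "s \<in> {0..1}" and t: "t \<in> {0..1}"
  shows "integrable M (\<lambda>\<omega>. w l s \<omega> * w l' t \<omega>)" and "expectation (\<lambda>\<omega>. w l s \<omega> * w l' t \<omega>) = 0"
proof -
  \<comment> \<open>The independence of the processes is needed at the time \<open>s\<close> for one component and \<open>t\<close> for the
    other.\<close>
  define T where "T k = (if k = l then s else t)" for k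
  have T: "T k \<in> {0..1}" for k using s t by (auto simp: T_def)
  have proc: "indep_vars (\<lambda>_. PiM {0..1} (\<lambda>_. borel)) (\<lambda>k \<omega>. \<lambda>t\<in>{0..1}. w k t \<omega>) L"
    using fam unfolding brownian_family_def by blast
  have "indep_vars (\<lambda>_. borel) (\<lambda>k \<omega>. (\<lambda>x. x (T k)) (\<lambda>t\<in>{0..1}. w k t \<omega>)) L"
    by (rule indep_vars_compose2[OF proc]) (rule measurable_component_singleton[OF T])
  then have ind: "indep_vars (\<lambda>_. borel) (\<lambda>k. w k (T k)) L" using T by simp
  have b: "std_brownian M (w k)" if "k \<in> L" for k using fam that by (auto simp: brownian_family_def)
  note * = indep_vars_pair[OF ind l] brownian_value[OF b T]
  have "T l = s" "T l' = t" using l by (auto simp: T_def)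
  then show "integrable M (\<lambda>\<omega>. w l s \<omega> * w l' t \<omega>)" "expectation (\<lambda>\<omega>. w l s \<omega> * w l' t \<omega>) = 0"
    using * l by auto
qed

text \<open>Both sides are bilinear, so only pairs of generators matter: for equal components it is
  \<open>min s t = \<integral> 1\<^bsub>[0,s)\<^esub> 1\<^bsub>[0,t)\<^esub>\<close>, and different components are independent and centred.\<close>

lemma elementary_isometry:
  assumes fam: "brownian_family M w L" and G: "finite G" "G \<subseteq> L"
    and "elementary w G f J" "elementary w G g K"
  shows "integrable M (\<lambda>\<omega>. J \<omega> * K \<omega>) \<and> (\<forall>l\<in>G. integrable lborel (\<lambda>s. f l s * g l s)) \<and>
     expectation (\<lambda>\<omega>. J \<omega> * K \<omega>) = (\<Sum>l\<in>G. \<integral>s. f l s * g l s \<partial>lborel)"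
  using assms(5)
proof (induction rule: elementary.induct)
  case (point l t)
  from assms(4) show ?case
  proof (induction rule: elementary.induct)
    case (point k s)
    have b: "std_brownian M (w l)" using fam \<open>l \<in> G\<close> G by (auto simp: brownian_family_def)
    let ?f = "\<lambda>l' u. (if l' = k then indicator {0..<s} u else 0) * (if l' = l then indicator {0..<t} u else 0) :: real"
    have f: "?f l' = (\<lambda>u. if l' = l \<and> l = k then indicator {0..<min s t} u else 0)" for l'
      by (auto simp: fun_eq_iff indicator_def)
    have int: "integrable lborel (?f l')" for l'
    proof (cases "l' = l \<and> l = k")
      case True
      then have "?f l' = indicator {0..<min s t}" unfolding f by auto
      moreover have "emeasure lborel {0..<min s t} < \<infinity>"
        using point(2) \<open>0 \<le> t\<close> by simp
      ultimately show ?thesis by (simp add: integrable_indicator_iff)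
    next
      case False
      then have "?f l' = (\<lambda>_. 0)" unfolding f by auto
      then show ?thesis by simp
    qed
    have sum: "(\<Sum>l'\<in>G. \<integral>u. ?f l' u \<partial>lborel) = (if l = k then min s t else 0)"
    proof -
      have "(\<Sum>l'\<in>G. \<integral>u. ?f l' u \<partial>lborel) = (\<Sum>l'\<in>G. if l' = l then (if l = k then min s t else 0) else 0)"
        unfolding f using point(2) \<open>0 \<le> t\<close> by (intro sum.cong refl) auto
      then show ?thesis using G \<open>l \<in> G\<close> by simp
    qed
    show ?case
      using int sum brownian_covariance[OF b, of s t] brownian_family_uncorrelated[OF fam, of k l s t]
        point \<open>l \<in> G\<close> \<open>0 \<le> t\<close> \<open>t \<le> 1\<close> G by auto
  next
    case (lin f J g K a c)
    have e: "(a * J \<omega> + c * K \<omega>) * w l t \<omega> = a * (J \<omega> * w l t \<omega>) + c * (K \<omega> * w l t \<omega>)"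
      "(a * f l' s + c * g l' s) * y = a * (f l' s * y) + c * (g l' s * y)" for \<omega> l' s y
      by (auto simp: algebra_simps)
    from lin show ?case unfolding e
      by (intro conjI ballI) (simp_all add: sum.distrib sum_distrib_left)
  qed
next
  case (lin g K h I a c)
  have e: "J \<omega> * (a * K \<omega> + c * I \<omega>) = a * (J \<omega> * K \<omega>) + c * (J \<omega> * I \<omega>)"
    "f l s * (a * g l s + c * h l s) = a * (f l s * g l s) + c * (f l s * h l s)" for \<omega> l s
    by (auto simp: algebra_simps)
  from lin show ?case unfolding e
    by (intro conjI ballI) (simp_all add: sum.distrib sum_distrib_left)
qed

lemma elementary_measurable:
  assumes fam: "brownian_family M w L" and G: "G \<subseteq> L" and "elementary w G f J"
  shows "J \<in> borel_measurable M \<and> (\<forall>l. f l \<in> borel_measurable borel)"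
  using assms(3)
proof (induction rule: elementary.induct)
  case (point l t)
  then have "w l t \<in> borel_measurable M"
    using fam G by (intro brownian_measurable) (auto simp: brownian_family_def)
  moreover have "(\<lambda>s. if l' = l then indicator {0..<t} s else 0 :: real) \<in> borel_measurable borel" for l'
    by (cases "l' = l") auto
  ultimately show ?case by blast
next
  case (lin f J g K a c)
  then have [measurable]: "J \<in> borel_measurable M" "K \<in> borel_measurable M"
    "\<And>l. f l \<in> borel_measurable borel" "\<And>l. g l \<in> borel_measurable borel" by auto
  show ?case by auto
qed

lemma elementary_sq_mom:
  assumes fam: "brownian_family M w L" and G: "finite G" "G \<subseteq> L" and el: "elementary w G f J"
  shows "sq_mom M J = (\<Sum>l\<in>G. sq_mom lborel (f l))"
proof -
  note iso = elementary_isometry[OF fam G el el, folded power2_eq_square]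
  have "sq_mom M J = ennreal (expectation (\<lambda>\<omega>. (J \<omega>)\<^sup>2))"
    unfolding sq_mom_def using iso by (intro nn_integral_eq_integral) auto
  also have "\<dots> = (\<Sum>l\<in>G. ennreal (\<integral>s. (f l s)\<^sup>2 \<partial>lborel))"
    using iso by (simp add: sum_ennreal)
  also have "\<dots> = (\<Sum>l\<in>G. sq_mom lborel (f l))"
    unfolding sq_mom_def using iso by (intro sum.cong refl nn_integral_eq_integral[symmetric]) auto
  finally show ?thesis .
qed

end

lemma elementary_step_integral:
  assumes l: "l \<in> G" and u0: "u 0 = 0" and mono: "\<forall>i<m. u i \<le> u (Suc i)" and u1: "u m \<le> 1"
  shows "elementary w G (\<lambda>l' s. if l' = l then step_fun m u c s else 0) (step_integral (w l) m u c)"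
  using mono u1
proof (induction m)
  case 0
  have "elementary w G (\<lambda>l' s. 0 * (if l' = l then indicator {0..<0} s else 0) + 0 * (if l' = l then indicator {0..<0} s else 0))
     (\<lambda>\<omega>. 0 * w l 0 \<omega> + 0 * w l 0 \<omega>)"
    using l by (intro elementary.lin elementary.point) auto
  then show ?case by (simp add: step_fun_def step_integral_def if_distrib cong: if_cong)
next
  case (Suc m)
  have le: "u m \<le> u (Suc m)" "u m \<le> 1" "u (Suc m) \<le> 1" using Suc.prems by auto
  have "0 \<le> u i" if "i \<le> m" for i
    using that
  proof (induction i)
    case (Suc j)
    then show ?case using Suc.prems \<open>\<forall>i<Suc m. u i \<le> u (Suc i)\<close> by (meson Suc_leD Suc_le_lessD le_SucI less_SucI order_trans)
  qed (simp add: u0)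
  then have um: "0 \<le> u m" by simp
  have "elementary w G (\<lambda>l' s. if l' = l then step_fun m u c s else 0) (step_integral (w l) m u c)"
    using Suc by auto
  moreover have "elementary w G
     (\<lambda>l' s. c m * (if l' = l then indicator {0..<u (Suc m)} s else 0) + - c m * (if l' = l then indicator {0..<u m} s else 0))
     (\<lambda>\<omega>. c m * w l (u (Suc m)) \<omega> + - c m * w l (u m) \<omega>)"
    using l le um by (intro elementary.lin elementary.point) auto
  ultimately have "elementary w G
     (\<lambda>l' s. 1 * (if l' = l then step_fun m u c s else 0) + 1 *
       (c m * (if l' = l then indicator {0..<u (Suc m)} s else 0) + - c m * (if l' = l then indicator {0..<u m} s else 0)))
     (\<lambda>\<omega>. 1 * step_integral (w l) m u c \<omega> + 1 * (c m * w l (u (Suc m)) \<omega> + - c m * w l (u m) \<omega>))"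
    by (rule elementary.lin)
  also have "(\<lambda>l' s. 1 * (if l' = l then step_fun m u c s else 0) + 1 *
       (c m * (if l' = l then indicator {0..<u (Suc m)} s else 0) + - c m * (if l' = l then indicator {0..<u m} s else 0)))
     = (\<lambda>l' s. if l' = l then step_fun (Suc m) u c s else 0)"
    using le um by (auto simp: fun_eq_iff step_fun_def indicator_def)
  also have "(\<lambda>\<omega>. 1 * step_integral (w l) m u c \<omega> + 1 * (c m * w l (u (Suc m)) \<omega> + - c m * w l (u m) \<omega>))
     = step_integral (w l) (Suc m) u c"
    by (auto simp: fun_eq_iff step_integral_def algebra_simps)
  finally show ?case .
qed

text \<open>The \<open>L\<^sup>2\<close> closure of the elementary pairs. Unlike \<^const>\<open>is_wiener_integral\<close>, whose step
  functions live on partitions of one fixed interval and integrate against one Brownian motion,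
  this class contains differences of integrals over different intervals and sums over several
  components.\<close>

definition wiener_limit ::
  "'w measure \<Rightarrow> ('l \<Rightarrow> real \<Rightarrow> 'w \<Rightarrow> real) \<Rightarrow> 'l set \<Rightarrow> ('l \<Rightarrow> real \<Rightarrow> real) \<Rightarrow> ('w \<Rightarrow> real) \<Rightarrow> bool" where
  "wiener_limit P w G f J \<longleftrightarrow> J \<in> borel_measurable P \<and> (\<forall>l\<in>G. f l \<in> borel_measurable borel) \<and>
     (\<exists>\<phi> Y. (\<forall>k::nat. elementary w G (\<phi> k) (Y k)) \<and>
        (\<forall>l\<in>G. (\<lambda>k. sq_mom lborel (\<lambda>s. \<phi> k l s - f l s)) \<longlonglongrightarrow> 0) \<and>
        (\<lambda>k. sq_mom P (\<lambda>\<omega>. Y k \<omega> - J \<omega>)) \<longlonglongrightarrow> 0)"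

lemma sq_mom_tendsto_lin:
  assumes "\<And>k::nat. Y k \<in> borel_measurable P" "\<And>k. Z k \<in> borel_measurable P"
    and "(\<lambda>k. sq_mom P (Y k)) \<longlonglongrightarrow> 0" "(\<lambda>k. sq_mom P (Z k)) \<longlonglongrightarrow> 0"
  shows "(\<lambda>k. sq_mom P (\<lambda>\<omega>. a * Y k \<omega> + c * Z k \<omega>)) \<longlonglongrightarrow> 0"
proof (rule tendsto_sandwich[of "\<lambda>_. 0"])
  have "sq_mom P (\<lambda>\<omega>. a * Y k \<omega> + c * Z k \<omega>)
      \<le> 2 * (ennreal (a\<^sup>2) * sq_mom P (Y k)) + 2 * (ennreal (c\<^sup>2) * sq_mom P (Z k))" for k
    using sq_mom_add_le[of "\<lambda>\<omega>. a * Y k \<omega>" P "\<lambda>\<omega>. c * Z k \<omega>"] assms(1,2)[of k] by (simp add: sq_mom_cmult)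
  then show "\<forall>\<^sub>F k in sequentially. sq_mom P (\<lambda>\<omega>. a * Y k \<omega> + c * Z k \<omega>)
      \<le> 2 * (ennreal (a\<^sup>2) * sq_mom P (Y k)) + 2 * (ennreal (c\<^sup>2) * sq_mom P (Z k))" by simp
  have "(\<lambda>k. 2 * (ennreal (a\<^sup>2) * sq_mom P (Y k)) + 2 * (ennreal (c\<^sup>2) * sq_mom P (Z k)))
      \<longlonglongrightarrow> 2 * (ennreal (a\<^sup>2) * 0) + 2 * (ennreal (c\<^sup>2) * 0)"
    by (intro tendsto_add ennreal_tendsto_cmult assms) auto
  then show "(\<lambda>k. 2 * (ennreal (a\<^sup>2) * sq_mom P (Y k)) + 2 * (ennreal (c\<^sup>2) * sq_mom P (Z k))) \<longlonglongrightarrow> 0"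
    by simp
qed auto

context prob_space begin

lemma wiener_limit_lin:
  assumes fam: "brownian_family M w L" and G: "G \<subseteq> L"
    and f: "wiener_limit M w G f J" and g: "wiener_limit M w G g K"
  shows "wiener_limit M w G (\<lambda>l s. a * f l s + c * g l s) (\<lambda>\<omega>. a * J \<omega> + c * K \<omega>)"
proof -
  from f obtain \<phi> Y where 1: "\<And>k::nat. elementary w G (\<phi> k) (Y k)"
    "\<And>l. l \<in> G \<Longrightarrow> (\<lambda>k. sq_mom lborel (\<lambda>s. \<phi> k l s - f l s)) \<longlonglongrightarrow> 0"
    "(\<lambda>k. sq_mom M (\<lambda>\<omega>. Y k \<omega> - J \<omega>)) \<longlonglongrightarrow> 0" "J \<in> borel_measurable M" "\<And>l. l \<in> G \<Longrightarrow> f l \<in> borel_measurable borel"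
    unfolding wiener_limit_def by blast
  from g obtain \<psi> Z where 2: "\<And>k::nat. elementary w G (\<psi> k) (Z k)"
    "\<And>l. l \<in> G \<Longrightarrow> (\<lambda>k. sq_mom lborel (\<lambda>s. \<psi> k l s - g l s)) \<longlonglongrightarrow> 0"
    "(\<lambda>k. sq_mom M (\<lambda>\<omega>. Z k \<omega> - K \<omega>)) \<longlonglongrightarrow> 0" "K \<in> borel_measurable M" "\<And>l. l \<in> G \<Longrightarrow> g l \<in> borel_measurable borel"
    unfolding wiener_limit_def by blast
  note m = elementary_measurable[OF fam G 1(1)] elementary_measurable[OF fam G 2(1)]
  have "elementary w G (\<lambda>l s. a * \<phi> k l s + c * \<psi> k l s) (\<lambda>\<omega>. a * Y k \<omega> + c * Z k \<omega>)" for k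
    by (intro elementary.lin 1 2)
  moreover have "(\<lambda>k. sq_mom lborel (\<lambda>s. (a * \<phi> k l s + c * \<psi> k l s) - (a * f l s + c * g l s))) \<longlonglongrightarrow> 0" if "l \<in> G" for l
  proof -
    have "(\<lambda>k. sq_mom lborel (\<lambda>s. a * (\<phi> k l s - f l s) + c * (\<psi> k l s - g l s))) \<longlonglongrightarrow> 0"
      using 1(2,5)[OF that] 2(2,5)[OF that] m
      by (intro sq_mom_tendsto_lin borel_measurable_diff) auto
    then show ?thesis by (simp add: algebra_simps)
  qed
  moreover have "(\<lambda>k. sq_mom M (\<lambda>\<omega>. (a * Y k \<omega> + c * Z k \<omega>) - (a * J \<omega> + c * K \<omega>))) \<longlonglongrightarrow> 0"
  proof -
    have "(\<lambda>k. sq_mom M (\<lambda>\<omega>. a * (Y k \<omega> - J \<omega>) + c * (Z k \<omega> - K \<omega>))) \<longlonglongrightarrow> 0"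
      using 1(3,4) 2(3,4) m by (intro sq_mom_tendsto_lin borel_measurable_diff) auto
    then show ?thesis by (simp add: algebra_simps)
  qed
  moreover have "(\<lambda>\<omega>. a * J \<omega> + c * K \<omega>) \<in> borel_measurable M" using 1 2 by auto
  moreover have "\<forall>l\<in>G. (\<lambda>s. a * f l s + c * g l s) \<in> borel_measurable borel" using 1 2 by auto
  ultimately show ?thesis unfolding wiener_limit_def by fast
qed

text \<open>The Ito isometry as an inequality, with a factor \<open>2\<close> lost in each of the two passages to the
  limit, in the integrand and in the integral.\<close>

lemma wiener_limit_sq_mom:
  assumes fam: "brownian_family M w L" and G: "finite G" "G \<subseteq> L" and f: "wiener_limit M w G f J"
  shows "sq_mom M J \<le> 4 * (\<Sum>l\<in>G. sq_mom lborel (f l))"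
proof -
  from f obtain \<phi> Y where 1: "\<And>k::nat. elementary w G (\<phi> k) (Y k)"
    "\<And>l. l \<in> G \<Longrightarrow> (\<lambda>k. sq_mom lborel (\<lambda>s. \<phi> k l s - f l s)) \<longlonglongrightarrow> 0"
    "(\<lambda>k. sq_mom M (\<lambda>\<omega>. Y k \<omega> - J \<omega>)) \<longlonglongrightarrow> 0" "J \<in> borel_measurable M" "\<And>l. l \<in> G \<Longrightarrow> f l \<in> borel_measurable borel"
    unfolding wiener_limit_def by blast
  note m = elementary_measurable[OF fam G(2) 1(1)]
  have "sq_mom M J \<le> 2 * (\<Sum>l\<in>G. 2 * 0 + 2 * sq_mom lborel (f l))"
  proof (rule sq_mom_limit_le[OF _ 1(4,3)])
    show "((\<lambda>k. \<Sum>l\<in>G. 2 * sq_mom lborel (\<lambda>s. \<phi> k l s - f l s) + 2 * sq_mom lborel (f l))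
        \<longlongrightarrow> (\<Sum>l\<in>G. 2 * 0 + 2 * sq_mom lborel (f l))) sequentially"
      by (intro tendsto_sum tendsto_add ennreal_tendsto_cmult 1 tendsto_const) auto
    have "sq_mom M (Y k) \<le> (\<Sum>l\<in>G. 2 * sq_mom lborel (\<lambda>s. \<phi> k l s - f l s) + 2 * sq_mom lborel (f l))" for k
      unfolding elementary_sq_mom[OF fam G 1(1)]
    proof (rule sum_mono)
      fix l assume l: "l \<in> G"
      have "sq_mom lborel (\<lambda>s. (\<phi> k l s - f l s) + f l s)
          \<le> 2 * sq_mom lborel (\<lambda>s. \<phi> k l s - f l s) + 2 * sq_mom lborel (f l)"
        using m 1(5)[OF l] by (intro sq_mom_add_le borel_measurable_diff) auto
      then show "sq_mom lborel (\<phi> k l) \<le> 2 * sq_mom lborel (\<lambda>s. \<phi> k l s - f l s) + 2 * sq_mom lborel (f l)"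
        by simp
    qed
    then show "\<forall>\<^sub>F k in sequentially. sq_mom M (Y k) \<le> (\<Sum>l\<in>G. 2 * sq_mom lborel (\<lambda>s. \<phi> k l s - f l s) + 2 * sq_mom lborel (f l))"
      by simp
  qed (use m in auto)
  then show ?thesis by (simp add: sum_distrib_left[symmetric] mult.assoc[symmetric])
qed

lemma wiener_limit_elementary:
  assumes fam: "brownian_family M w L" and G: "G \<subseteq> L" and el: "elementary w G f J"
  shows "wiener_limit M w G f J"
  unfolding wiener_limit_def using elementary_measurable[OF fam G el] el
  by (auto intro!: exI[of _ "\<lambda>_. f"] exI[of _ "\<lambda>_. J"] simp: sq_mom_def)

lemma wiener_limit_integral:
  assumes l: "l \<in> G" and t: "t \<in> {0..1}" and I: "is_wiener_integral M (w l) t f I"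
  shows "wiener_limit M w G (\<lambda>l' s. if l' = l then indicator {0..t} s * f s else 0) I"
proof -
  from I obtain m u c where
    f: "set_borel_measurable borel {0..t} f" and I: "I \<in> borel_measurable M" and
    u: "\<And>k::nat. u k 0 = 0 \<and> u k (m k) = t \<and> (\<forall>i<m k. u k i \<le> u k (Suc i))" and
    lim: "(\<lambda>k. \<integral>\<^sup>+s\<in>{0..t}. ennreal ((step_fun (m k) (u k) (c k) s - f s)\<^sup>2) \<partial>lborel) \<longlonglongrightarrow> 0"
      "(\<lambda>k. \<integral>\<^sup>+\<omega>. ennreal ((step_integral (w l) (m k) (u k) (c k) \<omega> - I \<omega>)\<^sup>2) \<partial>M) \<longlonglongrightarrow> 0"
    unfolding is_wiener_integral_def by blast
  \<comment> \<open>The partitions end at \<open>t\<close>, so the convergence on \<open>[0,t]\<close> is convergence on the whole line.\<close>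
  have out: "step_fun (m k) (u k) (c k) s = 0" if "s \<notin> {0..t}" for k s
  proof -
    have mono: "u k i \<le> u k j" if "i \<le> j" "j \<le> m k" for i j
      using that(1,2)
    proof (induction j rule: dec_induct)
      case (step n)
      then show ?case using u[of k] by (meson Suc_leD Suc_le_lessD order_trans)
    qed simp
    have "indicator {u k i..<u k (Suc i)} s = (0::real)" if "i < m k" for i
    proof -
      have "0 \<le> u k i" "u k (Suc i) \<le> t" using mono[of 0 i] mono[of "Suc i" "m k"] u[of k] that by auto
      then show ?thesis using \<open>s \<notin> {0..t}\<close> by (auto simp: indicator_def)
    qed
    then show ?thesis unfolding step_fun_def by (intro sum.neutral) auto
  qed
  have eq: "sq_mom lborel (\<lambda>s. step_fun (m k) (u k) (c k) s - indicator {0..t} s * f s)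
     = (\<integral>\<^sup>+s\<in>{0..t}. ennreal ((step_fun (m k) (u k) (c k) s - f s)\<^sup>2) \<partial>lborel)" for k
    unfolding sq_mom_def by (intro nn_integral_cong) (auto simp: out indicator_def)
  let ?\<phi> = "\<lambda>k l' s. if l' = l then step_fun (m k) (u k) (c k) s else 0"
    and ?f = "\<lambda>l' s. if l' = l then indicator {0..t} s * f s else 0"
  have el: "elementary w G (?\<phi> k) (step_integral (w l) (m k) (u k) (c k))" for k
    using u[of k] t l by (intro elementary_step_integral) auto
  have fl: "(\<lambda>k. sq_mom lborel (\<lambda>s. ?\<phi> k l' s - ?f l' s)) \<longlonglongrightarrow> 0" for l'
  proof (cases "l' = l")
    case True
    then show ?thesis using lim(1) by (simp add: eq)
  next
    case False
    then show ?thesis by (simp add: sq_mom_def)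
  qed
  have fm: "?f l' \<in> borel_measurable borel" for l'
    using f by (cases "l' = l") (simp_all add: set_borel_measurable_def)
  show ?thesis
    unfolding wiener_limit_def
  proof (intro conjI I exI allI ballI)
    show "elementary w G (?\<phi> k) (step_integral (w l) (m k) (u k) (c k))" for k by (rule el)
    show "(\<lambda>k. sq_mom M (\<lambda>\<omega>. step_integral (w l) (m k) (u k) (c k) \<omega> - I \<omega>)) \<longlonglongrightarrow> 0"
      using lim(2) by (simp add: sq_mom_def)
      show "(\<lambda>k. sq_mom lborel (\<lambda>s. ?\<phi> k l' s - ?f l' s)) \<longlonglongrightarrow> 0" for l' by (rule fl)
    show "?f l' \<in> borel_measurable borel" for l' by (rule fm)
  qed
qed

end

section \<open>The eigenfunctions\<close>

definition cube :: "(real ^ 'd::finite) set" where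
  "cube = {y. \<forall>k. 0 \<le> y $ k \<and> y $ k \<le> 1}"

lemma cube_eq_cbox: "cube = cbox 0 (\<chi> k. 1)"
  by (auto simp: cube_def mem_box_cart)

lemma dom_eq_box: "dom = box 0 (\<chi> k. 1)"
  by (auto simp: dom_def mem_box_cart)

lemma closure_dom: "closure dom = (cube :: (real ^ 'd::finite) set)"
proof -
  have "(1/2) *\<^sub>R (\<chi> k. 1) \<in> (box 0 (\<chi> k. 1) :: (real ^ 'd) set)" by (simp add: mem_box_cart)
  then have "box 0 (\<chi> k. 1) \<noteq> ({} :: (real ^ 'd) set)" by blast
  then show ?thesis by (simp add: dom_eq_box cube_eq_cbox)
qed

lemma compact_cube: "compact cube" by (simp add: cube_eq_cbox)
lemma dom_subset_cube: "dom \<subseteq> cube" by (auto simp: dom_def cube_def less_imp_le)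
lemma dom_sets [measurable]: "dom \<in> sets borel" by (simp add: dom_eq_box)
lemma norm_cube_le: "y \<in> cube \<Longrightarrow> norm (y :: real ^ 'd::finite) \<le> real CARD('d)"
proof -
  assume "y \<in> cube"
  then have "(\<Sum>k\<in>UNIV. \<bar>y $ k\<bar>) \<le> (\<Sum>k\<in>(UNIV :: 'd set). 1)" by (intro sum_mono) (auto simp: cube_def)
  then show ?thesis using norm_le_l1_cart[of y] by simp
qed

lemma inner_cube_le: "y \<in> cube \<Longrightarrow> \<bar>\<kappa> \<bullet> (y :: real ^ 'd::finite)\<bar> \<le> norm \<kappa> * real CARD('d)"
  by (rule order_trans[OF Cauchy_Schwarz_ineq2]) (intro mult_left_mono norm_cube_le; simp)

lemma abs_exp_diff_le:
  assumes "a \<le> c" "b \<le> c" shows "\<bar>exp a - exp b\<bar> \<le> exp c * \<bar>a - b :: real\<bar>"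
proof -
  have *: "exp b - exp a \<le> exp c * (b - a)" if "a \<le> b" "b \<le> c" for a b
  proof -
    have "exp b - exp a = exp b * (1 - exp (a - b))" by (simp add: exp_diff field_simps)
    also have "\<dots> \<le> exp b * (b - a)" using exp_ge_add_one_self[of "a - b"] by (intro mult_left_mono) (linarith, simp)
    also have "\<dots> \<le> exp c * (b - a)" using that by (intro mult_right_mono) auto
    finally show ?thesis .
  qed
  show ?thesis using *[of a b] *[of b a] assms by (cases "a \<le> b") auto
qed

lemma sqlen_ge_card: "l \<in> multi_idx \<Longrightarrow> real CARD('d) \<le> sqlen (l :: nat ^ 'd::finite)"
proof -
  assume "l \<in> multi_idx"
  then have "(\<Sum>k\<in>(UNIV :: 'd set). 1) \<le> sqlen l" unfolding sqlen_def by (intro sum_mono) (auto simp: multi_idx_def)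
  then show ?thesis by simp
qed

lemma sqlen_ge_1: "l \<in> multi_idx \<Longrightarrow> 1 \<le> sqlen (l :: nat ^ 'd::finite)"
  using sqlen_ge_card[of l] by (metis One_nat_def Suc_leI finite_UNIV_card_ge_0 finite order_trans of_nat_1 of_nat_mono)

lemma component_sq_le_sqlen: "(real (l $ k))\<^sup>2 \<le> sqlen l"
  unfolding sqlen_def by (rule member_le_sum) auto

lemma component_le_sqrt_sqlen: "real (l $ k) \<le> sqrt (sqlen l)"
  using component_sq_le_sqlen[of l k] by (simp add: real_le_rsqrt)

text \<open>The eigenvalue is an affine function of \<open>\<bar>l\<bar>\<^sup>2\<close> with positive slope, and its quotient by
  \<open>\<bar>l\<bar>\<^sup>2\<close> is smallest at infinity or, when the constant term is negative, at \<open>l = (1,\<dots>,1)\<close>, where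
  it is positive by assumption.\<close>

lemma eigval_lower_bound:
  fixes \<theta>1 :: "real ^ 'd::finite"
  assumes "0 < \<theta>2" and pos: "0 < eigval \<theta>0 \<theta>1 \<theta>2 (\<chi> k. 1)"
  shows "\<exists>c>0. \<forall>l\<in>multi_idx. c * sqlen l \<le> eigval \<theta>0 \<theta>1 \<theta>2 l"
proof -
  define b where "b = (norm \<theta>1)\<^sup>2 / (4 * \<theta>2) - \<theta>0"
  have d: "0 < real CARD('d)" by simp
  have s1: "sqlen (\<chi> k. 1 :: nat ^ 'd) = real CARD('d)" by (simp add: sqlen_def)
  have pb: "0 < \<theta>2 * pi\<^sup>2 * real CARD('d) + b" using pos unfolding eigval_def s1 b_def by linarith
  define c where "c = \<theta>2 * pi\<^sup>2 + min b 0 / real CARD('d)"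
  have "0 < c"
  proof (cases "b \<ge> 0")
    case True then show ?thesis using assms(1) by (simp add: c_def)
  next
    case False
    then have "c * real CARD('d) = \<theta>2 * pi\<^sup>2 * real CARD('d) + b" by (simp add: c_def distrib_right)
    then have "0 < c * real CARD('d)" using pb by linarith
    then show ?thesis using d by (simp only: zero_less_mult_iff) linarith
  qed
  moreover have "c * sqlen l \<le> eigval \<theta>0 \<theta>1 \<theta>2 l" if "l \<in> multi_idx" for l :: "nat ^ 'd"
  proof -
    have "1 \<le> sqlen l / real CARD('d)" using sqlen_ge_card[OF that] d by simp
    then have "min b 0 * (sqlen l / real CARD('d)) \<le> min b 0 * 1" by (intro mult_left_mono_neg) auto
    moreover have "c * sqlen l = \<theta>2 * pi\<^sup>2 * sqlen l + min b 0 * (sqlen l / real CARD('d))"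
      by (simp add: c_def distrib_right)
    moreover have "min b 0 \<le> b" by simp
    ultimately show ?thesis unfolding eigval_def b_def[symmetric] add_diff_eq[symmetric] by linarith
  qed
  ultimately show ?thesis by blast
qed

lemma vec_box_eq: "{j :: 'a ^ 'd::finite. \<forall>k. j $ k \<in> B k} = vec_lambda ` (PiE UNIV B)"
  by (auto simp: image_iff PiE_def extensional_def intro!: bexI[of _ "\<lambda>k. _ $ k"])

lemma vec_box_inj: "inj_on (vec_lambda :: ('d::finite \<Rightarrow> 'a) \<Rightarrow> 'a ^ 'd) S"
  by (auto simp: inj_on_def vec_lambda_inject)

lemma finite_vec_box: "(\<And>k. finite (B k)) \<Longrightarrow> finite {j :: 'a ^ 'd::finite. \<forall>k. j $ k \<in> B k}"
  unfolding vec_box_eq by (intro finite_imageI finite_PiE) auto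

lemma sum_vec_box:
  fixes f :: "'d::finite \<Rightarrow> 'a \<Rightarrow> real"
  assumes "\<And>k. finite (B k)"
  shows "(\<Sum>j | \<forall>k. j $ k \<in> B k. \<Prod>k\<in>UNIV. f k (j $ k)) = (\<Prod>k\<in>UNIV. \<Sum>i\<in>B k. f k i)"
  unfolding vec_box_eq using assms by (simp add: sum.reindex vec_box_inj prod_sum_PiE)

text \<open>Since \<open>\<bar>l\<bar>\<^sup>2\<close> dominates every \<open>l\<^sub>k\<^sup>2\<close>, the term \<open>\<bar>l\<bar>\<^sup>-\<^sup>2\<^sup>p\<close> is at most the product over \<open>k\<close>
  of \<open>l\<^sub>k\<close> to the power \<open>-2p/d\<close>, and the sum over a box factorises into convergent one-dimensional
  series.\<close>

lemma sqlen_powr_sum_bounded: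
  assumes "real CARD('d) < 2 * p"
  shows "\<exists>C\<ge>0. \<forall>F. finite F \<longrightarrow> F \<subseteq> (multi_idx :: (nat ^ 'd::finite) set) \<longrightarrow> (\<Sum>l\<in>F. sqlen l powr (- p)) \<le> C"
proof -
  \<comment> \<open>The exponent of the one-dimensional series; it exceeds one by assumption.\<close>
  define q where "q = 2 * p / real CARD('d)"
  have q: "q > 1" using assms by (simp add: q_def)
  have sm: "summable (\<lambda>i. real i powr (- q))" using q by (simp add: summable_real_powr_iff)
  define S where "S = (\<Sum>i. real i powr (- q))"
  have le_prod: "sqlen l powr (- p) \<le> (\<Prod>k\<in>UNIV. real (l $ k) powr (- q))" if l: "l \<in> multi_idx" for l :: "nat ^ 'd"
  proof -
    have s: "1 \<le> sqlen l" by (rule sqlen_ge_1[OF l])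
    have "sqlen l powr (- q / 2) \<le> real (l $ k) powr (- q)" for k
    proof -
      have lk: "1 \<le> real (l $ k)" using l by (auto simp: multi_idx_def)
      have "sqlen l powr (- q / 2) \<le> ((real (l $ k))\<^sup>2) powr (- q / 2)"
        using component_sq_le_sqlen[of l k] q lk by (intro powr_mono2') auto
      also have "\<dots> = real (l $ k) powr (- q)"
      proof -
        have "(real (l $ k))\<^sup>2 = real (l $ k) powr 2" using lk by simp
        then show ?thesis by (simp only: powr_powr) simp
      qed
      finally show ?thesis .
    qed
    then have "(\<Prod>k\<in>(UNIV :: 'd set). sqlen l powr (- q / 2)) \<le> (\<Prod>k\<in>UNIV. real (l $ k) powr (- q))"
      by (intro prod_mono) auto
    moreover have "(\<Prod>k\<in>(UNIV :: 'd set). sqlen l powr (- q / 2)) = sqlen l powr (- p)"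
      using s by (simp add: powr_power q_def)
    ultimately show ?thesis by simp
  qed
  have "(\<Sum>l\<in>F. sqlen l powr (- p)) \<le> S ^ CARD('d)" if F: "finite F" "F \<subseteq> multi_idx" for F :: "(nat ^ 'd) set"
  proof -
    define m where "m = Max (insert 0 ((\<lambda>(l, k). l $ k) ` (F \<times> UNIV)))"
    have m: "l $ k \<le> m" if "l \<in> F" for l k
      unfolding m_def using F that by (intro Max_ge) auto
    have "(\<Sum>l\<in>F. sqlen l powr (- p)) \<le> (\<Sum>l\<in>F. \<Prod>k\<in>UNIV. real (l $ k) powr (- q))"
      using F by (intro sum_mono le_prod) auto
    also have "\<dots> \<le> (\<Sum>l\<in>{l :: nat ^ 'd. \<forall>k. l $ k \<in> {..m}}. \<Prod>k\<in>UNIV. real (l $ k) powr (- q))"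
    proof (rule sum_mono2)
      show "finite {l :: nat ^ 'd. \<forall>k. l $ k \<in> {..m}}" by (rule finite_vec_box) simp
      show "F \<subseteq> {l. \<forall>k. l $ k \<in> {..m}}" using m by auto
    qed (intro prod_nonneg, simp)
    also have "\<dots> = (\<Prod>k\<in>(UNIV :: 'd set). \<Sum>i\<in>{..m}. real i powr (- q))"
      by (rule sum_vec_box) auto
    also have "\<dots> \<le> (\<Prod>k\<in>(UNIV :: 'd set). S)"
      unfolding S_def by (intro prod_mono conjI sum_nonneg sum_le_suminf sm) auto
    finally show ?thesis by simp
  qed
  moreover have "0 \<le> S" unfolding S_def by (intro suminf_nonneg sm) auto
  ultimately show ?thesis by (intro exI[of _ "S ^ CARD('d)"]) auto
qed

lemma min_comp_le: "min_comp M \<le> M $ k"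
  unfolding min_comp_def by (intro Min_le) auto

lemma min_comp_multi_idx: "1 \<le> min_comp M \<Longrightarrow> M \<in> multi_idx"
  using min_comp_le[of M] by (auto simp: multi_idx_def intro: order_trans)

lemma eigfun_bound:
  fixes \<kappa> :: "real ^ 'd::finite"
  shows "\<exists>C\<ge>0. \<forall>l. \<forall>y\<in>cube. \<bar>eigfun \<kappa> l y\<bar> \<le> C"
proof -
  let ?C = "2 powr (real CARD('d) / 2) * exp (norm \<kappa> * real CARD('d)) * 1"
  have "\<bar>eigfun \<kappa> l y\<bar> \<le> ?C" if "y \<in> cube" for l y
  proof -
    have "- (\<kappa> \<bullet> y) / 2 \<le> norm \<kappa> * real CARD('d)" using inner_cube_le[OF that, of \<kappa>] by (auto simp: abs_le_iff)
    moreover have "(\<Prod>k\<in>(UNIV :: 'd set). \<bar>sin (pi * real (l $ k) * y $ k)\<bar>) \<le> 1"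
      by (intro prod_le_1) auto
    ultimately show ?thesis
      unfolding eigfun_def abs_mult abs_prod by (intro mult_mono) (auto intro!: prod_nonneg)
  qed
  then show ?thesis by (intro exI[of _ ?C]) auto
qed

lemma abs_sin_diff_le: "\<bar>sin a - sin b\<bar> \<le> \<bar>a - b :: real\<bar>"
proof -
  have "sin a - sin b = 2 * sin ((a - b) / 2) * cos ((a + b) / 2)" by (rule sin_diff_sin)
  then have "\<bar>sin a - sin b\<bar> = 2 * \<bar>sin ((a - b) / 2)\<bar> * \<bar>cos ((a + b) / 2)\<bar>" by (simp add: abs_mult)
  also have "\<dots> \<le> 2 * \<bar>(a - b) / 2\<bar> * 1"
    using abs_sin_x_le_abs_x[of "(a - b) / 2"] by (intro mult_mono mult_left_mono) auto
  finally show ?thesis by simp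
qed

lemma eigfun_lipschitz:
  fixes \<kappa> :: "real ^ 'd::finite"
  shows "\<exists>C\<ge>0. \<forall>l\<in>multi_idx. \<forall>y\<in>cube. \<forall>y'\<in>cube. \<forall>h\<ge>0. (\<forall>k. \<bar>y $ k - y' $ k\<bar> \<le> h) \<longrightarrow>
     \<bar>eigfun \<kappa> l y - eigfun \<kappa> l y'\<bar> \<le> C * (h * sqrt (sqlen l))"
proof -
  let ?d = "real CARD('d)" and ?A = "2 powr (real CARD('d) / 2)" and ?E = "exp (norm \<kappa> * real CARD('d))"
  let ?C = "?A * (?E * (norm \<kappa> * ?d) + ?E * (pi * ?d))"
  have "\<bar>eigfun \<kappa> l y - eigfun \<kappa> l y'\<bar> \<le> ?C * (h * sqrt (sqlen l))"
    if l: "l \<in> multi_idx" and y: "y \<in> cube" "y' \<in> cube" and h: "h \<ge> 0" "\<forall>k. \<bar>y $ k - y' $ k\<bar> \<le> h" for l y y' h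
  proof -
    let ?q = "sqrt (sqlen l)"
    have q: "1 \<le> ?q" using sqlen_ge_1[OF l] by simp
    define a b where "a = exp (- (\<kappa> \<bullet> y) / 2)" and "b = exp (- (\<kappa> \<bullet> y') / 2)"
    define s t where "s = (\<Prod>k\<in>UNIV. sin (pi * real (l $ k) * y $ k))" and "t = (\<Prod>k\<in>UNIV. sin (pi * real (l $ k) * y' $ k))"
    have le: "- (\<kappa> \<bullet> y) / 2 \<le> norm \<kappa> * ?d" "- (\<kappa> \<bullet> y') / 2 \<le> norm \<kappa> * ?d"
      using inner_cube_le[OF y(1), of \<kappa>] inner_cube_le[OF y(2), of \<kappa>] by (auto simp: abs_le_iff)
    have "norm (y - y') \<le> (\<Sum>k\<in>UNIV. \<bar>(y - y') $ k\<bar>)" by (rule norm_le_l1_cart)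
    also have "\<dots> \<le> (\<Sum>k\<in>(UNIV :: 'd set). h)" using h by (intro sum_mono) auto
    finally have nd: "norm (y - y') \<le> ?d * h" by simp
    have "\<bar>a - b\<bar> \<le> ?E * \<bar>- (\<kappa> \<bullet> y) / 2 - - (\<kappa> \<bullet> y') / 2\<bar>"
      unfolding a_def b_def by (rule abs_exp_diff_le[OF le])
    also have "\<dots> \<le> ?E * (norm \<kappa> * (?d * h))"
    proof (rule mult_left_mono)
      have "\<bar>- (\<kappa> \<bullet> y) / 2 - - (\<kappa> \<bullet> y') / 2\<bar> \<le> \<bar>\<kappa> \<bullet> (y - y')\<bar>" by (simp add: inner_diff_right)
      also have "\<dots> \<le> norm \<kappa> * norm (y - y')" by (rule Cauchy_Schwarz_ineq2)
      also have "\<dots> \<le> norm \<kappa> * (?d * h)" by (intro mult_left_mono nd) auto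
      finally show "\<bar>- (\<kappa> \<bullet> y) / 2 - - (\<kappa> \<bullet> y') / 2\<bar> \<le> norm \<kappa> * (?d * h)" .
    qed simp
    also have "\<dots> \<le> ?E * (norm \<kappa> * (?d * (h * ?q)))"
      using h q by (intro mult_left_mono) (auto simp: mult_le_cancel_left1)
    finally have ab: "\<bar>a - b\<bar> \<le> ?E * (norm \<kappa> * ?d) * (h * ?q)" by (simp add: mult_ac)
    have "\<bar>s - t\<bar> \<le> (\<Sum>k\<in>UNIV. \<bar>sin (pi * real (l $ k) * y $ k) - sin (pi * real (l $ k) * y' $ k)\<bar>)"
      unfolding s_def t_def using norm_prod_diff[of UNIV "\<lambda>k. sin (pi * real (l $ k) * y $ k)" "\<lambda>k. sin (pi * real (l $ k) * y' $ k)"]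
      by simp
    also have "\<dots> \<le> (\<Sum>k\<in>(UNIV :: 'd set). pi * (h * ?q))"
    proof (rule sum_mono)
      fix k
      have "\<bar>sin (pi * real (l $ k) * y $ k) - sin (pi * real (l $ k) * y' $ k)\<bar>
          \<le> \<bar>pi * real (l $ k) * y $ k - pi * real (l $ k) * y' $ k\<bar>" by (rule abs_sin_diff_le)
      also have "\<dots> = pi * real (l $ k) * \<bar>y $ k - y' $ k\<bar>"
        by (simp add: abs_mult right_diff_distrib[symmetric])
      also have "\<dots> \<le> pi * ?q * h"
        using h q component_le_sqrt_sqlen[of l k] by (intro mult_mono mult_nonneg_nonneg) auto
      finally show "\<bar>sin (pi * real (l $ k) * y $ k) - sin (pi * real (l $ k) * y' $ k)\<bar> \<le> pi * (h * ?q)"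
        by (simp add: mult_ac)
    qed
    finally have st: "\<bar>s - t\<bar> \<le> (pi * ?d) * (h * ?q)" by (simp add: mult_ac)
    have s1: "\<bar>s\<bar> \<le> 1" unfolding s_def abs_prod by (intro prod_le_1) auto
    have b1: "\<bar>b\<bar> \<le> ?E" unfolding b_def using le by simp
    have "eigfun \<kappa> l y - eigfun \<kappa> l y' = ?A * ((a - b) * s + b * (s - t))"
      unfolding eigfun_def a_def b_def s_def t_def by (simp add: algebra_simps)
    then have "\<bar>eigfun \<kappa> l y - eigfun \<kappa> l y'\<bar> = ?A * \<bar>(a - b) * s + b * (s - t)\<bar>" by (simp add: abs_mult)
    also have "\<dots> \<le> ?A * (\<bar>a - b\<bar> * \<bar>s\<bar> + \<bar>b\<bar> * \<bar>s - t\<bar>)"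
      by (intro mult_left_mono) (auto simp: abs_mult[symmetric] intro: abs_triangle_ineq)
    also have "\<dots> \<le> ?A * ((?E * (norm \<kappa> * ?d) * (h * ?q)) * 1 + ?E * ((pi * ?d) * (h * ?q)))"
      using ab st s1 b1 by (intro mult_left_mono add_mono mult_mono) auto
    finally show ?thesis by (simp add: algebra_simps)
  qed
  then show ?thesis by (intro exI[of _ ?C]) auto
qed

text \<open>Interpolation between the uniform bound and the Lipschitz bound, whose constant grows like
  \<open>\<bar>l\<bar>\<close>. The smaller the exponent, the slower the growth in \<open>l\<close>, which is what makes the series
  over \<open>l\<close> converge later.\<close>

lemma eigfun_holder:
  fixes \<kappa> :: "real ^ 'd::finite"
  assumes s: "0 \<le> s" "s \<le> 1"
  shows "\<exists>C\<ge>0. \<forall>l\<in>multi_idx. \<forall>y\<in>cube. \<forall>y'\<in>cube. \<forall>h>0. (\<forall>k. \<bar>y $ k - y' $ k\<bar> \<le> h) \<longrightarrow>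
     \<bar>eigfun \<kappa> l y - eigfun \<kappa> l y'\<bar> \<le> C * (h * sqrt (sqlen l)) powr s"
proof -
  obtain B where B: "B \<ge> 0" "\<And>l y. y \<in> cube \<Longrightarrow> \<bar>eigfun \<kappa> l y\<bar> \<le> B"
    using eigfun_bound[of \<kappa>] by blast
  obtain C where C: "C \<ge> 0" "\<And>l y y' h. l \<in> multi_idx \<Longrightarrow> y \<in> cube \<Longrightarrow> y' \<in> cube \<Longrightarrow> h \<ge> 0 \<Longrightarrow>
     (\<forall>k. \<bar>y $ k - y' $ k\<bar> \<le> h) \<Longrightarrow> \<bar>eigfun \<kappa> l y - eigfun \<kappa> l y'\<bar> \<le> C * (h * sqrt (sqlen l))"
    using eigfun_lipschitz[of \<kappa>] by blast
  have "\<bar>eigfun \<kappa> l y - eigfun \<kappa> l y'\<bar> \<le> (2 * B + C) * (h * sqrt (sqlen l)) powr s"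
    if *: "l \<in> multi_idx" "y \<in> cube" "y' \<in> cube" "h > 0" "\<forall>k. \<bar>y $ k - y' $ k\<bar> \<le> h" for l y y' h
  proof -
    define x where "x = h * sqrt (sqlen l)"
    have x: "x > 0" using * sqlen_ge_1[OF *(1)] by (simp add: x_def)
    show ?thesis
    proof (cases "x \<le> 1")
      case True
      have "\<bar>eigfun \<kappa> l y - eigfun \<kappa> l y'\<bar> \<le> C * x" unfolding x_def using * by (intro C) auto
      also have "\<dots> \<le> C * x powr s"
        using powr_mono'[of s 1 x] s x True C(1) by (intro mult_left_mono) auto
      also have "\<dots> \<le> (2 * B + C) * x powr s" using B(1) by (intro mult_right_mono) auto
      finally show ?thesis by (simp add: x_def)
    next
      case False
      have "\<bar>eigfun \<kappa> l y - eigfun \<kappa> l y'\<bar> \<le> 2 * B"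
        using B(2)[OF *(2), of l] B(2)[OF *(3), of l] by linarith
      also have "\<dots> \<le> (2 * B + C) * 1" using C(1) by simp
      also have "\<dots> \<le> (2 * B + C) * x powr s"
        using False s ge_one_powr_ge_zero[of x s] B(1) C(1) by (intro mult_left_mono) auto
      finally show ?thesis by (simp add: x_def)
    qed
  qed
  then show ?thesis using B(1) C(1) by (intro exI[of _ "2 * B + C"]) auto
qed

lemma continuous_eigfun: "continuous_on S (eigfun \<kappa> l)"
  unfolding eigfun_def[abs_def] by (intro continuous_intros) auto

lemma measurable_eigfun [measurable]: "eigfun \<kappa> l \<in> borel_measurable borel"
  by (intro borel_measurable_continuous_onI continuous_eigfun)

lemma set_integrable_cube:
  assumes "continuous_on UNIV (f :: real ^ 'd::finite \<Rightarrow> real)" "S \<subseteq> cube" "S \<in> sets borel"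
  shows "set_integrable lborel S f"
proof (rule set_integrable_subset)
  show "set_integrable lborel cube f"
    unfolding set_integrable_def
    using assms by (intro borel_integrable_compact compact_cube) (auto intro: continuous_on_subset)
qed (use assms in auto)

lemma eigfun_L2D: "eigfun \<kappa> l \<in> L2D"
  unfolding L2D_def mem_Collect_eq
proof
  show "set_borel_measurable lborel dom (eigfun \<kappa> l)"
    unfolding set_borel_measurable_def by measurable
  show "set_integrable lborel dom (\<lambda>y. (eigfun \<kappa> l y)\<^sup>2)"
    by (intro set_integrable_cube dom_subset_cube dom_sets continuous_intros continuous_eigfun)
qed

lemma integral_prod_cart:
  fixes h :: "'d::finite \<Rightarrow> real \<Rightarrow> real"
  assumes "\<And>k. integrable lborel (h k)"
  shows "(\<integral>y. (\<Prod>k\<in>UNIV. h k (y $ k)) \<partial>(lborel :: (real ^ 'd) measure)) = (\<Prod>k\<in>UNIV. \<integral>x. h k x \<partial>lborel)"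
proof -
  interpret product_sigma_finite "\<lambda>_ :: real ^ 'd. lborel :: real measure" ..
  have bij: "bij_betw (\<lambda>k. axis k 1) UNIV (Basis :: (real ^ 'd) set)"
    by (auto simp: bij_betw_def inj_on_def axis_eq_axis Basis_vec_def)
  have [measurable]: "h k \<in> borel_measurable borel" for k using borel_measurable_integrable[OF assms[of k]] by simp
  have prod: "(\<Prod>k\<in>UNIV. g (axis k 1)) = (\<Prod>b\<in>Basis. g b)" for g :: "real ^ 'd \<Rightarrow> real"
    by (rule prod.reindex_bij_betw[OF bij])
  have comp: "(\<Sum>b\<in>Basis. f b *\<^sub>R b) $ k = f (axis k 1)" for f :: "real ^ 'd \<Rightarrow> real" and k
  proof -
    have "axis k 1 \<in> (Basis :: (real ^ 'd) set)" using bij by (auto simp: bij_betw_def)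
    then show ?thesis unfolding cart_eq_inner_axis by (rule inner_sum_left_Basis)
  qed
  have "(\<integral>y. (\<Prod>k\<in>UNIV. h k (y $ k)) \<partial>(lborel :: (real ^ 'd) measure))
      = (\<integral>f. (\<Prod>k\<in>UNIV. h k ((\<Sum>b\<in>Basis. f b *\<^sub>R b :: real ^ 'd) $ k)) \<partial>(\<Pi>\<^sub>M b\<in>Basis. lborel))"
    by (subst lborel_eq, subst integral_distr) auto
  also have "\<dots> = (\<integral>f. (\<Prod>b\<in>Basis. h (axis_index b) (f b)) \<partial>(\<Pi>\<^sub>M b\<in>(Basis :: (real ^ 'd) set). lborel))"
    unfolding comp by (intro Bochner_Integration.integral_cong refl, subst prod[symmetric]) simp
  also have "\<dots> = (\<Prod>b\<in>(Basis :: (real ^ 'd) set). \<integral>x. h (axis_index b) x \<partial>lborel)"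
    by (rule product_integral_prod) (auto intro: assms)
  also have "\<dots> = (\<Prod>k\<in>UNIV. \<integral>x. h k x \<partial>lborel)"
    by (subst prod[symmetric]) simp
  finally show ?thesis .
qed

lemma cos_integral:
  fixes n :: int
  shows "integrable lborel (\<lambda>x. cos (real_of_int n * pi * x) * indicator {0..1} x)"
    and "(\<integral>x. cos (real_of_int n * pi * x) * indicator {0..1} x \<partial>lborel) = (if n = 0 then 1 else 0)"
proof -
  have "has_bochner_integral lborel (\<lambda>x. cos (real_of_int n * pi * x) * indicator {0..1} x) (if n = 0 then 1 else 0)"
  proof (cases "n = 0")
    case True
    then show ?thesis using has_bochner_integral_integrable[of lborel "indicator {0..1::real} :: real \<Rightarrow> real"]
      by (simp add: integrable_indicator_iff)
  next
    case False
    let ?c = "real_of_int n * pi"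
    have c: "?c \<noteq> 0" using False by simp
    have "has_bochner_integral lborel (\<lambda>x. cos (?c * x) * indicator {0..1} x) (sin (?c * 1) / ?c - sin (?c * 0) / ?c)"
      using c by (intro has_bochner_integral_FTC_Icc_real) (auto intro!: derivative_eq_intros)
    moreover have "sin ?c = 0" using sin_zero_iff_int2 by blast
    ultimately show ?thesis using False by simp
  qed
  then show "integrable lborel (\<lambda>x. cos (real_of_int n * pi * x) * indicator {0..1} x)"
    "(\<integral>x. cos (real_of_int n * pi * x) * indicator {0..1} x \<partial>lborel) = (if n = 0 then 1 else 0)"
    by (auto simp: has_bochner_integral_iff)
qed

lemma sin_orthonormal:
  fixes a b :: nat
  assumes "1 \<le> a" "1 \<le> b"
  shows "integrable lborel (\<lambda>x. indicator {0<..<1} x * (2 * sin (pi * real a * x) * sin (pi * real b * x)))"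
    and "(\<integral>x. indicator {0<..<1} x * (2 * sin (pi * real a * x) * sin (pi * real b * x)) \<partial>lborel) = (if a = b then 1 else 0)"
proof -
  let ?f = "\<lambda>x. indicator {0<..<1} x * (2 * sin (pi * real a * x) * sin (pi * real b * x))"
  let ?g = "\<lambda>x. cos (real_of_int (int a - int b) * pi * x) * indicator {0..1} x
     - cos (real_of_int (int a + int b) * pi * x) * indicator {0..1} x"
  \<comment> \<open>The product of sines becomes a difference of cosines whose frequencies are integer multiples
    of \<open>\<pi>\<close>; only frequency zero has a nonzero integral over \<open>[0,1]\<close>.\<close>
  have tr: "2 * sin (pi * real a * x) * sin (pi * real b * x)
      = cos (real_of_int (int a - int b) * pi * x) - cos (real_of_int (int a + int b) * pi * x)" for x
    by (simp add: cos_diff cos_add algebra_simps)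
  have AE: "AE x in lborel. ?f x = ?g x"
  proof -
    have "AE x in lborel. x \<noteq> 0 \<and> x \<noteq> (1::real)" by (intro AE_conjI AE_lborel_singleton)
    then show ?thesis
    proof eventually_elim
      case (elim x)
      then show ?case unfolding tr by (auto simp: indicator_def)
    qed
  qed
  have fm: "?f \<in> borel_measurable lborel" by measurable
  have gm: "?g \<in> borel_measurable lborel" by measurable
  have "integrable lborel ?g" by (intro Bochner_Integration.integrable_diff cos_integral)
  then show "integrable lborel ?f" using integrable_cong_AE[OF fm gm AE] by simp
  have "(\<integral>x. ?f x \<partial>lborel) = (\<integral>x. ?g x \<partial>lborel)" by (rule integral_cong_AE[OF fm gm AE])
  also have "\<dots> = (if int a - int b = 0 then 1 else 0) - (if int a + int b = 0 then 1 else 0)"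
    by (subst Bochner_Integration.integral_diff[OF cos_integral(1) cos_integral(1)]) (simp only: cos_integral(2))
  also have "\<dots> = (if a = b then 1 else 0)" using assms by auto
  finally show "(\<integral>x. ?f x \<partial>lborel) = (if a = b then 1 else 0)" .
qed

text \<open>The weight \<open>exp(\<kappa>\<^sup>T y)\<close> cancels the two exponential factors, and what remains is a product
  of one-dimensional integrals of products of sines.\<close>

lemma eigfun_orthonormal:
  fixes \<kappa> :: "real ^ 'd::finite"
  assumes "l \<in> multi_idx" "l' \<in> multi_idx"
  shows "ip \<kappa> (eigfun \<kappa> l) (eigfun \<kappa> l') = (if l = l' then 1 else 0)"
proof -
  let ?h = "\<lambda>k x. indicator {0<..<1} x * (2 * sin (pi * real (l $ k) * x) * sin (pi * real (l' $ k) * x))"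
  have k: "1 \<le> l $ k" "1 \<le> l' $ k" for k using assms by (auto simp: multi_idx_def)
  have ind: "indicator dom y = (\<Prod>k\<in>UNIV. indicator {0<..<1} (y $ k) :: real)" for y :: "real ^ 'd"
  proof (cases "y \<in> dom")
    case False
    then obtain k where "y $ k \<notin> {0<..<1}" by (auto simp: dom_def)
    then have "(\<Prod>k\<in>UNIV. indicator {0<..<1} (y $ k) :: real) = 0" by (intro prod_zero) (auto simp: indicator_def)
    then show ?thesis using False by simp
  qed (auto simp: dom_def indicator_def)
  have pw: "2 powr (real CARD('d) / 2) * 2 powr (real CARD('d) / 2) = (\<Prod>k\<in>(UNIV :: 'd set). 2 :: real)"
    by (simp add: powr_add[symmetric] powr_realpow)
  have ex: "exp (- (\<kappa> \<bullet> y) / 2) * exp (- (\<kappa> \<bullet> y) / 2) * exp (\<kappa> \<bullet> y) = 1" for y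
    by (simp add: exp_add[symmetric])
  have "indicator dom y * (eigfun \<kappa> l y * eigfun \<kappa> l' y * exp (\<kappa> \<bullet> y)) = (\<Prod>k\<in>UNIV. ?h k (y $ k))" for y
  proof -
    have "indicator dom y * (eigfun \<kappa> l y * eigfun \<kappa> l' y * exp (\<kappa> \<bullet> y)) =
      indicator dom y * (2 powr (real CARD('d) / 2) * 2 powr (real CARD('d) / 2)) *
      (exp (- (\<kappa> \<bullet> y) / 2) * exp (- (\<kappa> \<bullet> y) / 2) * exp (\<kappa> \<bullet> y)) *
      ((\<Prod>k\<in>UNIV. sin (pi * real (l $ k) * y $ k)) * (\<Prod>k\<in>UNIV. sin (pi * real (l' $ k) * y $ k)))"
      unfolding eigfun_def by (simp only: mult_ac)
    also have "\<dots> = (\<Prod>k\<in>UNIV. ?h k (y $ k))"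
      unfolding pw ex ind by (simp only: prod.distrib mult_1_right mult.assoc)
    finally show ?thesis .
  qed
  then have "ip \<kappa> (eigfun \<kappa> l) (eigfun \<kappa> l') = (\<integral>y. (\<Prod>k\<in>UNIV. ?h k (y $ k)) \<partial>lborel)"
    unfolding ip_def set_lebesgue_integral_def by simp
  also have "\<dots> = (\<Prod>k\<in>UNIV. \<integral>x. ?h k x \<partial>lborel)"
    by (rule integral_prod_cart) (intro sin_orthonormal k)
  also have "\<dots> = (\<Prod>k\<in>UNIV. if l $ k = l' $ k then 1 else 0)"
    by (intro prod.cong refl sin_orthonormal k)
  also have "\<dots> = (if l = l' then 1 else 0)"
  proof (cases "l = l'")
    case False
    then obtain k where "l $ k \<noteq> l' $ k" by (auto simp: vec_eq_iff)
    then have "(\<Prod>k\<in>UNIV. if l $ k = l' $ k then 1 else 0) = (0 :: real)" by (intro prod_zero) auto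
    then show ?thesis using False by simp
  qed simp
  finally show ?thesis .
qed

section \<open>Averages over the cells of the spatial grid\<close>

definition grid :: "nat ^ 'd::finite \<Rightarrow> (nat ^ 'd) set" where
  "grid M = {j. \<forall>k. 1 \<le> j $ k \<and> j $ k \<le> M $ k}"

definition cell_coef :: "nat ^ 'd::finite \<Rightarrow> nat ^ 'd \<Rightarrow> real ^ 'd \<Rightarrow> nat ^ 'd \<Rightarrow> real" where
  "cell_coef M l \<kappa> j = (LINT y:cell M j|lborel. eigfun \<kappa> l y * exp (\<kappa> \<bullet> y))"

lemma approx_coord_eq: "approx_coord M l \<kappa> x = (\<Sum>j\<in>grid M. x (space_pt M j) * cell_coef M l \<kappa> j)"
  by (simp add: approx_coord_def grid_def cell_coef_def)

lemma grid_eq: "grid M = {j. \<forall>k. j $ k \<in> {1..M $ k}}"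
  by (auto simp: grid_def)

lemma finite_grid: "finite (grid M)"
  unfolding grid_eq by (rule finite_vec_box) simp

lemma space_pt_cube: "(\<And>k. j $ k \<le> M $ k) \<Longrightarrow> space_pt M j \<in> cube"
  by (auto simp: space_pt_def cube_def divide_le_eq_1)

lemma space_pt_grid_cube: "j \<in> grid M \<Longrightarrow> space_pt M j \<in> cube"
  by (rule space_pt_cube) (auto simp: grid_def)

lemma cell_cbox: "cell M j = cbox (\<chi> k. (real (j $ k) - 1) / real (M $ k)) (\<chi> k. real (j $ k) / real (M $ k))"
  by (auto simp: cell_def mem_box_cart)

lemma cell_sets [measurable]: "cell M j \<in> sets borel"
  by (simp add: cell_cbox)

lemma cell_subset_cube:
  assumes "j \<in> grid M" shows "cell M j \<subseteq> cube"
proof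
  fix y assume y: "y \<in> cell M j"
  show "y \<in> cube" unfolding cube_def
  proof (intro CollectI allI conjI)
    fix k
    have j: "1 \<le> j $ k" "j $ k \<le> M $ k" using assms by (auto simp: grid_def)
    have y': "(real (j $ k) - 1) / real (M $ k) \<le> y $ k" "y $ k \<le> real (j $ k) / real (M $ k)"
      using y by (auto simp: cell_def)
    have "0 \<le> (real (j $ k) - 1) / real (M $ k)" "real (j $ k) / real (M $ k) \<le> 1"
      using j by (auto simp: divide_le_eq_1)
    then show "0 \<le> y $ k" "y $ k \<le> 1" using y' by linarith+
  qed
qed

lemma measure_cell:
  assumes "M \<in> multi_idx"
  shows "measure lborel (cell M j) = (\<Prod>k\<in>UNIV. 1 / real (M $ k))"
proof -
  let ?a = "\<chi> k. (real (j $ k) - 1) / real (M $ k)" and ?b = "\<chi> k. real (j $ k) / real (M $ k)"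
  have M: "0 < real (M $ k)" for k using assms by (auto simp: multi_idx_def Suc_le_eq)
  have "?a $ k \<le> ?b $ k" for k using M[of k] by (simp add: divide_right_mono)
  then have "?a \<in> cbox ?a ?b" by (auto simp: mem_box_cart)
  then have "measure lborel (cbox ?a ?b) = (\<Prod>k\<in>UNIV. ?b $ k - ?a $ k)"
    by (intro content_cbox_cart) auto
  also have "\<dots> = (\<Prod>k\<in>UNIV. 1 / real (M $ k))"
    using M by (intro prod.cong refl) (simp add: diff_divide_distrib)
  finally show ?thesis by (simp add: cell_cbox)
qed

lemma sum_measure_cell:
  assumes "M \<in> multi_idx"
  shows "(\<Sum>j\<in>grid M. measure lborel (cell M j)) = 1"
proof -
  have M: "0 < real (M $ k)" for k using assms by (auto simp: multi_idx_def Suc_le_eq)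
  have "(\<Sum>j\<in>grid M. measure lborel (cell M j)) = (\<Sum>j\<in>grid M. \<Prod>k\<in>UNIV. 1 / real (M $ k))"
    by (simp add: measure_cell[OF assms])
  also have "\<dots> = (\<Prod>k\<in>UNIV. \<Sum>i\<in>{1..M $ k}. 1 / real (M $ k))"
    unfolding grid_eq by (rule sum_vec_box[where f="\<lambda>k _. 1 / real (M $ k)"]) simp
  also have "\<dots> = 1" using M by (simp add: less_imp_neq[symmetric])
  finally show ?thesis .
qed

text \<open>The closed cells overlap, and together with the boundary of the cube differ from a
  partition, only on the grid hyperplanes.\<close>

lemma AE_cells_partition:
  fixes M :: "nat ^ 'd::finite"
  assumes M: "M \<in> multi_idx"
  shows "AE y in lborel. indicator dom y = (\<Sum>j\<in>grid M. indicator (cell M j) y :: real)"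
proof -
  define N where "N = (\<Union>k. \<Union>i\<in>{..M $ k}. {y :: real ^ 'd. y $ k = real i / real (M $ k)})"
  have Mp: "0 < real (M $ k)" for k using M by (auto simp: multi_idx_def Suc_le_eq)
  have "negligible {y :: real ^ 'd. y $ k = c}" for k c
    by (simp add: cart_eq_inner_axis negligible_standard_hyperplane)
  then have "negligible N" unfolding N_def
    by (intro negligible_Union finite_imageI) (auto intro!: negligible_Union)
  then have "AE y in completion lborel. y \<notin> N"
    by (simp add: negligible_iff_null_sets AE_not_in)
  then have "AE y in lborel. y \<notin> N"
    using AE_completion_iff by blast
  then show ?thesis
  proof eventually_elim
    case (elim y)
    have off: "y $ k \<noteq> real i / real (M $ k)" if "i \<le> M $ k" for k i
      using elim that by (auto simp: N_def)
    show ?case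
    proof (cases "y \<in> dom")
      case False
      have "y \<notin> cell M j" if "j \<in> grid M" for j
      proof
        assume "y \<in> cell M j"
        then have "y \<in> cube" using cell_subset_cube[OF that] by blast
        moreover have "y $ k \<noteq> 0" "y $ k \<noteq> 1" for k
          using off[of 0 k] off[of "M $ k" k] Mp[of k] by auto
        ultimately have "y \<in> dom" by (auto simp: cube_def dom_def order.strict_iff_order)
        with False show False ..
      qed
      then show ?thesis using False by simp
    next
      case True
      then have y: "0 < y $ k" "y $ k < 1" for k by (auto simp: dom_def)
      \<comment> \<open>The index of the cell that contains \<open>y\<close>.\<close>
      define j where "j = (\<chi> k. nat \<lceil>real (M $ k) * y $ k\<rceil>)"
      have pos: "0 < real (M $ k) * y $ k" "real (M $ k) * y $ k \<le> real (M $ k)" for k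
        using y[of k] Mp[of k] by (auto simp: mult_le_cancel_left1)
      have jr: "real (j $ k) = of_int \<lceil>real (M $ k) * y $ k\<rceil>" for k
        using pos(1)[of k] by (simp add: j_def)
      have j: "real (j $ k) - 1 < real (M $ k) * y $ k" "real (M $ k) * y $ k \<le> real (j $ k)" for k
        unfolding jr by linarith+
      have jM: "1 \<le> j $ k" "j $ k \<le> M $ k" for k
      proof -
        have "0 < real (j $ k)" using j(2)[of k] pos(1)[of k] by linarith
        then show "1 \<le> j $ k" by simp
        have "real (j $ k) < real (M $ k) + 1" using j(1)[of k] pos(2)[of k] by linarith
        then show "j $ k \<le> M $ k" by linarith
      qed
      then have jg: "j \<in> grid M" by (auto simp: grid_def)
      have "y \<in> cell M i \<longleftrightarrow> i = j" if i: "i \<in> grid M" for i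
      proof
        assume "i = j"
        then show "y \<in> cell M i"
          using j Mp by (auto simp: cell_def divide_le_eq le_divide_eq mult.commute less_imp_le)
      next
        assume c: "y \<in> cell M i"
        have "i $ k = j $ k" for k
        proof -
          have ik: "1 \<le> i $ k" "i $ k \<le> M $ k" using i by (auto simp: grid_def)
          have "y $ k \<noteq> real (i $ k - 1) / real (M $ k)" using ik by (intro off) auto
          then have "y $ k \<noteq> (real (i $ k) - 1) / real (M $ k)" using ik by (simp add: of_nat_diff)
          then have "(real (i $ k) - 1) / real (M $ k) < y $ k" "y $ k \<le> real (i $ k) / real (M $ k)"
            using c by (auto simp: cell_def order.strict_iff_order)
          then have "real (i $ k) - 1 < real (M $ k) * y $ k" "real (M $ k) * y $ k \<le> real (i $ k)"
            using Mp[of k] by (auto simp: divide_less_eq le_divide_eq mult.commute)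
          then have "real (i $ k) < real (j $ k) + 1" "real (j $ k) < real (i $ k) + 1"
            using j[of k] by linarith+
          then show ?thesis by linarith
        qed
        then show "i = j" by (simp add: vec_eq_iff)
      qed
      then have "(\<Sum>i\<in>grid M. indicator (cell M i) y :: real) = (\<Sum>i\<in>grid M. if i = j then 1 else 0)"
        by (intro sum.cong refl) (auto simp: indicator_def)
      then show ?thesis using jg True finite_grid[of M] by simp
    qed
  qed
qed

lemma integral_cells:
  fixes f :: "real ^ 'd::finite \<Rightarrow> real"
  assumes M: "M \<in> multi_idx" and f: "continuous_on UNIV f"
  shows "(LINT y:dom|lborel. f y) = (\<Sum>j\<in>grid M. LINT y:cell M j|lborel. f y)"
proof -
  have [measurable]: "f \<in> borel_measurable borel" using f by (rule borel_measurable_continuous_onI)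
  have int: "integrable lborel (\<lambda>y. indicator (cell M j) y *\<^sub>R f y)" if "j \<in> grid M" for j
    using set_integrable_cube[OF f cell_subset_cube[OF that] cell_sets] by (simp add: set_integrable_def)
  have "(LINT y:dom|lborel. f y) = (\<integral>y. (\<Sum>j\<in>grid M. indicator (cell M j) y *\<^sub>R f y) \<partial>lborel)"
    unfolding set_lebesgue_integral_def
  proof (rule integral_cong_AE)
    show "AE y in lborel. indicator dom y *\<^sub>R f y = (\<Sum>j\<in>grid M. indicator (cell M j) y *\<^sub>R f y)"
      using AE_cells_partition[OF M] by eventually_elim (simp add: sum_distrib_right)
  qed measurable
  also have "\<dots> = (\<Sum>j\<in>grid M. LINT y:cell M j|lborel. f y)"
    unfolding set_lebesgue_integral_def using int by (rule Bochner_Integration.integral_sum)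
  finally show ?thesis .
qed

lemma cell_integral_le:
  fixes f :: "real ^ 'd::finite \<Rightarrow> real"
  assumes "j \<in> grid M" "continuous_on UNIV f" "\<And>y. y \<in> cell M j \<Longrightarrow> \<bar>f y\<bar> \<le> B"
  shows "\<bar>LINT y:cell M j|lborel. f y\<bar> \<le> B * measure lborel (cell M j)"
proof -
  have fin: "emeasure lborel (cell M j) < \<infinity>" unfolding cell_cbox by (rule emeasure_lborel_cbox_finite)
  have int: "set_integrable lborel (cell M j) f"
    using assms by (intro set_integrable_cube cell_subset_cube) auto
  have "\<bar>LINT y:cell M j|lborel. f y\<bar> \<le> (\<integral>y. \<bar>indicator (cell M j) y *\<^sub>R f y\<bar> \<partial>lborel)"
    unfolding set_lebesgue_integral_def by (rule integral_abs_bound)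
  also have "\<dots> \<le> (\<integral>y. indicator (cell M j) y *\<^sub>R B \<partial>lborel)"
  proof (rule integral_mono)
    show "integrable lborel (\<lambda>y. \<bar>indicator (cell M j) y *\<^sub>R f y\<bar>)"
      using int unfolding set_integrable_def by (rule integrable_abs)
    show "integrable lborel (\<lambda>y. indicator (cell M j) y *\<^sub>R B)"
      using fin by (intro integrable_scaleR_left integrable_real_indicator) auto
  qed (use assms(3) in \<open>auto simp: indicator_def\<close>)
  also have "\<dots> = B * measure lborel (cell M j)" using fin by simp
  finally show ?thesis .
qed

text \<open>By orthonormality the Kronecker delta is the exact integral of which \<^const>\<open>approx_coord\<close> is the
  quadrature approximation, so the difference is controlled by the oscillation of \<open>eigfun \<kappa> l\<close>
  over a cell.\<close>

lemma approx_coord_eigfun: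
  fixes \<kappa> :: "real ^ 'd::finite"
  assumes s: "0 \<le> s" "s \<le> 1" and l0: "l0 \<in> multi_idx"
  shows "\<exists>C\<ge>0. \<forall>M l. 1 \<le> min_comp M \<longrightarrow> l \<in> multi_idx \<longrightarrow>
    \<bar>approx_coord M l0 \<kappa> (eigfun \<kappa> l) - (if l = l0 then 1 else 0)\<bar> \<le> C * (sqrt (sqlen l) / real (min_comp M)) powr s"
proof -
  obtain B where B: "B \<ge> 0" "\<And>l y. y \<in> cube \<Longrightarrow> \<bar>eigfun \<kappa> l y\<bar> \<le> B"
    using eigfun_bound[of \<kappa>] by blast
  obtain C where C: "C \<ge> 0" "\<And>l y y' h. l \<in> multi_idx \<Longrightarrow> y \<in> cube \<Longrightarrow> y' \<in> cube \<Longrightarrow> h > 0 \<Longrightarrow>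
     (\<forall>k. \<bar>y $ k - y' $ k\<bar> \<le> h) \<Longrightarrow> \<bar>eigfun \<kappa> l y - eigfun \<kappa> l y'\<bar> \<le> C * (h * sqrt (sqlen l)) powr s"
    using eigfun_holder[OF s, of \<kappa>] by blast
  let ?E = "exp (norm \<kappa> * real CARD('d))"
  let ?w = "\<lambda>y. eigfun \<kappa> l0 y * exp (\<kappa> \<bullet> y)"
  have w: "\<bar>?w y\<bar> \<le> B * ?E" if "y \<in> cube" for y
    using B(2)[OF that, of l0] inner_cube_le[OF that, of \<kappa>] B(1) unfolding abs_mult
    by (intro mult_mono) (auto simp: abs_le_iff)
  have wc: "continuous_on UNIV ?w" by (intro continuous_intros continuous_eigfun)
  have "\<bar>approx_coord M l0 \<kappa> (eigfun \<kappa> l) - (if l = l0 then 1 else 0)\<bar>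
      \<le> (C * (B * ?E)) * (sqrt (sqlen l) / real (min_comp M)) powr s"
    if M1: "1 \<le> min_comp M" and l: "l \<in> multi_idx" for M l
  proof -
    note M = min_comp_multi_idx[OF M1]
    let ?h = "1 / real (min_comp M)"
    let ?S = "C * (?h * sqrt (sqlen l)) powr s"
    have "(if l = l0 then 1 else 0) = ip \<kappa> (eigfun \<kappa> l) (eigfun \<kappa> l0)"
      by (simp only: eigfun_orthonormal[OF l l0])
    also have "\<dots> = (LINT y:dom|lborel. eigfun \<kappa> l y * ?w y)"
      by (simp add: ip_def mult.assoc)
    also have "\<dots> = (\<Sum>j\<in>grid M. LINT y:cell M j|lborel. eigfun \<kappa> l y * ?w y)"
      by (intro integral_cells M continuous_on_mult continuous_eigfun wc)
    finally have "approx_coord M l0 \<kappa> (eigfun \<kappa> l) - (if l = l0 then 1 else 0) =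
       (\<Sum>j\<in>grid M. eigfun \<kappa> l (space_pt M j) * cell_coef M l0 \<kappa> j - (LINT y:cell M j|lborel. eigfun \<kappa> l y * ?w y))"
      by (simp add: approx_coord_eq sum_subtractf)
    also have "\<bar>\<dots>\<bar> \<le> (\<Sum>j\<in>grid M. ?S * (B * ?E) * measure lborel (cell M j))"
    proof (rule order_trans[OF sum_abs], rule sum_mono)
      fix j assume j: "j \<in> grid M"
      have int: "set_integrable lborel (cell M j) f" if "continuous_on UNIV f" for f :: "real ^ 'd \<Rightarrow> real"
        using that j by (intro set_integrable_cube cell_subset_cube) auto
      let ?c = "eigfun \<kappa> l (space_pt M j)"
      have "?c * cell_coef M l0 \<kappa> j - (LINT y:cell M j|lborel. eigfun \<kappa> l y * ?w y)
         = (LINT y:cell M j|lborel. ?c * ?w y - eigfun \<kappa> l y * ?w y)"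
        unfolding cell_coef_def
        by (subst set_integral_diff(2)) (auto intro!: int continuous_on_mult continuous_eigfun wc continuous_on_const)
      also have "\<bar>\<dots>\<bar> \<le> (?S * (B * ?E)) * measure lborel (cell M j)"
      proof (rule cell_integral_le[OF j])
        show "continuous_on UNIV (\<lambda>y. ?c * ?w y - eigfun \<kappa> l y * ?w y)"
          by (intro continuous_on_diff continuous_on_mult continuous_eigfun wc continuous_on_const)
        fix y assume y: "y \<in> cell M j"
        then have yc: "y \<in> cube" using cell_subset_cube[OF j] by blast
        have "\<bar>space_pt M j $ k - y $ k\<bar> \<le> ?h" for k
        proof -
          have "(real (j $ k) - 1) / real (M $ k) \<le> y $ k" "y $ k \<le> real (j $ k) / real (M $ k)"
            using y by (auto simp: cell_def)
          moreover have "(real (j $ k) - 1) / real (M $ k) = real (j $ k) / real (M $ k) - 1 / real (M $ k)"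
            by (simp add: diff_divide_distrib)
          ultimately have "\<bar>space_pt M j $ k - y $ k\<bar> \<le> 1 / real (M $ k)"
            by (simp add: space_pt_def abs_le_iff)
          also have "\<dots> \<le> ?h" using min_comp_le[of M k] M1 by (intro divide_left_mono) auto
          finally show ?thesis .
        qed
        then have "\<bar>?c - eigfun \<kappa> l y\<bar> \<le> ?S"
          using M1 by (intro C(2) l space_pt_grid_cube j yc) auto
        then have "\<bar>?c - eigfun \<kappa> l y\<bar> * \<bar>?w y\<bar> \<le> ?S * (B * ?E)"
          using w[OF yc] by (intro mult_mono) auto
        then show "\<bar>?c * ?w y - eigfun \<kappa> l y * ?w y\<bar> \<le> ?S * (B * ?E)"
          by (simp add: abs_mult[symmetric] left_diff_distrib)
      qed
      finally show "\<bar>?c * cell_coef M l0 \<kappa> j - (LINT y:cell M j|lborel. eigfun \<kappa> l y * ?w y)\<bar>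
          \<le> ?S * (B * ?E) * measure lborel (cell M j)" .
    qed
    also have "\<dots> = ?S * (B * ?E)"
      by (simp add: sum_distrib_left[symmetric] sum_measure_cell[OF M])
    finally show ?thesis by (simp add: mult_ac)
  qed
  then show ?thesis using B(1) C(1) by (intro exI[of _ "C * (B * ?E)"]) auto
qed

text \<open>The parameter enters the integrand \<open>eigfun \<kappa> l y * exp (\<kappa> \<bullet> y)\<close> only through the factor
  \<open>exp (\<kappa> \<bullet> y / 2)\<close>. The bound is proportional to the volume of the cell, so that the coefficients
  change by a relative amount of order \<open>norm (\<kappa>' - \<kappa>)\<close>.\<close>

lemma cell_coef_lipschitz:
  fixes \<kappa> :: "real ^ 'd::finite"
  shows "\<exists>C\<ge>0. \<forall>M \<kappa>'. M \<in> multi_idx \<longrightarrow> norm (\<kappa>' - \<kappa>) \<le> 1 \<longrightarrow> (\<forall>j\<in>grid M.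
    \<bar>cell_coef M l \<kappa>' j - cell_coef M l \<kappa> j\<bar> \<le> C * norm (\<kappa>' - \<kappa>) * measure lborel (cell M j))"
proof -
  let ?d = "real CARD('d)" and ?A = "2 powr (real CARD('d) / 2)"
  let ?E = "exp ((norm \<kappa> + 1) * real CARD('d))"
  have w: "eigfun k l y * exp (k \<bullet> y) = ?A * exp ((k \<bullet> y) / 2) * (\<Prod>i\<in>UNIV. sin (pi * real (l $ i) * y $ i))" for k y
  proof -
    have "exp (- (k \<bullet> y) / 2) * exp (k \<bullet> y) = exp ((k \<bullet> y) / 2)" by (simp add: exp_add[symmetric])
    then show ?thesis unfolding eigfun_def by (simp add: mult_ac)
  qed
  have wc: "continuous_on UNIV (\<lambda>y. eigfun k l y * exp (k \<bullet> y))" for k by (intro continuous_intros continuous_eigfun)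
  have "\<bar>cell_coef M l \<kappa>' j - cell_coef M l \<kappa> j\<bar> \<le> (?A * (?E * ?d)) * norm (\<kappa>' - \<kappa>) * measure lborel (cell M j)"
    if M: "M \<in> multi_idx" and n1: "norm (\<kappa>' - \<kappa>) \<le> 1" and j: "j \<in> grid M" for M \<kappa>' j
  proof -
    have int: "set_integrable lborel (cell M j) (\<lambda>y. eigfun k l y * exp (k \<bullet> y))" for k
      using j wc by (intro set_integrable_cube cell_subset_cube) auto
    have "cell_coef M l \<kappa>' j - cell_coef M l \<kappa> j
       = (LINT y:cell M j|lborel. eigfun \<kappa>' l y * exp (\<kappa>' \<bullet> y) - eigfun \<kappa> l y * exp (\<kappa> \<bullet> y))"
      unfolding cell_coef_def by (rule set_integral_diff(2)[OF int int, symmetric])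
    also have "\<bar>\<dots>\<bar> \<le> ((?A * (?E * ?d)) * norm (\<kappa>' - \<kappa>)) * measure lborel (cell M j)"
    proof (rule cell_integral_le[OF j])
      show "continuous_on UNIV (\<lambda>y. eigfun \<kappa>' l y * exp (\<kappa>' \<bullet> y) - eigfun \<kappa> l y * exp (\<kappa> \<bullet> y))"
        by (intro continuous_on_diff wc)
      fix y assume "y \<in> cell M j"
      then have y: "y \<in> cube" using cell_subset_cube[OF j] by blast
      let ?s = "\<Prod>i\<in>UNIV. sin (pi * real (l $ i) * y $ i)"
      have s: "\<bar>?s\<bar> \<le> 1" unfolding abs_prod by (intro prod_le_1) auto
      have n': "norm \<kappa>' \<le> norm \<kappa> + 1" using n1 norm_triangle_ineq2[of \<kappa>' \<kappa>] by linarith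
      have le: "(\<kappa> \<bullet> y) / 2 \<le> (norm \<kappa> + 1) * ?d" "(\<kappa>' \<bullet> y) / 2 \<le> (norm \<kappa> + 1) * ?d"
      proof -
        have half: "x / 2 \<le> c" if "\<bar>x\<bar> \<le> c" for x c :: real using that by linarith
        have "norm \<kappa> * ?d \<le> (norm \<kappa> + 1) * ?d" "norm \<kappa>' * ?d \<le> (norm \<kappa> + 1) * ?d"
          using n' by (intro mult_right_mono; simp)+
        then have "\<bar>\<kappa> \<bullet> y\<bar> \<le> (norm \<kappa> + 1) * ?d" "\<bar>\<kappa>' \<bullet> y\<bar> \<le> (norm \<kappa> + 1) * ?d"
          using inner_cube_le[OF y, of \<kappa>] inner_cube_le[OF y, of \<kappa>'] by linarith+
        then show "(\<kappa> \<bullet> y) / 2 \<le> (norm \<kappa> + 1) * ?d" "(\<kappa>' \<bullet> y) / 2 \<le> (norm \<kappa> + 1) * ?d"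
          by (simp_all only: half)
      qed
      have "\<bar>exp ((\<kappa>' \<bullet> y) / 2) - exp ((\<kappa> \<bullet> y) / 2)\<bar> \<le> ?E * \<bar>(\<kappa>' \<bullet> y) / 2 - (\<kappa> \<bullet> y) / 2\<bar>"
        by (rule abs_exp_diff_le[OF le(2,1)])
      also have "\<dots> \<le> ?E * (norm (\<kappa>' - \<kappa>) * ?d)"
        using inner_cube_le[OF y, of "\<kappa>' - \<kappa>"] by (intro mult_left_mono) (auto simp: inner_diff_left abs_le_iff)
      finally have ex: "\<bar>exp ((\<kappa>' \<bullet> y) / 2) - exp ((\<kappa> \<bullet> y) / 2)\<bar> \<le> ?E * (norm (\<kappa>' - \<kappa>) * ?d)" .
      have "eigfun \<kappa>' l y * exp (\<kappa>' \<bullet> y) - eigfun \<kappa> l y * exp (\<kappa> \<bullet> y)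
         = ?A * (exp ((\<kappa>' \<bullet> y) / 2) - exp ((\<kappa> \<bullet> y) / 2)) * ?s"
        unfolding w by (simp add: algebra_simps)
      then have "\<bar>eigfun \<kappa>' l y * exp (\<kappa>' \<bullet> y) - eigfun \<kappa> l y * exp (\<kappa> \<bullet> y)\<bar>
         = ?A * \<bar>exp ((\<kappa>' \<bullet> y) / 2) - exp ((\<kappa> \<bullet> y) / 2)\<bar> * \<bar>?s\<bar>" by (simp add: abs_mult)
      also have "\<dots> \<le> ?A * (?E * (norm (\<kappa>' - \<kappa>) * ?d)) * 1"
        using ex s by (intro mult_mono) auto
      finally show "\<bar>eigfun \<kappa>' l y * exp (\<kappa>' \<bullet> y) - eigfun \<kappa> l y * exp (\<kappa> \<bullet> y)\<bar>
         \<le> (?A * (?E * ?d)) * norm (\<kappa>' - \<kappa>)" by (simp add: mult_ac)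
    qed
    finally show ?thesis .
  qed
  then show ?thesis by (intro exI[of _ "?A * (?E * ?d)"]) auto
qed

lemma measurable_cell_coef: "(\<lambda>\<kappa>. cell_coef M l \<kappa> j) \<in> borel_measurable (borel :: (real ^ 'd::finite) measure)"
proof -
  have c: "continuous_on UNIV (\<lambda>p :: (real ^ 'd) \<times> (real ^ 'd). eigfun (fst p) l (snd p) * exp (fst p \<bullet> snd p))"
    unfolding eigfun_def by (intro continuous_intros) auto
  have m: "(\<lambda>p :: (real ^ 'd) \<times> (real ^ 'd). indicator (cell M j) (snd p) *\<^sub>R (eigfun (fst p) l (snd p) * exp (fst p \<bullet> snd p)))
      \<in> borel_measurable (borel \<Otimes>\<^sub>M lborel)"
  proof (intro borel_measurable_scaleR)
    have "sets (borel \<Otimes>\<^sub>M lborel) = sets (borel :: ((real ^ 'd) \<times> (real ^ 'd)) measure)"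
      by (simp add: borel_prod[symmetric] cong: sets_pair_measure_cong)
    then show "(\<lambda>p. eigfun (fst p) l (snd p) * exp (fst p \<bullet> snd p)) \<in> borel_measurable (borel \<Otimes>\<^sub>M lborel)"
      using borel_measurable_continuous_onI[OF c] by (simp cong: measurable_cong_sets)
    show "(\<lambda>p :: (real ^ 'd) \<times> (real ^ 'd). indicator (cell M j) (snd p) :: real) \<in> borel_measurable (borel \<Otimes>\<^sub>M lborel)"
      by measurable
  qed
  show ?thesis
    unfolding cell_coef_def set_lebesgue_integral_def
    by (rule lborel.borel_measurable_lebesgue_integral) (use m in \<open>simp add: case_prod_beta\<close>)
qed

section \<open>Second moments of the solution\<close>

lemma L2D_weighted_integrable:
  assumes "u \<in> L2D" shows "set_integrable lborel dom (\<lambda>y. u y * u y * exp (\<kappa> \<bullet> y))"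
proof -
  have m [measurable]: "(\<lambda>y. indicator dom y *\<^sub>R u y) \<in> borel_measurable borel"
    using assms by (simp add: L2D_def set_borel_measurable_def)
  have i: "integrable lborel (\<lambda>y. indicator dom y *\<^sub>R (u y)\<^sup>2)"
    using assms by (simp add: L2D_def set_integrable_def)
  let ?E = "exp (norm \<kappa> * real CARD('a))"
  have eq: "indicator dom y *\<^sub>R (u y * u y * exp (\<kappa> \<bullet> y)) =
      (indicator dom y *\<^sub>R u y) * (indicator dom y *\<^sub>R u y) * exp (\<kappa> \<bullet> y)" for y
    by (simp add: indicator_def)
  show ?thesis
    unfolding set_integrable_def
  proof (rule Bochner_Integration.integrable_bound)
    show "integrable lborel (\<lambda>y. ?E * (indicator dom y *\<^sub>R (u y)\<^sup>2))" using i by simp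
    show "(\<lambda>y. indicator dom y *\<^sub>R (u y * u y * exp (\<kappa> \<bullet> y))) \<in> borel_measurable lborel"
      unfolding eq by measurable
    have "norm (indicator dom y *\<^sub>R (u y * u y * exp (\<kappa> \<bullet> y))) \<le> norm (?E * (indicator dom y *\<^sub>R (u y)\<^sup>2))" for y
    proof (cases "y \<in> dom")
      case True
      then have "y \<in> cube" using dom_subset_cube by blast
      then have "exp (\<kappa> \<bullet> y) \<le> ?E" using inner_cube_le[of y \<kappa>] by (simp add: abs_le_iff)
      then have "(u y * u y) * exp (\<kappa> \<bullet> y) \<le> (u y * u y) * ?E" by (intro mult_left_mono) auto
      then show ?thesis using True by (simp add: abs_mult power2_eq_square mult.commute)
    qed simp
    then show "AE y in lborel. norm (indicator dom y *\<^sub>R (u y * u y * exp (\<kappa> \<bullet> y))) \<le> norm (?E * (indicator dom y *\<^sub>R (u y)\<^sup>2))"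
      by simp
  qed
qed

lemma L2D_diff:
  assumes u: "u \<in> L2D" and v: "v \<in> L2D" shows "(\<lambda>y. u y - v y) \<in> L2D"
proof -
  have m [measurable]: "(\<lambda>y. indicator dom y *\<^sub>R u y) \<in> borel_measurable borel" "(\<lambda>y. indicator dom y *\<^sub>R v y) \<in> borel_measurable borel"
    using assms by (simp_all add: L2D_def set_borel_measurable_def)
  have i: "integrable lborel (\<lambda>y. indicator dom y *\<^sub>R (u y)\<^sup>2)" "integrable lborel (\<lambda>y. indicator dom y *\<^sub>R (v y)\<^sup>2)"
    using assms by (simp_all add: L2D_def set_integrable_def)
  have eq: "indicator dom y *\<^sub>R (u y - v y) = indicator dom y *\<^sub>R u y - indicator dom y *\<^sub>R v y"
    "indicator dom y *\<^sub>R (u y - v y)\<^sup>2 = (indicator dom y *\<^sub>R u y - indicator dom y *\<^sub>R v y)\<^sup>2" for y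
    by (simp_all add: indicator_def)
  have "integrable lborel (\<lambda>y. indicator dom y *\<^sub>R (u y - v y)\<^sup>2)"
  proof (rule Bochner_Integration.integrable_bound)
    show "integrable lborel (\<lambda>y. 2 * (indicator dom y *\<^sub>R (u y)\<^sup>2) + 2 * (indicator dom y *\<^sub>R (v y)\<^sup>2))" using i by simp
    show "(\<lambda>y. indicator dom y *\<^sub>R (u y - v y)\<^sup>2) \<in> borel_measurable lborel" unfolding eq by measurable
    have "(u y - v y)\<^sup>2 \<le> 2 * (u y)\<^sup>2 + 2 * (v y)\<^sup>2" for y
      using zero_le_power2[of "u y + v y"] by (simp add: power2_sum power2_diff)
    then show "AE y in lborel. norm (indicator dom y *\<^sub>R (u y - v y)\<^sup>2)
        \<le> norm (2 * (indicator dom y *\<^sub>R (u y)\<^sup>2) + 2 * (indicator dom y *\<^sub>R (v y)\<^sup>2))"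
      by (intro AE_I2) (auto simp: indicator_def)
  qed
  moreover have "(\<lambda>y. indicator dom y *\<^sub>R (u y - v y)) \<in> borel_measurable lborel" unfolding eq by measurable
  ultimately show ?thesis unfolding L2D_def set_borel_measurable_def set_integrable_def by blast
qed

lemma ip_self_nonneg: "0 \<le> ip \<kappa> u u"
  unfolding ip_def set_lebesgue_integral_def by (intro integral_nonneg_AE AE_I2) simp

lemma ip_norm_sq: "(ip_norm \<kappa> u)\<^sup>2 = ip \<kappa> u u"
  by (simp add: ip_norm_def ip_self_nonneg)

lemma eigfun_sum_L2D:
  fixes \<kappa> :: "real ^ 'd::finite"
  shows "(\<lambda>y. \<Sum>l\<in>F. a l * eigfun \<kappa> l y) \<in> L2D"
proof -
  have c: "continuous_on UNIV (\<lambda>y. \<Sum>l\<in>F. a l * eigfun \<kappa> l y)"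
    by (intro continuous_intros continuous_eigfun)
  have [measurable]: "(\<lambda>y. \<Sum>l\<in>F. a l * eigfun \<kappa> l y) \<in> borel_measurable borel"
    using c by (rule borel_measurable_continuous_onI)
  show ?thesis
    unfolding L2D_def mem_Collect_eq
    by (intro conjI set_integrable_cube continuous_on_power c dom_subset_cube dom_sets)
       (simp add: set_borel_measurable_def)
qed

lemma ip_eigfun_sum:
  fixes \<kappa> :: "real ^ 'd::finite"
  assumes F: "finite F" "F \<subseteq> multi_idx"
  shows "ip \<kappa> (\<lambda>y. \<Sum>l\<in>F. a l * eigfun \<kappa> l y) (\<lambda>y. \<Sum>l\<in>F. a l * eigfun \<kappa> l y) = (\<Sum>l\<in>F. (a l)\<^sup>2)"
proof -
  let ?f = "\<lambda>l l' y. a l * a l' * (eigfun \<kappa> l y * eigfun \<kappa> l' y * exp (\<kappa> \<bullet> y))"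
  have int: "integrable lborel (\<lambda>y. indicator dom y *\<^sub>R ?f l l' y)" for l l'
    unfolding set_integrable_def[symmetric]
    by (intro set_integrable_cube dom_subset_cube dom_sets continuous_intros continuous_eigfun)
  have "indicator dom y *\<^sub>R ((\<Sum>l\<in>F. a l * eigfun \<kappa> l y) * (\<Sum>l\<in>F. a l * eigfun \<kappa> l y) * exp (\<kappa> \<bullet> y))
      = (\<Sum>l\<in>F. \<Sum>l'\<in>F. indicator dom y *\<^sub>R ?f l l' y)" for y
    by (simp add: sum_product sum_distrib_left sum_distrib_right mult_ac)
  then have "ip \<kappa> (\<lambda>y. \<Sum>l\<in>F. a l * eigfun \<kappa> l y) (\<lambda>y. \<Sum>l\<in>F. a l * eigfun \<kappa> l y)
      = (\<integral>y. (\<Sum>l\<in>F. \<Sum>l'\<in>F. indicator dom y *\<^sub>R ?f l l' y) \<partial>lborel)"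
    by (simp add: ip_def set_lebesgue_integral_def)
  also have "\<dots> = (\<Sum>l\<in>F. \<integral>y. (\<Sum>l'\<in>F. indicator dom y *\<^sub>R ?f l l' y) \<partial>lborel)"
    by (intro Bochner_Integration.integral_sum Bochner_Integration.integrable_sum int)
  also have "\<dots> = (\<Sum>l\<in>F. \<Sum>l'\<in>F. \<integral>y. indicator dom y *\<^sub>R ?f l l' y \<partial>lborel)"
    by (intro sum.cong refl Bochner_Integration.integral_sum int)
  also have "\<dots> = (\<Sum>l\<in>F. \<Sum>l'\<in>F. a l * a l' * ip \<kappa> (eigfun \<kappa> l) (eigfun \<kappa> l'))"
    unfolding ip_def set_lebesgue_integral_def
    by (intro sum.cong refl) (simp only: mult_scaleR_right[symmetric] integral_mult_right_zero)
  also have "\<dots> = (\<Sum>l\<in>F. \<Sum>l'\<in>F. if l' = l then (a l)\<^sup>2 else 0)"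
    using F by (intro sum.cong refl) (auto simp: eigfun_orthonormal power2_eq_square subset_iff)
  also have "\<dots> = (\<Sum>l\<in>F. (a l)\<^sup>2)" using F by simp
  finally show ?thesis .
qed

text \<open>A form of Bessel's inequality: the squared norm of a partial sum of the expansion of \<open>v\<close> is
  the sum of the squares of its coefficients, and the partial sums converge to \<open>v\<close>. The factor \<open>2\<close>
  is again that of \<open>(a + b)\<^sup>2 \<le> 2 a\<^sup>2 + 2 b\<^sup>2\<close>.\<close>

lemma frac_power_bessel:
  fixes \<theta>1 :: "real ^ 'd::finite"
  assumes uv: "is_frac_power \<theta>0 \<theta>1 \<theta>2 s u v" and G: "finite G" "G \<subseteq> multi_idx"
  shows "(\<Sum>l\<in>G. (eigval \<theta>0 \<theta>1 \<theta>2 l powr s * ip (\<theta>1 /\<^sub>R \<theta>2) u (eigfun (\<theta>1 /\<^sub>R \<theta>2) l))\<^sup>2)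
    \<le> 2 * (ip_norm (\<theta>1 /\<^sub>R \<theta>2) v)\<^sup>2"
proof -
  define \<kappa> where "\<kappa> = \<theta>1 /\<^sub>R \<theta>2"
  define a where "a l = eigval \<theta>0 \<theta>1 \<theta>2 l powr s * ip \<kappa> u (eigfun \<kappa> l)" for l
  define S where "S F y = (\<Sum>l\<in>F. a l * eigfun \<kappa> l y)" for F y
  have v: "v \<in> L2D" and lim: "((\<lambda>F. ip_norm \<kappa> (\<lambda>y. v y - S F y)) \<longlongrightarrow> 0) (finite_subsets_at_top multi_idx)"
    using uv unfolding is_frac_power_def Let_def \<kappa>_def[symmetric] a_def S_def by auto
  have le: "(\<Sum>l\<in>G. (a l)\<^sup>2) \<le> 2 * (ip_norm \<kappa> (\<lambda>y. v y - S F y))\<^sup>2 + 2 * (ip_norm \<kappa> v)\<^sup>2"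
    if F: "finite F" "F \<subseteq> multi_idx" "G \<subseteq> F" for F
  proof -
    let ?r = "\<lambda>y. v y - S F y"
    have S: "S F \<in> L2D" unfolding S_def[abs_def] by (rule eigfun_sum_L2D)
    note int = L2D_weighted_integrable[OF v, of \<kappa>] L2D_weighted_integrable[OF L2D_diff[OF v S], of \<kappa>]
      L2D_weighted_integrable[OF S, of \<kappa>]
    have "(\<Sum>l\<in>G. (a l)\<^sup>2) \<le> (\<Sum>l\<in>F. (a l)\<^sup>2)" using F by (intro sum_mono2) auto
    also have "\<dots> = ip \<kappa> (S F) (S F)" unfolding S_def[abs_def] using F by (simp add: ip_eigfun_sum)
    also have "\<dots> \<le> (LINT y:dom|lborel. 2 * (?r y * ?r y * exp (\<kappa> \<bullet> y)) + 2 * (v y * v y * exp (\<kappa> \<bullet> y)))"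
      unfolding ip_def
    proof (rule set_integral_mono)
      show "set_integrable lborel dom (\<lambda>y. 2 * (?r y * ?r y * exp (\<kappa> \<bullet> y)) + 2 * (v y * v y * exp (\<kappa> \<bullet> y)))"
        using int by (intro set_integral_add set_integrable_mult_right) auto
      fix y
      have "S F y * S F y \<le> 2 * (?r y * ?r y) + 2 * (v y * v y)"
        using zero_le_power2[of "?r y + v y"] zero_le_power2[of "2 * v y - S F y"]
        by (simp add: power2_eq_square algebra_simps)
      then have "(S F y * S F y) * exp (\<kappa> \<bullet> y) \<le> (2 * (?r y * ?r y) + 2 * (v y * v y)) * exp (\<kappa> \<bullet> y)"
        by (intro mult_right_mono) auto
      then show "S F y * S F y * exp (\<kappa> \<bullet> y) \<le> 2 * (?r y * ?r y * exp (\<kappa> \<bullet> y)) + 2 * (v y * v y * exp (\<kappa> \<bullet> y))"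
        by (simp only: distrib_right mult.assoc)
    qed (use int in auto)
    also have "\<dots> = 2 * ip \<kappa> ?r ?r + 2 * ip \<kappa> v v"
      unfolding ip_def using int by (subst set_integral_add(2)) (auto intro!: set_integrable_mult_right)
    finally show ?thesis by (simp add: ip_norm_sq)
  qed
  have "((\<lambda>F. 2 * (ip_norm \<kappa> (\<lambda>y. v y - S F y))\<^sup>2 + 2 * (ip_norm \<kappa> v)\<^sup>2) \<longlongrightarrow> 2 * 0\<^sup>2 + 2 * (ip_norm \<kappa> v)\<^sup>2)
      (finite_subsets_at_top multi_idx)"
    by (intro tendsto_intros lim)
  moreover have "eventually (\<lambda>F. (\<Sum>l\<in>G. (a l)\<^sup>2) \<le> 2 * (ip_norm \<kappa> (\<lambda>y. v y - S F y))\<^sup>2 + 2 * (ip_norm \<kappa> v)\<^sup>2)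
      (finite_subsets_at_top multi_idx)"
    unfolding eventually_finite_subsets_at_top using G le by (intro exI[of _ G]) auto
  ultimately have "(\<Sum>l\<in>G. (a l)\<^sup>2) \<le> 2 * 0\<^sup>2 + 2 * (ip_norm \<kappa> v)\<^sup>2"
    by (rule tendsto_lowerbound) simp
  then show ?thesis by (simp add: a_def \<kappa>_def)
qed

definition (in spde_model) kap :: "real ^ 'd" where "kap = \<theta>1 /\<^sub>R \<theta>2"

definition (in spde_model) lam :: "nat ^ 'd \<Rightarrow> real" where "lam l = eigval \<theta>0 \<theta>1 \<theta>2 l"

definition (in spde_model) coord :: "nat ^ 'd \<Rightarrow> real \<Rightarrow> 'w \<Rightarrow> real" where
  "coord l t \<omega> = ip kap (X t \<omega>) (eigfun kap l)"

text \<open>The model provides a version of the stochastic convolution for each \<open>l\<close> and \<open>t\<close>; this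
  selects one of them.\<close>

definition (in spde_model) noise :: "nat ^ 'd \<Rightarrow> real \<Rightarrow> 'w \<Rightarrow> real" where
  "noise l t = (SOME I. is_wiener_integral P (w l) t (\<lambda>s. \<sigma> s * exp (- lam l * (t - s))) I \<and>
     (AE \<omega> in P. coord l t \<omega> = exp (- lam l * t) * coord l 0 \<omega> + \<gamma> l powr (- \<alpha> / 2) * I \<omega>))"

context spde_model begin

lemma noise:
  assumes "l \<in> multi_idx" "t \<in> {0..1}"
  shows "is_wiener_integral P (w l) t (\<lambda>s. \<sigma> s * exp (- lam l * (t - s))) (noise l t)"
    and "AE \<omega> in P. coord l t \<omega> = exp (- lam l * t) * coord l 0 \<omega> + \<gamma> l powr (- \<alpha> / 2) * noise l t \<omega>"
  using someI_ex[OF mild_coord[OF assms, folded lam_def kap_def, folded coord_def], folded noise_def] by auto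

lemma noise_measurable: "l \<in> multi_idx \<Longrightarrow> t \<in> {0..1} \<Longrightarrow> noise l t \<in> borel_measurable P"
  using noise(1) by (auto simp: is_wiener_integral_def)

lemma coord_measurable: "t \<in> {0..1} \<Longrightarrow> coord l t \<in> borel_measurable P"
  using X_rv[of t] eigfun_L2D unfolding L2D_rv_def coord_def[abs_def] kap_def[symmetric] by blast

lemma driving_family: "brownian_family P w multi_idx"
  unfolding brownian_family_def using brownian brownian_indep by blast

lemma lam_lower: "\<exists>a>0. \<forall>l\<in>multi_idx. a * sqlen l \<le> lam l"
  unfolding lam_def by (rule eigval_lower_bound[OF theta2_pos eigval_pos])

lemma lam_pos: "l \<in> multi_idx \<Longrightarrow> 0 < lam l"
  using lam_lower sqlen_ge_1[of l] by (metis less_le_trans mult_pos_pos zero_less_one)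

abbreviation (input) ou_kernel :: "nat ^ 'd \<Rightarrow> real \<Rightarrow> real \<Rightarrow> real" where
  "ou_kernel l t s \<equiv> indicator {0..t} s * (\<sigma> s * exp (- lam l * (t - s)))"

lemma noise_limit:
  assumes "l \<in> G" "l \<in> multi_idx" "t \<in> {0..1}"
  shows "wiener_limit P w G (\<lambda>l' s. if l' = l then ou_kernel l t s else 0) (noise l t)"
  using assms by (intro wiener_limit_integral noise)

text \<open>The variance of an Ornstein-Uhlenbeck process is bounded, uniformly in time, by its
  stationary value for the constant volatility \<open>S\<close>.\<close>

lemma ou_kernel_sq_mom:
  assumes l: "l \<in> multi_idx" and t: "t \<in> {0..1}" and S: "\<forall>t\<in>{0..1}. \<sigma> t \<le> S"
  shows "sq_mom lborel (\<lambda>s. ou_kernel l t s) \<le> ennreal (S\<^sup>2 / (2 * lam l))"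
proof -
  note lp = lam_pos[OF l]
  have sb: "\<bar>\<sigma> s\<bar> \<le> \<bar>S\<bar>" if "s \<in> {0..1}" for s using S[rule_format, OF that] sigma_pos[OF that] by simp
  have "sq_mom lborel (\<lambda>s. ou_kernel l t s) \<le> (\<integral>\<^sup>+s. ennreal (S\<^sup>2 * exp (- (2 * lam l) * (t - s))) * indicator {0..t} s \<partial>lborel)"
    unfolding sq_mom_def
  proof (intro nn_integral_mono)
    fix s
    have "(\<sigma> s * exp (- lam l * (t - s)))\<^sup>2 \<le> S\<^sup>2 * exp (- (2 * lam l) * (t - s))" if "s \<in> {0..t}"
    proof -
      have "(\<sigma> s)\<^sup>2 \<le> S\<^sup>2" using sb[of s] that t by (simp add: abs_le_square_iff)
      then show ?thesis by (simp add: power_mult_distrib exp_double[symmetric] mult.assoc)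
    qed
    then show "ennreal ((ou_kernel l t s)\<^sup>2) \<le> ennreal (S\<^sup>2 * exp (- (2 * lam l) * (t - s))) * indicator {0..t} s"
      by (auto simp: indicator_def intro!: ennreal_leI)
  qed
  also have "\<dots> = ennreal (S\<^sup>2 / (2 * lam l) * exp (- (2 * lam l) * (t - t)) - S\<^sup>2 / (2 * lam l) * exp (- (2 * lam l) * (t - 0)))"
    using t lp by (intro nn_integral_FTC_Icc) (auto intro!: derivative_eq_intros continuous_intros simp: field_simps)
  also have "\<dots> \<le> ennreal (S\<^sup>2 / (2 * lam l))" using lp by (intro ennreal_leI) auto
  finally show ?thesis .
qed

lemma noise_sum_sq_mom:
  assumes G: "finite G" "G \<subseteq> multi_idx" and t: "t \<in> {0..1}" and S: "\<forall>t\<in>{0..1}. \<sigma> t \<le> S"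
  shows "sq_mom P (\<lambda>\<omega>. \<Sum>l\<in>G. c l * noise l t \<omega>) \<le> ennreal (\<Sum>l\<in>G. 2 * S\<^sup>2 * (c l)\<^sup>2 / lam l)"
proof (cases "G = {}")
  case True
  then show ?thesis by (simp add: sq_mom_def)
next
  case False
  have "wiener_limit P w G (\<lambda>l' s. \<Sum>l\<in>A. c l * (if l' = l then ou_kernel l t s else 0)) (\<lambda>\<omega>. \<Sum>l\<in>A. c l * noise l t \<omega>)"
    if "finite A" "A \<noteq> {}" "A \<subseteq> G" for A
    using that
  proof (induction A rule: finite_ne_induct)
    case (singleton l)
    then have "wiener_limit P w G (\<lambda>l' s. if l' = l then ou_kernel l t s else 0) (noise l t)"
      using G t by (intro noise_limit) auto
    from wiener_limit_lin[OF driving_family G(2) this this, of "c l" 0] show ?case by simp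
  next
    case (insert l A)
    then have "wiener_limit P w G (\<lambda>l' s. if l' = l then ou_kernel l t s else 0) (noise l t)"
      using G t by (intro noise_limit) auto
    from wiener_limit_lin[OF driving_family G(2) this, of _ _ "c l" 1] insert show ?case by simp
  qed
  from this[OF G(1) False order_refl]
  have "sq_mom P (\<lambda>\<omega>. \<Sum>l\<in>G. c l * noise l t \<omega>) \<le> 4 * (\<Sum>l'\<in>G. sq_mom lborel (\<lambda>s. \<Sum>l\<in>G. c l * (if l' = l then ou_kernel l t s else 0)))"
    by (rule wiener_limit_sq_mom[OF driving_family G])
  also have "(\<Sum>l'\<in>G. sq_mom lborel (\<lambda>s. \<Sum>l\<in>G. c l * (if l' = l then ou_kernel l t s else 0))) \<le> (\<Sum>l\<in>G. ennreal ((c l)\<^sup>2 * (S\<^sup>2 / (2 * lam l))))"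
  proof (rule sum_mono)
    fix l assume l: "l \<in> G"
    then have lm: "l \<in> multi_idx" using G by blast
    have "(\<lambda>s. \<Sum>l'\<in>G. c l' * (if l = l' then ou_kernel l' t s else 0)) = (\<lambda>s. c l * ou_kernel l t s)"
      using G l by (simp add: if_distrib cong: if_cong)
    moreover have "(\<lambda>s. ou_kernel l t s) \<in> borel_measurable lborel"
      using noise(1)[OF lm t] by (simp add: is_wiener_integral_def set_borel_measurable_def)
    ultimately have "sq_mom lborel (\<lambda>s. \<Sum>l'\<in>G. c l' * (if l = l' then ou_kernel l' t s else 0))
        = ennreal ((c l)\<^sup>2) * sq_mom lborel (\<lambda>s. ou_kernel l t s)" by (simp add: sq_mom_cmult)
    also have "\<dots> \<le> ennreal ((c l)\<^sup>2) * ennreal (S\<^sup>2 / (2 * lam l))"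
      by (intro mult_left_mono ou_kernel_sq_mom lm t S) auto
    also have "\<dots> = ennreal ((c l)\<^sup>2 * (S\<^sup>2 / (2 * lam l)))"
      using lam_pos[OF lm] by (simp add: ennreal_mult[symmetric])
    finally show "sq_mom lborel (\<lambda>s. \<Sum>l'\<in>G. c l' * (if l = l' then ou_kernel l' t s else 0)) \<le> ennreal ((c l)\<^sup>2 * (S\<^sup>2 / (2 * lam l)))" .
  qed
  also have "4 * (\<Sum>l\<in>G. ennreal ((c l)\<^sup>2 * (S\<^sup>2 / (2 * lam l)))) = ennreal (4 * (\<Sum>l\<in>G. (c l)\<^sup>2 * (S\<^sup>2 / (2 * lam l))))"
    using G lam_pos by (subst sum_ennreal) (auto simp: ennreal_mult sum_nonneg less_imp_le subset_iff intro!: divide_nonneg_pos)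
  also have "4 * (\<Sum>l\<in>G. (c l)\<^sup>2 * (S\<^sup>2 / (2 * lam l))) = (\<Sum>l\<in>G. 2 * S\<^sup>2 * (c l)\<^sup>2 / lam l)"
    unfolding sum_distrib_left by (intro sum.cong refl) simp
  finally show ?thesis by (auto simp: mult_left_mono)
qed

text \<open>In the centred case of the condition on the initial value its coordinates are uncorrelated
  with variances of order \<open>\<lambda>\<^sup>-\<^sup>(\<^sup>1\<^sup>+\<^sup>\<alpha>\<^sup>)\<close>. In the other case there are no signs to exploit: the
  Cauchy-Schwarz inequality is applied for each outcome and \<open>\<Sum> \<lambda>\<^sup>1\<^sup>+\<^sup>\<alpha> x\<^sup>2\<close> is bounded by
  \<open>frac_power_bessel\<close>. Both give the same estimate.\<close>

lemma initial_sum_sq_mom: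
  assumes A1: "cond_A1 P \<theta>0 \<theta>1 \<theta>2 \<alpha> (X 0) l0"
  shows "\<exists>K\<ge>0. \<forall>G c. finite G \<longrightarrow> G \<subseteq> multi_idx \<longrightarrow>
    sq_mom P (\<lambda>\<omega>. \<Sum>l\<in>G. c l * coord l 0 \<omega>) \<le> ennreal (K * (\<Sum>l\<in>G. (c l)\<^sup>2 * lam l powr (- (1 + \<alpha>))))"
proof -
  have ind: "indep_vars (\<lambda>_. borel) (\<lambda>l. coord l 0) multi_idx"
    using A1 unfolding cond_A1_def Let_def kap_def[symmetric] coord_def[abs_def] by blast
  have inv: "lam l powr (- (1 + \<alpha>)) * lam l powr (1 + \<alpha>) = 1" if "l \<in> multi_idx" for l
    using lam_pos[OF that] by (simp add: powr_add[symmetric])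
  have disj: "((\<forall>l\<in>multi_idx. integrable P (\<lambda>\<omega>. (coord l 0 \<omega>)\<^sup>2) \<and> expectation (coord l 0) = 0) \<and>
      bdd_above ((\<lambda>l. lam l powr (1 + \<alpha>) * expectation (\<lambda>\<omega>. (coord l 0 \<omega>)\<^sup>2)) ` multi_idx)) \<or>
    (\<exists>V. (AE \<omega> in P. is_frac_power \<theta>0 \<theta>1 \<theta>2 ((1 + \<alpha>) / 2) (X 0 \<omega>) (V \<omega>)) \<and>
      integrable P (\<lambda>\<omega>. (ip_norm kap (V \<omega>))\<^sup>2))"
    using A1 unfolding cond_A1_def Let_def kap_def[symmetric] coord_def[abs_def] lam_def[abs_def] by (rule conjunct1)
  from disj show ?thesis
  proof (elim disjE conjE exE)
    assume a: "\<forall>l\<in>multi_idx. integrable P (\<lambda>\<omega>. (coord l 0 \<omega>)\<^sup>2) \<and> expectation (coord l 0) = 0"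
      and "bdd_above ((\<lambda>l. lam l powr (1 + \<alpha>) * expectation (\<lambda>\<omega>. (coord l 0 \<omega>)\<^sup>2)) ` multi_idx)"
    then obtain K where K: "\<And>l. l \<in> multi_idx \<Longrightarrow> lam l powr (1 + \<alpha>) * expectation (\<lambda>\<omega>. (coord l 0 \<omega>)\<^sup>2) \<le> K"
      unfolding bdd_above_def by auto
    define K' where "K' = max K 0"
    have sq: "expectation (\<lambda>\<omega>. (coord l 0 \<omega>)\<^sup>2) \<le> K' * lam l powr (- (1 + \<alpha>))" if l: "l \<in> multi_idx" for l
    proof -
      have "lam l powr (- (1 + \<alpha>)) * (lam l powr (1 + \<alpha>) * expectation (\<lambda>\<omega>. (coord l 0 \<omega>)\<^sup>2)) \<le> lam l powr (- (1 + \<alpha>)) * K'"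
        using K[OF l] by (intro mult_left_mono) (auto simp: K'_def)
      then have "(lam l powr (- (1 + \<alpha>)) * lam l powr (1 + \<alpha>)) * expectation (\<lambda>\<omega>. (coord l 0 \<omega>)\<^sup>2) \<le> K' * lam l powr (- (1 + \<alpha>))"
        by (simp only: mult.assoc mult.commute[of K'])
      then show ?thesis unfolding inv[OF l] by simp
    qed
    have int1: "integrable P (coord l 0)" if l: "l \<in> multi_idx" for l
      using a l coord_measurable[of 0 l] by (auto intro: square_integrable_imp_integrable)
    have "sq_mom P (\<lambda>\<omega>. \<Sum>l\<in>G. c l * coord l 0 \<omega>) \<le> ennreal (K' * (\<Sum>l\<in>G. (c l)\<^sup>2 * lam l powr (- (1 + \<alpha>))))"
      if G: "finite G" "G \<subseteq> multi_idx" for G c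
    proof -
      have "sq_mom P (\<lambda>\<omega>. \<Sum>l\<in>G. c l * coord l 0 \<omega>) = ennreal (\<Sum>l\<in>G. expectation (\<lambda>\<omega>. (c l * coord l 0 \<omega>)\<^sup>2))"
      proof (rule sum_uncorrelated[OF G(1)])
        fix i j assume ij: "i \<in> G" "j \<in> G"
        then have ij': "i \<in> multi_idx" "j \<in> multi_idx" using G by auto
        have eq: "c i * coord i 0 \<omega> * (c j * coord j 0 \<omega>) = c i * c j * (coord i 0 \<omega> * coord j 0 \<omega>)" for \<omega>
          by (simp only: mult_ac)
        have "integrable P (\<lambda>\<omega>. coord i 0 \<omega> * coord j 0 \<omega>)"
          using indep_vars_pair(1)[OF ind ij' _ int1 int1] ij' a
          by (cases "i = j") (auto simp: power2_eq_square)
        then show "integrable P (\<lambda>\<omega>. c i * coord i 0 \<omega> * (c j * coord j 0 \<omega>))"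
          unfolding eq by simp
        assume "i \<noteq> j"
        then show "expectation (\<lambda>\<omega>. c i * coord i 0 \<omega> * (c j * coord j 0 \<omega>)) = 0"
          unfolding eq using indep_vars_pair(2)[OF ind ij' _ int1 int1] ij' a by simp
      qed
      also have "\<dots> \<le> ennreal (\<Sum>l\<in>G. (c l)\<^sup>2 * (K' * lam l powr (- (1 + \<alpha>))))"
      proof (intro ennreal_leI sum_mono)
        fix l assume "l \<in> G"
        then have "l \<in> multi_idx" using G by auto
        then show "expectation (\<lambda>\<omega>. (c l * coord l 0 \<omega>)\<^sup>2) \<le> (c l)\<^sup>2 * (K' * lam l powr (- (1 + \<alpha>)))"
          using sq[of l] by (simp add: power_mult_distrib mult_left_mono)
      qed
      finally show ?thesis by (simp add: sum_distrib_left mult_ac)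
    qed
    then show ?thesis by (intro exI[of _ K']) (auto simp: K'_def)
  next
    fix V
    assume b: "AE \<omega> in P. is_frac_power \<theta>0 \<theta>1 \<theta>2 ((1 + \<alpha>) / 2) (X 0 \<omega>) (V \<omega>)"
      "integrable P (\<lambda>\<omega>. (ip_norm kap (V \<omega>))\<^sup>2)"
    define K where "K = 2 * expectation (\<lambda>\<omega>. (ip_norm kap (V \<omega>))\<^sup>2)"
    have "sq_mom P (\<lambda>\<omega>. \<Sum>l\<in>G. c l * coord l 0 \<omega>) \<le> ennreal (K * (\<Sum>l\<in>G. (c l)\<^sup>2 * lam l powr (- (1 + \<alpha>))))"
      if G: "finite G" "G \<subseteq> multi_idx" for G c
    proof -
      let ?A = "\<Sum>l\<in>G. (c l)\<^sup>2 * lam l powr (- (1 + \<alpha>))"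
      have A0: "0 \<le> ?A" by (intro sum_nonneg) auto
      have "AE \<omega> in P. (\<Sum>l\<in>G. c l * coord l 0 \<omega>)\<^sup>2 \<le> ?A * (2 * (ip_norm kap (V \<omega>))\<^sup>2)"
        using b(1)
      proof eventually_elim
        case (elim \<omega>)
        let ?s = "(1 + \<alpha>) / 2"
        have lp: "0 < lam l" if "l \<in> G" for l using lam_pos that G by auto
        have "(\<Sum>l\<in>G. c l * coord l 0 \<omega>)\<^sup>2 = (\<Sum>l\<in>G. (c l * lam l powr (- ?s)) * (lam l powr ?s * coord l 0 \<omega>))\<^sup>2"
        proof -
          have "c l * coord l 0 \<omega> = (c l * lam l powr (- ?s)) * (lam l powr ?s * coord l 0 \<omega>)" if "l \<in> G" for l
          proof -
            have "lam l powr (- ?s) * lam l powr ?s = 1" using lp[OF that] by (simp add: powr_minus)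
            then have "c l * coord l 0 \<omega> = c l * (lam l powr (- ?s) * lam l powr ?s) * coord l 0 \<omega>" by simp
            then show ?thesis by (simp only: mult_ac)
          qed
          then have "(\<Sum>l\<in>G. c l * coord l 0 \<omega>) = (\<Sum>l\<in>G. (c l * lam l powr (- ?s)) * (lam l powr ?s * coord l 0 \<omega>))"
            by (rule sum.cong[OF refl])
          then show ?thesis by (rule arg_cong)
        qed
        also have "\<dots> \<le> (\<Sum>l\<in>G. (c l * lam l powr (- ?s))\<^sup>2) * (\<Sum>l\<in>G. (lam l powr ?s * coord l 0 \<omega>)\<^sup>2)"
          by (rule Cauchy_Schwarz_ineq_sum)
        also have "(\<Sum>l\<in>G. (c l * lam l powr (- ?s))\<^sup>2) = ?A"
        proof (intro sum.cong refl)
          fix l assume "l \<in> G"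
          have "(lam l powr (- ?s))\<^sup>2 = lam l powr (- (1 + \<alpha>))"
            using lp[OF \<open>l \<in> G\<close>] by (simp add: power2_eq_square powr_add[symmetric])
          then show "(c l * lam l powr (- ?s))\<^sup>2 = (c l)\<^sup>2 * lam l powr (- (1 + \<alpha>))"
            by (simp only: power_mult_distrib)
        qed
        also have "?A * (\<Sum>l\<in>G. (lam l powr ?s * coord l 0 \<omega>)\<^sup>2) \<le> ?A * (2 * (ip_norm kap (V \<omega>))\<^sup>2)"
          using frac_power_bessel[OF elim G] A0
          by (intro mult_left_mono) (simp_all only: coord_def lam_def kap_def)
        finally show ?case .
      qed
      then have "sq_mom P (\<lambda>\<omega>. \<Sum>l\<in>G. c l * coord l 0 \<omega>) \<le> (\<integral>\<^sup>+\<omega>. ennreal (?A * (2 * (ip_norm kap (V \<omega>))\<^sup>2)) \<partial>P)"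
        unfolding sq_mom_def by (intro nn_integral_mono_AE) (auto elim!: eventually_mono intro: ennreal_leI)
      also have "\<dots> = ennreal (expectation (\<lambda>\<omega>. ?A * (2 * (ip_norm kap (V \<omega>))\<^sup>2)))"
        using b(2) A0 by (intro nn_integral_eq_integral) auto
      also have "\<dots> = ennreal (K * ?A)" by (simp add: K_def mult_ac)
      finally show ?thesis .
    qed
    then show ?thesis by (intro exI[of _ K]) (auto simp: K_def)
  qed
qed

text \<open>Initial value and noise contribute alike: \<open>\<lambda>\<^sup>-\<^sup>(\<^sup>1\<^sup>+\<^sup>\<alpha>\<^sup>)\<close> and \<open>\<gamma>\<^sup>-\<^sup>\<alpha> / \<lambda>\<close> are both at most
  of order \<open>\<bar>l\<bar>\<^sup>-\<^sup>2\<^sup>(\<^sup>1\<^sup>+\<^sup>\<alpha>\<^sup>)\<close>. The constant depends on neither the time nor the finite index set,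
  so the estimate extends to infinite series.\<close>

lemma coord_sum_sq_mom:
  assumes A1: "cond_A1 P \<theta>0 \<theta>1 \<theta>2 \<alpha> (X 0) l0" and S: "\<forall>t\<in>{0..1}. \<sigma> t \<le> S"
  shows "\<exists>C\<ge>0. \<forall>t\<in>{0..1}. \<forall>G c. finite G \<longrightarrow> G \<subseteq> multi_idx \<longrightarrow>
    sq_mom P (\<lambda>\<omega>. \<Sum>l\<in>G. c l * coord l t \<omega>) \<le> ennreal (C * (\<Sum>l\<in>G. (c l)\<^sup>2 * sqlen l powr (- (1 + \<alpha>))))"
proof -
  obtain K where K0: "K \<ge> 0" and K1: "\<forall>G c. finite G \<longrightarrow> G \<subseteq> multi_idx \<longrightarrow>
    sq_mom P (\<lambda>\<omega>. \<Sum>l\<in>G. c l * coord l 0 \<omega>) \<le> ennreal (K * (\<Sum>l\<in>G. (c l)\<^sup>2 * lam l powr (- (1 + \<alpha>))))"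
    using initial_sum_sq_mom[OF A1] by (elim exE conjE) (rule that)
  note K = K0 K1[rule_format]
  obtain a where a: "a > 0" "\<And>l. l \<in> multi_idx \<Longrightarrow> a * sqlen l \<le> lam l" using lam_lower by blast
  obtain b where b: "b > 0" "\<And>l. l \<in> multi_idx \<Longrightarrow> b * sqlen l \<le> \<gamma> l" using gamma_order by blast
  let ?q = "\<lambda>l :: nat ^ 'd. sqlen l powr (- (1 + \<alpha>))"
  define C1 where "C1 = a powr (- (1 + \<alpha>))"
  define C2 where "C2 = 2 * S\<^sup>2 * b powr (- \<alpha>) / a"
  have C12: "0 \<le> C1" "0 \<le> C2" using a by (auto simp: C1_def C2_def)
  have init: "(c * exp (- lam l * t))\<^sup>2 * lam l powr (- (1 + \<alpha>)) \<le> C1 * (c\<^sup>2 * ?q l)"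
    if l: "l \<in> multi_idx" and t: "t \<in> {0..1}" for l t c
  proof -
    note q = sqlen_ge_1[OF l]
    have "exp (- lam l * t) \<le> 1" using lam_pos[OF l] t by (simp add: mult_nonneg_nonneg)
    then have "(exp (- lam l * t))\<^sup>2 \<le> 1\<^sup>2" by (intro power_mono) auto
    moreover have "lam l powr (- (1 + \<alpha>)) \<le> (a * sqlen l) powr (- (1 + \<alpha>))"
      using a q l alpha_nonneg by (intro powr_mono2') auto
    moreover have "(a * sqlen l) powr (- (1 + \<alpha>)) = C1 * ?q l"
      using a q unfolding C1_def by (intro powr_mult)
    ultimately have "(exp (- lam l * t))\<^sup>2 * lam l powr (- (1 + \<alpha>)) \<le> 1 * (C1 * ?q l)"
      by (intro mult_mono) auto
    then have "c\<^sup>2 * ((exp (- lam l * t))\<^sup>2 * lam l powr (- (1 + \<alpha>))) \<le> c\<^sup>2 * (1 * (C1 * ?q l))"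
      by (rule mult_left_mono) simp
    then show ?thesis by (simp only: power_mult_distrib mult_ac mult_1_left)
  qed
  have nois: "2 * S\<^sup>2 * (c * \<gamma> l powr (- \<alpha> / 2))\<^sup>2 / lam l \<le> C2 * (c\<^sup>2 * ?q l)" if l: "l \<in> multi_idx" for l c
  proof -
    note q = sqlen_ge_1[OF l]
    have "(\<gamma> l powr (- \<alpha> / 2))\<^sup>2 = \<gamma> l powr (- \<alpha>)"
      using gamma_pos[OF l] by (simp add: power2_eq_square powr_add[symmetric])
    also have "\<dots> \<le> (b * sqlen l) powr (- \<alpha>)"
      using b q l alpha_nonneg by (intro powr_mono2') auto
    also have "\<dots> = b powr (- \<alpha>) * sqlen l powr (- \<alpha>)" using b q by (intro powr_mult)
    finally have g: "(\<gamma> l powr (- \<alpha> / 2))\<^sup>2 \<le> b powr (- \<alpha>) * sqlen l powr (- \<alpha>)" .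
    have "sqlen l powr (- (1 + \<alpha>)) = sqlen l powr (- \<alpha> + - 1)" by (simp add: algebra_simps)
    also have "\<dots> = sqlen l powr (- \<alpha>) / sqlen l" using q by (simp only: powr_add) (simp add: powr_minus divide_inverse)
    finally have qq: "?q l = sqlen l powr (- \<alpha>) / sqlen l" .
    have "1 / lam l \<le> 1 / (a * sqlen l)"
      using a q l lam_pos[OF l] by (intro divide_left_mono) auto
    then have "(\<gamma> l powr (- \<alpha> / 2))\<^sup>2 * (1 / lam l) \<le> (b powr (- \<alpha>) * sqlen l powr (- \<alpha>)) * (1 / (a * sqlen l))"
      using g lam_pos[OF l] by (intro mult_mono) auto
    then have "2 * S\<^sup>2 * c\<^sup>2 * ((\<gamma> l powr (- \<alpha> / 2))\<^sup>2 * (1 / lam l)) \<le> 2 * S\<^sup>2 * c\<^sup>2 * ((b powr (- \<alpha>) * sqlen l powr (- \<alpha>)) * (1 / (a * sqlen l)))"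
      by (intro mult_left_mono) auto
    then show ?thesis unfolding C2_def qq by (simp add: power_mult_distrib mult_ac)
  qed
  have "sq_mom P (\<lambda>\<omega>. \<Sum>l\<in>G. c l * coord l t \<omega>) \<le> ennreal ((2 * K * C1 + 2 * C2) * (\<Sum>l\<in>G. (c l)\<^sup>2 * ?q l))"
    if t: "t \<in> {0..1}" and G: "finite G" "G \<subseteq> multi_idx" for t G c
  proof -
    let ?Q = "\<Sum>l\<in>G. (c l)\<^sup>2 * ?q l"
    have Q0: "0 \<le> ?Q" by (intro sum_nonneg) auto
    have "AE \<omega> in P. \<forall>l\<in>G. coord l t \<omega> = exp (- lam l * t) * coord l 0 \<omega> + \<gamma> l powr (- \<alpha> / 2) * noise l t \<omega>"
      using G t by (intro AE_finite_allI noise) auto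
    then have "AE \<omega> in P. (\<Sum>l\<in>G. c l * coord l t \<omega>) = (\<Sum>l\<in>G. (c l * exp (- lam l * t)) * coord l 0 \<omega>)
        + (\<Sum>l\<in>G. (c l * \<gamma> l powr (- \<alpha> / 2)) * noise l t \<omega>)"
    proof eventually_elim
      case (elim \<omega>)
      then show ?case unfolding sum.distrib[symmetric] by (intro sum.cong refl) (simp add: algebra_simps)
    qed
    then have "sq_mom P (\<lambda>\<omega>. \<Sum>l\<in>G. c l * coord l t \<omega>) = sq_mom P (\<lambda>\<omega>. (\<Sum>l\<in>G. (c l * exp (- lam l * t)) * coord l 0 \<omega>)
        + (\<Sum>l\<in>G. (c l * \<gamma> l powr (- \<alpha> / 2)) * noise l t \<omega>))"
      by (rule sq_mom_cong_AE)
    also have "\<dots> \<le> 2 * sq_mom P (\<lambda>\<omega>. \<Sum>l\<in>G. (c l * exp (- lam l * t)) * coord l 0 \<omega>)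
        + 2 * sq_mom P (\<lambda>\<omega>. \<Sum>l\<in>G. (c l * \<gamma> l powr (- \<alpha> / 2)) * noise l t \<omega>)"
      using G t by (intro sq_mom_add_le borel_measurable_sum borel_measurable_times borel_measurable_const coord_measurable noise_measurable) auto
    also have "\<dots> \<le> 2 * ennreal (K * (C1 * ?Q)) + 2 * ennreal (C2 * ?Q)"
    proof (intro add_mono mult_left_mono)
      have "sq_mom P (\<lambda>\<omega>. \<Sum>l\<in>G. (c l * exp (- lam l * t)) * coord l 0 \<omega>)
        \<le> ennreal (K * (\<Sum>l\<in>G. (c l * exp (- lam l * t))\<^sup>2 * lam l powr (- (1 + \<alpha>))))" by (rule K(2)[OF G])
      also have "\<dots> \<le> ennreal (K * (C1 * ?Q))"
        unfolding sum_distrib_left[of C1] using G t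
        by (intro ennreal_leI mult_left_mono sum_mono init K(1)) auto
      finally show "sq_mom P (\<lambda>\<omega>. \<Sum>l\<in>G. (c l * exp (- lam l * t)) * coord l 0 \<omega>) \<le> ennreal (K * (C1 * ?Q))" .
      have "sq_mom P (\<lambda>\<omega>. \<Sum>l\<in>G. (c l * \<gamma> l powr (- \<alpha> / 2)) * noise l t \<omega>)
        \<le> ennreal (\<Sum>l\<in>G. 2 * S\<^sup>2 * (c l * \<gamma> l powr (- \<alpha> / 2))\<^sup>2 / lam l)" by (rule noise_sum_sq_mom[OF G t S])
      also have "\<dots> \<le> ennreal (C2 * ?Q)"
        unfolding sum_distrib_left[of C2] using G by (intro ennreal_leI sum_mono nois) auto
      finally show "sq_mom P (\<lambda>\<omega>. \<Sum>l\<in>G. (c l * \<gamma> l powr (- \<alpha> / 2)) * noise l t \<omega>) \<le> ennreal (C2 * ?Q)" .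
    qed auto
    also have "\<dots> = ennreal (2 * (K * (C1 * ?Q)) + 2 * (C2 * ?Q))"
      using K(1) C12 Q0 by (simp add: ennreal_mult)
    also have "2 * (K * (C1 * ?Q)) + 2 * (C2 * ?Q) = (2 * K * C1 + 2 * C2) * ?Q" by (simp add: algebra_simps)
    finally show ?thesis .
  qed
  then show ?thesis using K(1) C12 by (intro exI[of _ "2 * K * C1 + 2 * C2"]) auto
qed

text \<open>A linear functional \<open>Z\<close> of the solution is determined by its values \<open>g l\<close> on the
  eigenfunctions. If their squares are at most \<open>B \<bar>l\<bar>\<^sup>2\<^sup>q\<close>, the second moment of \<open>Z\<close> is at most a
  constant times \<open>B \<Sum> \<bar>l\<bar>\<^sup>2\<^sup>q\<^sup>-\<^sup>2\<^sup>(\<^sup>1\<^sup>+\<^sup>\<alpha>\<^sup>)\<close>, a convergent series. Point evaluation has \<open>q = 0\<close>;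
  the discretisation error has a positive \<open>q\<close> and a small \<open>B\<close>.\<close>

lemma series_sq_mom:
  assumes A1: "cond_A1 P \<theta>0 \<theta>1 \<theta>2 \<alpha> (X 0) l0" and S: "\<forall>t\<in>{0..1}. \<sigma> t \<le> S"
    and q: "real CARD('d) < 2 * (1 + \<alpha> - q)"
  shows "\<exists>C\<ge>0. \<forall>t\<in>{0..1}. \<forall>g Z B. Z \<in> borel_measurable P \<longrightarrow> 0 \<le> B \<longrightarrow>
    (\<forall>l\<in>multi_idx. (g l)\<^sup>2 \<le> B * sqlen l powr q) \<longrightarrow>
    ((\<lambda>F. sq_mom P (\<lambda>\<omega>. Z \<omega> - (\<Sum>l\<in>F. g l * coord l t \<omega>))) \<longlongrightarrow> 0) (finite_subsets_at_top multi_idx) \<longrightarrow>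
    sq_mom P Z \<le> ennreal (C * B)"
proof -
  obtain K where K0: "K \<ge> 0" and K1: "\<forall>t\<in>{0..1}. \<forall>G c. finite G \<longrightarrow> G \<subseteq> multi_idx \<longrightarrow>
    sq_mom P (\<lambda>\<omega>. \<Sum>l\<in>G. c l * coord l t \<omega>) \<le> ennreal (K * (\<Sum>l\<in>G. (c l)\<^sup>2 * sqlen l powr (- (1 + \<alpha>))))"
    using coord_sum_sq_mom[OF A1 S] by (elim exE conjE) (rule that)
  note K = K0 K1[rule_format]
  obtain D where D: "D \<ge> 0" "\<And>F. finite F \<Longrightarrow> F \<subseteq> (multi_idx :: (nat ^ 'd) set) \<Longrightarrow> (\<Sum>l\<in>F. sqlen l powr (- (1 + \<alpha> - q))) \<le> D"
    using sqlen_powr_sum_bounded[OF q] by blast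
  have "sq_mom P Z \<le> ennreal (2 * K * D * B)"
    if t: "t \<in> {0..1}" and Z: "Z \<in> borel_measurable P" and B: "0 \<le> B"
      and g: "\<forall>l\<in>multi_idx. (g l)\<^sup>2 \<le> B * sqlen l powr q"
      and lim: "((\<lambda>F. sq_mom P (\<lambda>\<omega>. Z \<omega> - (\<Sum>l\<in>F. g l * coord l t \<omega>))) \<longlongrightarrow> 0) (finite_subsets_at_top multi_idx)"
    for t Z B g
  proof -
    have "sq_mom P Z \<le> 2 * ennreal (K * (B * D))"
    proof (rule sq_mom_limit_le[where Z="\<lambda>F \<omega>. \<Sum>l\<in>F. g l * coord l t \<omega>" and C="\<lambda>_. ennreal (K * (B * D))"
          and F="finite_subsets_at_top multi_idx"])
      show "Z \<in> borel_measurable P" by (rule Z)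
      show "((\<lambda>_. ennreal (K * (B * D))) \<longlongrightarrow> ennreal (K * (B * D))) (finite_subsets_at_top multi_idx)"
        by (rule tendsto_const)
      show "(\<lambda>\<omega>. \<Sum>l\<in>F. g l * coord l t \<omega>) \<in> borel_measurable P" for F
        using coord_measurable[OF t] by (intro borel_measurable_sum borel_measurable_times borel_measurable_const)
      show "((\<lambda>F. sq_mom P (\<lambda>\<omega>. (\<Sum>l\<in>F. g l * coord l t \<omega>) - Z \<omega>)) \<longlongrightarrow> 0) (finite_subsets_at_top multi_idx)"
        using lim by (simp add: sq_mom_def power2_commute)
      have "sq_mom P (\<lambda>\<omega>. \<Sum>l\<in>F. g l * coord l t \<omega>) \<le> ennreal (K * (B * D))"
        if F: "finite F" "F \<subseteq> multi_idx" for F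
      proof -
        have "(\<Sum>l\<in>F. (g l)\<^sup>2 * sqlen l powr (- (1 + \<alpha>))) \<le> (\<Sum>l\<in>F. B * sqlen l powr (- (1 + \<alpha> - q)))"
        proof (rule sum_mono)
          fix l assume "l \<in> F"
          then have l: "l \<in> multi_idx" using F by auto
          have "(g l)\<^sup>2 * sqlen l powr (- (1 + \<alpha>)) \<le> (B * sqlen l powr q) * sqlen l powr (- (1 + \<alpha>))"
            using g l by (intro mult_right_mono) auto
          also have "\<dots> = B * sqlen l powr (q + - (1 + \<alpha>))" by (simp only: powr_add mult.assoc)
          also have "q + - (1 + \<alpha>) = - (1 + \<alpha> - q)" by simp
          finally show "(g l)\<^sup>2 * sqlen l powr (- (1 + \<alpha>)) \<le> B * sqlen l powr (- (1 + \<alpha> - q))" .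
        qed
        also have "\<dots> \<le> B * D" unfolding sum_distrib_left[symmetric] by (intro mult_left_mono D F B)
        finally have "K * (\<Sum>l\<in>F. (g l)\<^sup>2 * sqlen l powr (- (1 + \<alpha>))) \<le> K * (B * D)"
          using K(1) by (rule mult_left_mono)
        from order_trans[OF K(2)[OF t F, of g] ennreal_leI[OF this]] show ?thesis .
      qed
      then show "eventually (\<lambda>F. sq_mom P (\<lambda>\<omega>. \<Sum>l\<in>F. g l * coord l t \<omega>) \<le> ennreal (K * (B * D))) (finite_subsets_at_top multi_idx)"
        unfolding eventually_finite_subsets_at_top by (intro exI[of _ "{}"]) auto
    qed simp
    also have "2 * ennreal (K * (B * D)) = ennreal (2 * K * D * B)"
    proof -
      have "2 * ennreal (K * (B * D)) = ennreal (2 * (K * (B * D)))" using K(1) B D(1) by (simp add: ennreal_mult)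
      then show ?thesis by (simp only: mult_ac)
    qed
    finally show ?thesis .
  qed
  note bound = this
  show ?thesis
  proof (intro exI[of _ "2 * K * D"] conjI ballI allI impI)
    show "0 \<le> 2 * K * D" using K(1) D(1) by simp
  qed (rule bound)
qed

lemma point_series:
  assumes "t \<in> {0..1}" "y \<in> cube"
  shows "((\<lambda>F. sq_mom P (\<lambda>\<omega>. X t \<omega> y - (\<Sum>l\<in>F. eigfun kap l y * coord l t \<omega>))) \<longlongrightarrow> 0) (finite_subsets_at_top multi_idx)"
  using X_point_series[of t y] assms
  by (simp add: sq_mom_def coord_def kap_def closure_dom mult.commute)

lemma point_measurable: "t \<in> {0..1} \<Longrightarrow> y \<in> cube \<Longrightarrow> (\<lambda>\<omega>. X t \<omega> y) \<in> borel_measurable P"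
  using X_point_rv by (simp add: closure_dom)

lemma point_sq_mom:
  assumes A1: "cond_A1 P \<theta>0 \<theta>1 \<theta>2 \<alpha> (X 0) l0" and S: "\<forall>t\<in>{0..1}. \<sigma> t \<le> S"
  shows "\<exists>C\<ge>0. \<forall>t\<in>{0..1}. \<forall>y\<in>cube. sq_mom P (\<lambda>\<omega>. X t \<omega> y) \<le> ennreal C"
proof -
  have q: "real CARD('d) < 2 * (1 + \<alpha> - 0)" using alpha_gt by simp
  obtain C where C0: "C \<ge> 0" and C1: "\<forall>t\<in>{0..1}. \<forall>g Z B. Z \<in> borel_measurable P \<longrightarrow> 0 \<le> B \<longrightarrow>
    (\<forall>l\<in>multi_idx. (g l)\<^sup>2 \<le> B * sqlen l powr 0) \<longrightarrow>
    ((\<lambda>F. sq_mom P (\<lambda>\<omega>. Z \<omega> - (\<Sum>l\<in>F. g l * coord l t \<omega>))) \<longlongrightarrow> 0) (finite_subsets_at_top multi_idx) \<longrightarrow>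
    sq_mom P Z \<le> ennreal (C * B)"
    using series_sq_mom[OF A1 S q] by (elim exE conjE) (rule that)
  have C: "sq_mom P Z \<le> ennreal (C * B)" if "t \<in> {0..1}" "Z \<in> borel_measurable P" "0 \<le> B"
    "\<forall>l\<in>multi_idx. (g l)\<^sup>2 \<le> B * sqlen l powr 0"
    "((\<lambda>F. sq_mom P (\<lambda>\<omega>. Z \<omega> - (\<Sum>l\<in>F. g l * coord l t \<omega>))) \<longlongrightarrow> 0) (finite_subsets_at_top multi_idx)" for t g Z B
    by (rule C1[THEN bspec, OF that(1), THEN spec, THEN spec, THEN spec, THEN mp, OF that(2), THEN mp, OF that(3),
        THEN mp, OF that(4), THEN mp, OF that(5)])
  obtain B where B: "B \<ge> 0" "\<And>l y. y \<in> cube \<Longrightarrow> \<bar>eigfun kap l y\<bar> \<le> B"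
    using eigfun_bound[of kap] by blast
  have "sq_mom P (\<lambda>\<omega>. X t \<omega> y) \<le> ennreal (C * B\<^sup>2)" if t: "t \<in> {0..1}" and y: "y \<in> cube" for t y
  proof (rule C[OF t point_measurable[OF t y] _ _ point_series[OF t y]])
    show "\<forall>l\<in>multi_idx. (eigfun kap l y)\<^sup>2 \<le> B\<^sup>2 * sqlen l powr 0"
    proof
      fix l :: "nat ^ 'd" assume "l \<in> multi_idx"
      then show "(eigfun kap l y)\<^sup>2 \<le> B\<^sup>2 * sqlen l powr 0"
        using sqlen_ge_1[of l] abs_le_square_iff[of "eigfun kap l y" B] B(1) B(2)[OF y, of l] by simp
    qed
  qed simp
  then show ?thesis using C0 by (intro exI[of _ "C * B\<^sup>2"]) auto
qed

lemma approx_coord_measurable: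
  assumes "t \<in> {0..1}" shows "(\<lambda>\<omega>. approx_coord M l k (X t \<omega>)) \<in> borel_measurable P"
  unfolding approx_coord_eq
  by (rule borel_measurable_sum)
     (rule borel_measurable_times[OF point_measurable[OF assms space_pt_grid_cube] borel_measurable_const])

text \<open>The residual of the expansion of the discretisation error is a finite combination of the
  residuals of the expansions of the solution at the grid points, so its convergence follows from
  theirs.\<close>

lemma approx_coord_residual:
  assumes F: "finite F" "l0 \<in> F"
  shows "(approx_coord M l0 k u - v l0) - (\<Sum>l\<in>F. (approx_coord M l0 k (e l) - (if l = l0 then 1 else 0)) * v l)
    = (\<Sum>j\<in>grid M. cell_coef M l0 k j * (u (space_pt M j) - (\<Sum>l\<in>F. e l (space_pt M j) * v l)))"
proof -
  let ?b = "cell_coef M l0 k" and ?p = "space_pt M"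
  have "(\<Sum>l\<in>F. (approx_coord M l0 k (e l) - (if l = l0 then 1 else 0)) * v l)
      = (\<Sum>l\<in>F. approx_coord M l0 k (e l) * v l) - (\<Sum>l\<in>F. if l = l0 then v l else 0)"
    unfolding sum_subtractf[symmetric] by (rule sum.cong) (auto simp: left_diff_distrib)
  also have "(\<Sum>l\<in>F. if l = l0 then v l else 0) = v l0" using F by simp
  also have "(\<Sum>l\<in>F. approx_coord M l0 k (e l) * v l) = (\<Sum>l\<in>F. \<Sum>j\<in>grid M. ?b j * (e l (?p j) * v l))"
    unfolding approx_coord_eq sum_distrib_right by (intro sum.cong refl) simp
  also have "\<dots> = (\<Sum>j\<in>grid M. \<Sum>l\<in>F. ?b j * (e l (?p j) * v l))" by (rule sum.swap)
  finally have "(approx_coord M l0 k u - v l0) - (\<Sum>l\<in>F. (approx_coord M l0 k (e l) - (if l = l0 then 1 else 0)) * v l)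
      = approx_coord M l0 k u - (\<Sum>j\<in>grid M. \<Sum>l\<in>F. ?b j * (e l (?p j) * v l))" by simp
  also have "\<dots> = (\<Sum>j\<in>grid M. ?b j * (u (?p j) - (\<Sum>l\<in>F. e l (?p j) * v l)))"
    unfolding approx_coord_eq sum_subtractf[symmetric]
    by (rule sum.cong) (auto simp: right_diff_distrib sum_distrib_left)
  finally show ?thesis .
qed

lemma discretisation_sq_mom:
  assumes A1: "cond_A1 P \<theta>0 \<theta>1 \<theta>2 \<alpha> (X 0) l0" and S: "\<forall>t\<in>{0..1}. \<sigma> t \<le> S"
    and s: "0 \<le> s" "s \<le> 1" and q: "real CARD('d) < 2 * (1 + \<alpha> - s)"
  shows "\<exists>C\<ge>0. \<forall>t\<in>{0..1}. \<forall>M. 1 \<le> min_comp M \<longrightarrow>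
    sq_mom P (\<lambda>\<omega>. approx_coord M l0 kap (X t \<omega>) - coord l0 t \<omega>) \<le> ennreal (C * real (min_comp M) powr (- (2 * s)))"
proof -
  have l0: "l0 \<in> multi_idx" using A1 by (simp add: cond_A1_def Let_def)
  obtain C where C0: "C \<ge> 0" and C1: "\<forall>t\<in>{0..1}. \<forall>g Z B. Z \<in> borel_measurable P \<longrightarrow> 0 \<le> B \<longrightarrow>
    (\<forall>l\<in>multi_idx. (g l)\<^sup>2 \<le> B * sqlen l powr s) \<longrightarrow>
    ((\<lambda>F. sq_mom P (\<lambda>\<omega>. Z \<omega> - (\<Sum>l\<in>F. g l * coord l t \<omega>))) \<longlongrightarrow> 0) (finite_subsets_at_top multi_idx) \<longrightarrow>
    sq_mom P Z \<le> ennreal (C * B)"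
    using series_sq_mom[OF A1 S q] by (elim exE conjE) (rule that)
  have C: "sq_mom P Z \<le> ennreal (C * B)" if "t \<in> {0..1}" "Z \<in> borel_measurable P" "0 \<le> B"
    "\<forall>l\<in>multi_idx. (g l)\<^sup>2 \<le> B * sqlen l powr s"
    "((\<lambda>F. sq_mom P (\<lambda>\<omega>. Z \<omega> - (\<Sum>l\<in>F. g l * coord l t \<omega>))) \<longlongrightarrow> 0) (finite_subsets_at_top multi_idx)" for t g Z B
    by (rule C1[THEN bspec, OF that(1), THEN spec, THEN spec, THEN spec, THEN mp, OF that(2), THEN mp, OF that(3),
        THEN mp, OF that(4), THEN mp, OF that(5)])
  obtain D where D: "D \<ge> 0" "\<And>M l. 1 \<le> min_comp M \<Longrightarrow> l \<in> multi_idx \<Longrightarrow>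
    \<bar>approx_coord M l0 kap (eigfun kap l) - (if l = l0 then 1 else 0)\<bar> \<le> D * (sqrt (sqlen l) / real (min_comp M)) powr s"
    using approx_coord_eigfun[OF s l0, of kap] by blast
  have "sq_mom P (\<lambda>\<omega>. approx_coord M l0 kap (X t \<omega>) - coord l0 t \<omega>) \<le> ennreal (C * (D\<^sup>2 * real (min_comp M) powr (- (2 * s))))"
    if t: "t \<in> {0..1}" and M: "1 \<le> min_comp M" for t M
  proof (rule C[of t _ _ "\<lambda>l. approx_coord M l0 kap (eigfun kap l) - (if l = l0 then 1 else 0)"])
    let ?m = "real (min_comp M)"
    let ?g = "\<lambda>l. approx_coord M l0 kap (eigfun kap l) - (if l = l0 then 1 else 0)"
    let ?b = "cell_coef M l0 kap"
    show "t \<in> {0..1}" by (rule t)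
    let ?R = "\<lambda>F j \<omega>. X t \<omega> (space_pt M j) - (\<Sum>l\<in>F. eigfun kap l (space_pt M j) * coord l t \<omega>)"
    show "(\<lambda>\<omega>. approx_coord M l0 kap (X t \<omega>) - coord l0 t \<omega>) \<in> borel_measurable P"
      by (intro borel_measurable_diff approx_coord_measurable coord_measurable t)
    show "\<forall>l\<in>multi_idx. (?g l)\<^sup>2 \<le> D\<^sup>2 * ?m powr (- (2 * s)) * sqlen l powr s"
    proof
      fix l :: "nat ^ 'd" assume l: "l \<in> multi_idx"
      note ql = sqlen_ge_1[OF l]
      have m: "0 < ?m" using M by simp
      have "(?g l)\<^sup>2 \<le> (D * (sqrt (sqlen l) / ?m) powr s)\<^sup>2"
        using D(2)[OF M l] D(1) by (simp add: abs_le_square_iff[symmetric])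
      also have "\<dots> = D\<^sup>2 * ((sqrt (sqlen l) powr s)\<^sup>2 * ((?m powr s)\<^sup>2 powr (- 1)))"
      proof -
        have "(sqrt (sqlen l) / ?m) powr s = sqrt (sqlen l) powr s / ?m powr s"
          by (rule powr_divide)
        moreover have "((?m powr s)\<^sup>2) powr (- 1) = 1 / (?m powr s)\<^sup>2"
          by (simp add: powr_minus divide_inverse)
        ultimately show ?thesis by (simp only: power_mult_distrib power_divide) simp
      qed
      also have "(sqrt (sqlen l) powr s)\<^sup>2 = sqlen l powr s"
      proof -
        have "sqrt (sqlen l) powr s = (sqlen l powr (1/2)) powr s" using ql by (subst powr_half_sqrt) auto
        also have "\<dots> = sqlen l powr (s/2)" by (simp only: powr_powr) simp
        finally show ?thesis by (simp add: power2_eq_square powr_add[symmetric])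
      qed
      also have "(?m powr s)\<^sup>2 powr (- 1) = ?m powr (- (2 * s))"
        using m by (simp add: power2_eq_square powr_add[symmetric] powr_powr powr_minus_divide)
      finally show "(?g l)\<^sup>2 \<le> D\<^sup>2 * ?m powr (- (2 * s)) * sqlen l powr s" by (simp add: mult_ac)
    qed
    have lim0: "((\<lambda>F. of_nat (card (grid M)) * (\<Sum>j\<in>grid M. ennreal ((?b j)\<^sup>2) * sq_mom P (?R F j)))
        \<longlongrightarrow> of_nat (card (grid M)) * (\<Sum>j\<in>grid M. ennreal ((?b j)\<^sup>2) * 0)) (finite_subsets_at_top multi_idx)"
    proof (intro ennreal_tendsto_cmult tendsto_sum)
      show "of_nat (card (grid M)) < (\<top> :: ennreal)" by (simp add: of_nat_less_top)
      fix j assume "j \<in> grid M"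
      then show "((\<lambda>F. sq_mom P (?R F j)) \<longlongrightarrow> 0) (finite_subsets_at_top multi_idx)"
        by (intro point_series t space_pt_grid_cube)
    qed simp
    have Rm: "?R F j \<in> borel_measurable P" if "j \<in> grid M" for F j
      by (rule borel_measurable_diff[OF point_measurable[OF t space_pt_grid_cube[OF that]]])
         (intro borel_measurable_sum borel_measurable_times borel_measurable_const coord_measurable t)
    have le: "sq_mom P (\<lambda>\<omega>. (approx_coord M l0 kap (X t \<omega>) - coord l0 t \<omega>) - (\<Sum>l\<in>F. ?g l * coord l t \<omega>))
        \<le> of_nat (card (grid M)) * (\<Sum>j\<in>grid M. ennreal ((?b j)\<^sup>2) * sq_mom P (?R F j))"
      if F: "finite F" "l0 \<in> F" for F
    proof -
      have "(approx_coord M l0 kap (X t \<omega>) - coord l0 t \<omega>) - (\<Sum>l\<in>F. ?g l * coord l t \<omega>) = (\<Sum>j\<in>grid M. ?b j * ?R F j \<omega>)" for \<omega>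
        by (rule approx_coord_residual[OF F])
      then have "sq_mom P (\<lambda>\<omega>. (approx_coord M l0 kap (X t \<omega>) - coord l0 t \<omega>) - (\<Sum>l\<in>F. ?g l * coord l t \<omega>))
          = sq_mom P (\<lambda>\<omega>. \<Sum>j\<in>grid M. ?b j * ?R F j \<omega>)" by (simp only:)
      also have "\<dots> \<le> of_nat (card (grid M)) * (\<Sum>j\<in>grid M. sq_mom P (\<lambda>\<omega>. ?b j * ?R F j \<omega>))"
      proof (rule sq_mom_sum_le[OF finite_grid])
        fix j assume "j \<in> grid M"
        then show "(\<lambda>\<omega>. ?b j * ?R F j \<omega>) \<in> borel_measurable P"
          by (rule borel_measurable_times[OF borel_measurable_const Rm])
      qed
      also have "(\<Sum>j\<in>grid M. sq_mom P (\<lambda>\<omega>. ?b j * ?R F j \<omega>)) = (\<Sum>j\<in>grid M. ennreal ((?b j)\<^sup>2) * sq_mom P (?R F j))"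
        by (rule sum.cong[OF refl], rule sq_mom_cmult[OF Rm])
      finally show ?thesis .
    qed
    show "((\<lambda>F. sq_mom P (\<lambda>\<omega>. (approx_coord M l0 kap (X t \<omega>) - coord l0 t \<omega>) - (\<Sum>l\<in>F. ?g l * coord l t \<omega>))) \<longlongrightarrow> 0)
        (finite_subsets_at_top multi_idx)"
    proof (rule tendsto_sandwich[of "\<lambda>_. 0"])
      show "((\<lambda>F. of_nat (card (grid M)) * (\<Sum>j\<in>grid M. ennreal ((?b j)\<^sup>2) * sq_mom P (?R F j))) \<longlongrightarrow> 0) (finite_subsets_at_top multi_idx)"
        using lim0 by simp
      show "eventually (\<lambda>F. sq_mom P (\<lambda>\<omega>. (approx_coord M l0 kap (X t \<omega>) - coord l0 t \<omega>) - (\<Sum>l\<in>F. ?g l * coord l t \<omega>))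
        \<le> of_nat (card (grid M)) * (\<Sum>j\<in>grid M. ennreal ((?b j)\<^sup>2) * sq_mom P (?R F j))) (finite_subsets_at_top multi_idx)"
        unfolding eventually_finite_subsets_at_top using le l0 by (intro exI[of _ "{l0}"]) auto
    qed auto
  qed simp
  then show ?thesis using C0 by (intro exI[of _ "C * D\<^sup>2"]) (auto simp: mult.assoc)
qed

text \<open>As an integrand, the increment of the stochastic convolution differs from \<open>v\<close> on \<open>[s,t)\<close> by
  \<open>\<sigma>(u) (exp(-\<lambda>(t-u)) - exp(-\<lambda>(s-u)))\<close> before \<open>s\<close> and by \<open>v (exp(-\<lambda>(t-u)) - 1)\<close> after \<open>s\<close>. Both
  are of order \<open>t - s\<close> everywhere, and so is the change of the contribution of the initial value.\<close>

lemma coord_increment_sq_mom: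
  assumes A1: "cond_A1 P \<theta>0 \<theta>1 \<theta>2 \<alpha> (X 0) l0" and S: "\<forall>t\<in>{0..1}. \<sigma> t \<le> S"
  shows "\<exists>C\<ge>0. \<forall>s t v. 0 \<le> s \<longrightarrow> s < t \<longrightarrow> t \<le> 1 \<longrightarrow> (\<forall>u\<in>{s<..<t}. \<sigma> u = v) \<longrightarrow>
    sq_mom P (\<lambda>\<omega>. coord l0 t \<omega> - coord l0 s \<omega> - v * \<gamma> l0 powr (- \<alpha> / 2) * (w l0 t \<omega> - w l0 s \<omega>)) \<le> ennreal (C * (t - s)\<^sup>2)"
proof -
  have l: "l0 \<in> multi_idx" using A1 by (simp add: cond_A1_def Let_def)
  let ?L = "lam l0" and ?g = "\<gamma> l0 powr (- \<alpha> / 2)"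
  note lp = lam_pos[OF l]
  obtain K where K: "K \<ge> 0" "sq_mom P (coord l0 0) \<le> ennreal K"
  proof -
    obtain K where K0: "K \<ge> 0" and K1: "\<forall>G c. finite G \<longrightarrow> G \<subseteq> multi_idx \<longrightarrow>
      sq_mom P (\<lambda>\<omega>. \<Sum>l\<in>G. c l * coord l 0 \<omega>) \<le> ennreal (K * (\<Sum>l\<in>G. (c l)\<^sup>2 * lam l powr (- (1 + \<alpha>))))"
      using initial_sum_sq_mom[OF A1] by (elim exE conjE) (rule that)
    from K1[rule_format, of "{l0}" "\<lambda>_. 1"] K0 l show ?thesis
      by (intro that[of "K * lam l0 powr (- (1 + \<alpha>))"]) auto
  qed
  have sb: "\<bar>\<sigma> u\<bar> \<le> S" if "u \<in> {0..1}" for u using S[rule_format, OF that] sigma_pos[OF that] by simp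
  have S0: "0 \<le> S" using sb[of 0] by simp
  have ex: "\<bar>exp (- ?L * a) - exp (- ?L * b)\<bar> \<le> ?L * \<bar>a - b\<bar>" if "0 \<le> a" "0 \<le> b" for a b
  proof -
    have "\<bar>exp (- ?L * a) - exp (- ?L * b)\<bar> \<le> exp 0 * \<bar>- ?L * a - - ?L * b\<bar>"
      using that lp by (intro abs_exp_diff_le) auto
    also have "- ?L * a - - ?L * b = ?L * (b - a)" by (simp add: algebra_simps)
    finally show ?thesis using lp by (simp add: abs_mult abs_minus_commute)
  qed
  have "sq_mom P (\<lambda>\<omega>. coord l0 t \<omega> - coord l0 s \<omega> - v * ?g * (w l0 t \<omega> - w l0 s \<omega>))
      \<le> ennreal ((2 * ?L\<^sup>2 * K + 8 * ?g\<^sup>2 * (S * ?L)\<^sup>2) * (t - s)\<^sup>2)"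
    if st: "0 \<le> s" "s < t" "t \<le> 1" and v: "\<forall>u\<in>{s<..<t}. \<sigma> u = v" for s t v
  proof -
    have t: "t \<in> {0..1}" and s: "s \<in> {0..1}" using st by auto
    have fm: "brownian_family P w {l0}"
      using driving_family l unfolding brownian_family_def by (auto intro: indep_vars_subset)
    let ?J = "\<lambda>\<omega>. (noise l0 t \<omega> - noise l0 s \<omega>) - v * (w l0 t \<omega> - w l0 s \<omega>)"
    define k where "k t = (\<lambda>l' u. if l' = l0 then ou_kernel l0 t u else 0)" for t
    define i where "i t = (\<lambda>l' u. if l' = l0 then indicator {0..<t} u else 0 :: real)" for t :: real
    define f where "f = (\<lambda>l' u. 1 * (1 * k t l' u + - 1 * k s l' u) + - v * (1 * i t l' u + - 1 * i s l' u))"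
    have k: "wiener_limit P w {l0} (k t) (noise l0 t)" if "t \<in> {0..1}" for t
      unfolding k_def by (rule noise_limit[OF _ l that]) simp
    have i: "wiener_limit P w {l0} (i t) (w l0 t)" if "t \<in> {0..1}" for t
      unfolding i_def using that
      by (intro wiener_limit_elementary[OF fm order_refl] elementary.point) auto
    note lin = wiener_limit_lin[OF fm order_refl]
    have "wiener_limit P w {l0} f (\<lambda>\<omega>. 1 * (1 * noise l0 t \<omega> + - 1 * noise l0 s \<omega>) + - v * (1 * w l0 t \<omega> + - 1 * w l0 s \<omega>))"
      unfolding f_def by (rule lin[OF lin[OF k[OF t] k[OF s]] lin[OF i[OF t] i[OF s]]])
    moreover have "(\<lambda>\<omega>. 1 * (1 * noise l0 t \<omega> + - 1 * noise l0 s \<omega>) + - v * (1 * w l0 t \<omega> + - 1 * w l0 s \<omega>)) = ?J"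
      by (simp add: fun_eq_iff)
    ultimately have "wiener_limit P w {l0} f ?J" by (simp only:)
    from wiener_limit_sq_mom[OF fm _ order_refl this]
    have "sq_mom P ?J \<le> 4 * sq_mom lborel (f l0)" by simp
    have f0: "f l0 u = \<sigma> u * (indicator {0..t} u * exp (- ?L * (t - u)) - indicator {0..s} u * exp (- ?L * (s - u)))
        - v * (indicator {0..<t} u - indicator {0..<s} u)" for u
      by (simp add: f_def k_def i_def algebra_simps)
    note \<open>sq_mom P ?J \<le> 4 * sq_mom lborel (f l0)\<close>
    also have "sq_mom lborel (f l0) \<le> sq_mom lborel (\<lambda>u. S * ?L * (t - s) * indicator {0..1::real} u)"
      unfolding sq_mom_def
    proof (rule nn_integral_mono_AE)
      have "AE u in lborel. u \<noteq> s \<and> u \<noteq> t" by (intro AE_conjI AE_lborel_singleton)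
      then show "AE u in lborel. ennreal ((f l0 u)\<^sup>2) \<le> ennreal ((S * ?L * (t - s) * indicator {0..1::real} u)\<^sup>2)"
      proof eventually_elim
        case (elim u)
        have "\<bar>f l0 u\<bar> \<le> \<bar>S * ?L * (t - s) * indicator {0..1::real} u\<bar>"
        proof -
          consider "u < 0 \<or> t < u" | "0 \<le> u" "u < s" | "s < u" "u < t" using elim by linarith
          then show ?thesis
          proof cases
            case 1
            then have "f l0 u = 0" using st unfolding f0 by (auto simp: indicator_def)
            then show ?thesis by simp
          next
            case 2
            then have u: "u \<in> {0..1}" using st by auto
            have "f l0 u = \<sigma> u * (exp (- ?L * (t - u)) - exp (- ?L * (s - u)))"
              using 2 st unfolding f0 by (simp add: indicator_def right_diff_distrib)
            then have "\<bar>f l0 u\<bar> \<le> S * (?L * \<bar>(t - u) - (s - u)\<bar>)"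
              using sb[OF u] ex[of "t - u" "s - u"] 2 st S0 by (simp only: abs_mult) (intro mult_mono; simp)
            then show ?thesis using u st S0 lp by (simp add: abs_mult)
          next
            case 3
            then have u: "u \<in> {0..1}" and \<sigma>: "\<sigma> u = v" using st v by auto
            have "f l0 u = \<sigma> u * (exp (- ?L * (t - u)) - exp (- ?L * 0))"
              using 3 st \<sigma> unfolding f0 by (simp add: indicator_def right_diff_distrib)
            then have "\<bar>f l0 u\<bar> \<le> S * (?L * \<bar>(t - u) - 0\<bar>)"
              using sb[OF u] ex[of "t - u" 0] 3 st S0 by (simp only: abs_mult) (intro mult_mono; simp)
            also have "\<dots> \<le> S * (?L * (t - s))"
              using 3 S0 lp by (intro mult_left_mono) auto
            finally show ?thesis using u st S0 lp by (simp add: abs_mult)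
          qed
        qed
        then show ?case by (intro ennreal_leI) (simp only: abs_le_square_iff)
      qed
    qed
    also have "sq_mom lborel (\<lambda>u. S * ?L * (t - s) * indicator {0..1::real} u) = ennreal ((S * ?L * (t - s))\<^sup>2) * sq_mom lborel (indicator {0..1::real})"
      by (rule sq_mom_cmult) simp
    also have "sq_mom lborel (indicator {0..1::real}) = 1"
    proof -
      have "sq_mom lborel (indicator {0..1::real}) = (\<integral>\<^sup>+u. indicator {0..1::real} u \<partial>lborel)"
        unfolding sq_mom_def by (intro nn_integral_cong) (auto simp: indicator_def)
      then show ?thesis by simp
    qed
    finally have "sq_mom P ?J \<le> 4 * ennreal ((S * ?L * (t - s))\<^sup>2)" by (simp add: mult_left_mono)
    then have J: "sq_mom P ?J \<le> ennreal (4 * (S * ?L * (t - s))\<^sup>2)" by (simp add: ennreal_mult)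
    have Jm [measurable]: "?J \<in> borel_measurable P"
      by (intro borel_measurable_diff borel_measurable_times borel_measurable_const noise_measurable[OF l] t s
          brownian_measurable[OF brownian[OF l]])
    let ?e = "exp (- ?L * t) - exp (- ?L * s)"
    have "AE \<omega> in P. coord l0 t \<omega> - coord l0 s \<omega> - v * ?g * (w l0 t \<omega> - w l0 s \<omega>) = ?e * coord l0 0 \<omega> + ?g * ?J \<omega>"
      using noise(2)[OF l t] noise(2)[OF l s]
    proof eventually_elim
      case (elim \<omega>)
      show ?case unfolding elim by (simp add: algebra_simps)
    qed
    then have "sq_mom P (\<lambda>\<omega>. coord l0 t \<omega> - coord l0 s \<omega> - v * ?g * (w l0 t \<omega> - w l0 s \<omega>))
        = sq_mom P (\<lambda>\<omega>. ?e * coord l0 0 \<omega> + ?g * ?J \<omega>)" by (rule sq_mom_cong_AE)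
    also have "\<dots> \<le> 2 * sq_mom P (\<lambda>\<omega>. ?e * coord l0 0 \<omega>) + 2 * sq_mom P (\<lambda>\<omega>. ?g * ?J \<omega>)"
      using coord_measurable[of 0 l0] Jm by (intro sq_mom_add_le borel_measurable_times borel_measurable_const) auto
    also have "\<dots> = 2 * (ennreal (?e\<^sup>2) * sq_mom P (coord l0 0)) + 2 * (ennreal (?g\<^sup>2) * sq_mom P ?J)"
    proof -
      have c0: "coord l0 0 \<in> borel_measurable P" by (rule coord_measurable) simp
      show ?thesis by (simp only: sq_mom_cmult[OF c0] sq_mom_cmult[OF Jm])
    qed
    also have "\<dots> \<le> 2 * (ennreal ((?L * (t - s))\<^sup>2) * ennreal K) + 2 * (ennreal (?g\<^sup>2) * ennreal (4 * (S * ?L * (t - s))\<^sup>2))"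
    proof (intro add_mono mult_left_mono mult_mono J K(2) ennreal_leI)
      have "\<bar>?e\<bar> \<le> ?L * (t - s)" using ex[of t s] st by simp
      then show "?e\<^sup>2 \<le> (?L * (t - s))\<^sup>2"
        using st lp by (simp add: abs_le_square_iff[symmetric])
    qed auto
    also have "\<dots> = ennreal (2 * ((?L * (t - s))\<^sup>2 * K) + 2 * (?g\<^sup>2 * (4 * (S * ?L * (t - s))\<^sup>2)))"
    proof -
      have "2 * (ennreal a * ennreal b) + 2 * (ennreal c * ennreal d) = ennreal (2 * (a * b) + 2 * (c * d))"
        if "0 \<le> a" "0 \<le> b" "0 \<le> c" "0 \<le> d" for a b c d
        using that by (simp add: ennreal_mult)
      then show ?thesis using K(1) by (simp only: zero_le_power2 mult_nonneg_nonneg zero_le_numeral)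
    qed
    also have "2 * ((?L * (t - s))\<^sup>2 * K) + 2 * (?g\<^sup>2 * (4 * (S * ?L * (t - s))\<^sup>2)) = (2 * ?L\<^sup>2 * K + 8 * ?g\<^sup>2 * (S * ?L)\<^sup>2) * (t - s)\<^sup>2"
      by (simp only: power_mult_distrib) (simp add: algebra_simps)
    finally show ?thesis .
  qed
  then show ?thesis using K(1) by (intro exI[of _ "2 * ?L\<^sup>2 * K + 8 * ?g\<^sup>2 * (S * ?L)\<^sup>2"]) auto
qed

end

section \<open>Deterministic inequalities\<close>

lemma sum_shift_diff:
  fixes Y :: "nat \<Rightarrow> real"
  shows "(\<Sum>k<m. Y (b + 1 + k)) = (\<Sum>i=1..b + m. Y i) - (\<Sum>i=1..b. Y i)"
  by (induction m) auto

text \<open>The linear term \<open>k/n S\<^sub>n\<close> contributes equally to blocks of equal length and cancels in the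
  difference. What remains is a combination of four values of \<open>S\<^sub>k - k/n S\<^sub>n\<close>, each at most the
  maximum; at \<open>k = 0\<close> the value is zero.\<close>

lemma max_bridge_ge_second_difference:
  fixes Y :: "nat \<Rightarrow> real"
  assumes "b + m \<le> c" "c + m \<le> n" "1 \<le> n"
  shows "\<bar>(\<Sum>k<m. Y (c + 1 + k)) - (\<Sum>k<m. Y (b + 1 + k))\<bar>
    \<le> 4 * (MAX k\<in>{1..n}. \<bar>(\<Sum>i=1..k. Y i) - real k / real n * (\<Sum>i=1..n. Y i)\<bar>)"
proof -
  let ?D = "\<lambda>k. (\<Sum>i=1..k. Y i) - real k / real n * (\<Sum>i=1..n. Y i)"
  let ?M = "MAX k\<in>{1..n}. \<bar>?D k\<bar>"
  have ge: "\<bar>?D k\<bar> \<le> ?M" if "k \<in> {1..n}" for k using that by (intro Max_ge) auto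
  have "0 \<le> ?M" using ge[of 1] assms by auto
  then have D: "\<bar>?D k\<bar> \<le> ?M" if "k \<le> n" for k using ge[of k] that by (cases "k = 0") auto
  have lin: "real (c + m) / real n - real c / real n = real (b + m) / real n - real b / real n"
    by (simp add: diff_divide_distrib[symmetric])
  have "(\<Sum>k<m. Y (c + 1 + k)) - (\<Sum>k<m. Y (b + 1 + k)) = ?D (c + m) - ?D c - (?D (b + m) - ?D b)
      + (real (c + m) / real n - real c / real n - (real (b + m) / real n - real b / real n)) * (\<Sum>i=1..n. Y i)"
    unfolding sum_shift_diff by (simp add: algebra_simps)
  then have "(\<Sum>k<m. Y (c + 1 + k)) - (\<Sum>k<m. Y (b + 1 + k)) = ?D (c + m) - ?D c - (?D (b + m) - ?D b)"
    unfolding lin by simp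
  then have eq: "(\<Sum>k<m. Y (c + 1 + k)) - (\<Sum>k<m. Y (b + 1 + k)) = ?D (c + m) - ?D c - (?D (b + m) - ?D b)" .
  have quad: "\<bar>p - q - (r - s)\<bar> \<le> 4 * M" if "\<bar>p\<bar> \<le> M" "\<bar>q\<bar> \<le> M" "\<bar>r\<bar> \<le> M" "\<bar>s\<bar> \<le> M" for p q r s M :: real
    using that by linarith
  show ?thesis unfolding eq by (rule quad) (intro D; use assms in linarith)+
qed

text \<open>The cross terms are split by \<open>2 \<bar>x y\<bar> \<le> e x\<^sup>2 + y\<^sup>2 / e\<close>, which is why the errors have to be
  of order \<open>e\<^sup>2\<close>.\<close>

lemma sum_squares_perturb:
  fixes G \<rho> :: "nat \<Rightarrow> real"
  assumes e: "0 < e" "e \<le> 1" and G: "\<bar>(\<Sum>k<m. (G k)\<^sup>2) - v\<bar> \<le> e" and v: "v \<le> V" and \<rho>: "(\<Sum>k<m. (\<rho> k)\<^sup>2) \<le> e\<^sup>2"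
  shows "\<bar>(\<Sum>k<m. (G k + \<rho> k)\<^sup>2) - v\<bar> \<le> e * (V + 4)"
proof -
  have amgm: "\<bar>2 * (x * y)\<bar> \<le> e * x\<^sup>2 + y\<^sup>2 / e" for x y :: real
  proof -
    have "0 \<le> (e * \<bar>x\<bar> - \<bar>y\<bar>)\<^sup>2 / e" using e by simp
    also have "\<dots> = e * x\<^sup>2 + y\<^sup>2 / e - 2 * \<bar>x\<bar> * \<bar>y\<bar>"
      using e by (simp add: power2_diff power_mult_distrib field_simps power2_eq_square)
    finally show ?thesis by (simp add: abs_mult)
  qed
  have "(\<Sum>k<m. (G k + \<rho> k)\<^sup>2) - (\<Sum>k<m. (G k)\<^sup>2) = (\<Sum>k<m. 2 * (G k * \<rho> k) + (\<rho> k)\<^sup>2)"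
    unfolding sum_subtractf[symmetric] by (intro sum.cong refl) (simp add: power2_sum)
  also have "\<bar>\<dots>\<bar> \<le> (\<Sum>k<m. \<bar>2 * (G k * \<rho> k) + (\<rho> k)\<^sup>2\<bar>)" by (rule sum_abs)
  also have "\<dots> \<le> (\<Sum>k<m. e * (G k)\<^sup>2 + (\<rho> k)\<^sup>2 / e + (\<rho> k)\<^sup>2)"
  proof (rule sum_mono)
    fix k
    show "\<bar>2 * (G k * \<rho> k) + (\<rho> k)\<^sup>2\<bar> \<le> e * (G k)\<^sup>2 + (\<rho> k)\<^sup>2 / e + (\<rho> k)\<^sup>2"
      using amgm[of "G k" "\<rho> k"] zero_le_power2[of "\<rho> k"] by linarith
  qed
  also have "\<dots> = e * (\<Sum>k<m. (G k)\<^sup>2) + (\<Sum>k<m. (\<rho> k)\<^sup>2) / e + (\<Sum>k<m. (\<rho> k)\<^sup>2)"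
    by (simp add: sum.distrib sum_distrib_left sum_divide_distrib)
  also have "\<dots> \<le> e * (V + 1) + e + e"
  proof (intro add_mono mult_left_mono)
    show "(\<Sum>k<m. (G k)\<^sup>2) \<le> V + 1" using G v e by linarith
    have "(\<Sum>k<m. (\<rho> k)\<^sup>2) / e \<le> e\<^sup>2 / e" using \<rho> e by (intro divide_right_mono) auto
    then show "(\<Sum>k<m. (\<rho> k)\<^sup>2) / e \<le> e" using e by (simp add: power2_eq_square)
    have "e\<^sup>2 \<le> e" using e by (simp add: power2_eq_square mult_le_cancel_left1)
    then show "(\<Sum>k<m. (\<rho> k)\<^sup>2) \<le> e" using \<rho> by linarith
  qed (use e in auto)
  finally have "\<bar>(\<Sum>k<m. (G k + \<rho> k)\<^sup>2) - (\<Sum>k<m. (G k)\<^sup>2)\<bar> \<le> e * (V + 1) + e + e" .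
  then show ?thesis using G by (simp add: algebra_simps)
qed

lemma mesh_bounds:
  assumes "1 \<le> n" "n \<le> N"
  shows "mesh N n \<le> 1 / real n" and "1 / (2 * real n) \<le> mesh N n" and "0 < mesh N n" and "real n * mesh N n \<le> 1"
proof -
  have n: "0 < real n" "0 < real N" "real n \<le> real N" using assms by auto
  define q where "q = real N / real n"
  have q1: "1 \<le> q" using n by (simp add: q_def le_divide_eq)
  have f: "real_of_int \<lfloor>q\<rfloor> \<le> q" "q < real_of_int \<lfloor>q\<rfloor> + 1" by linarith+
  have f1: "1 \<le> real_of_int \<lfloor>q\<rfloor>" using q1 by simp
  have half: "q / 2 \<le> real_of_int \<lfloor>q\<rfloor>" using f f1 by linarith
  have "mesh N n \<le> q / real N" unfolding mesh_def q_def[symmetric] using f n by (intro divide_right_mono) auto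
  then show up: "mesh N n \<le> 1 / real n" using n by (simp add: q_def)
  have "(q / 2) / real N \<le> mesh N n" unfolding mesh_def q_def[symmetric] using half n by (intro divide_right_mono) auto
  then show lo: "1 / (2 * real n) \<le> mesh N n" using n by (simp add: q_def field_simps)
  then show "0 < mesh N n" using n by (intro less_le_trans[OF _ lo]) simp
  show "real n * mesh N n \<le> 1" using up n by (simp add: field_simps)
qed

text \<open>The time-regularity factor in the first part of \<^const>\<open>cond_A3\<close> is at least the mesh, whichever
  of its three cases applies. The bound \<open>1/3\<close> ensures \<open>-ln h \<ge> 1\<close>.\<close>

lemma wedge_small_ge:
  assumes "0 < h" "h \<le> 1/3" "0 < a" shows "h \<le> wedge_small h a 1"
proof -
  have "ln h \<le> ln (1/3)" using assms by simp
  also have "\<dots> \<le> -1"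
  proof -
    have "exp 1 \<le> (3::real)" using exp_le by simp
    then have "1 \<le> ln (3::real)" using ln_ge_iff[of 3 1] by simp
    then show ?thesis by (simp add: ln_div)
  qed
  finally have "h * 1 \<le> h * - ln h" using assms by (intro mult_left_mono) auto
  moreover have "h \<le> h powr a" if "a < 1" using powr_mono'[of a 1 h] assms that by simp
  ultimately show ?thesis using assms unfolding wedge_small_def by auto
qed

text \<open>In the critical case the logarithm, which is at least \<open>1\<close> from \<open>L = 3\<close> on, only decreases
  the value.\<close>

lemma wedge_large_le:
  assumes L: "3 \<le> L" and "0 < a"
  shows "wedge_large L a 2 \<le> L powr (min a 2)" and "0 < wedge_large L a 2"
proof -
  have "exp 1 \<le> L" using exp_le L by linarith
  then have ln: "1 \<le> ln L" using ln_ge_iff[of L 1] L by simp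
  have inv: "1 / (1 / L) powr b = L powr b" for b using L by (simp add: powr_divide)
  consider "a < 2" | "a = 2" | "a > 2" by linarith
  then have "wedge_large L a 2 \<le> L powr (min a 2) \<and> 0 < wedge_large L a 2"
  proof cases
    case 1
    then show ?thesis using L inv[of a] by (simp add: wedge_large_def wedge_small_def)
  next
    case 3
    then show ?thesis using L inv[of 2] by (simp add: wedge_large_def wedge_small_def)
  next
    case 2
    have "wedge_large L a 2 = 1 / (1 / L) powr 2 / ln L"
      using 2 L by (simp add: wedge_large_def wedge_small_def ln_div)
    also have "\<dots> = L powr 2 / ln L" by (simp only: inv)
    finally have eq: "wedge_large L a 2 = L powr 2 / ln L" .
    have "L powr 2 / ln L \<le> L powr 2 / 1" using ln by (intro divide_left_mono) auto
    then show ?thesis unfolding eq using 2 L ln by auto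
  qed
  then show "wedge_large L a 2 \<le> L powr (min a 2)" "0 < wedge_large L a 2" by auto
qed

section \<open>The asymptotic regime\<close>

text \<open>\<open>S\<close> is an upper bound of the volatility. The points \<open>i = (N, M, n)\<close> of the filter are
  addressed through the projections abbreviated below.\<close>

locale observation_scheme = spde_model P \<theta>0 \<theta>1 \<theta>2 \<alpha> \<gamma> \<sigma> w X
  for P :: "'w measure" and \<theta>0 and \<theta>1 :: "real ^ 'd::finite" and \<theta>2 \<alpha> \<gamma> \<sigma> w X +
  fixes l0 :: "nat ^ 'd" and R :: "nat \<Rightarrow> nat ^ 'd \<Rightarrow> real"
    and \<kappa>hat :: "nat \<Rightarrow> nat ^ 'd \<Rightarrow> (nat \<times> (nat ^ 'd) \<Rightarrow> real) \<Rightarrow> real ^ 'd"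
    and F :: "(nat \<times> (nat ^ 'd) \<times> nat) filter"
    and S :: real
  assumes regime: "regime F"
    and A1: "cond_A1 P \<theta>0 \<theta>1 \<theta>2 \<alpha> (X 0) l0"
    and A2: "cond_A2 P (\<theta>1 /\<^sub>R \<theta>2) X R \<kappa>hat"
    and A3: "cond_A3 \<alpha> R F"
    and sigma_bound: "\<forall>t\<in>{0..1}. \<sigma> t \<le> S"
begin

lemma l0: "l0 \<in> multi_idx"
  using A1 by (simp add: cond_A1_def Let_def)

abbreviation num :: "nat \<times> (nat ^ 'd) \<times> nat \<Rightarrow> nat" where "num i \<equiv> snd (snd i)"
abbreviation step :: "nat \<times> (nat ^ 'd) \<times> nat \<Rightarrow> real" where "step i \<equiv> mesh (fst i) (snd (snd i))"
abbreviation res :: "nat \<times> (nat ^ 'd) \<times> nat \<Rightarrow> nat" where "res i \<equiv> min_comp (fst (snd i))"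
abbreviation rate :: "nat \<times> (nat ^ 'd) \<times> nat \<Rightarrow> real" where "rate i \<equiv> R (fst i) (fst (snd i))"

lemma num_at_top: "filterlim num at_top F"
  using regime by (simp add: regime_def split_def)

lemma num_real_at_top: "filterlim (\<lambda>i. real (num i)) at_top F"
  by (rule filterlim_compose[OF filterlim_real_sequentially num_at_top])

lemma res_at_top: "filterlim res at_top F"
  using regime by (simp add: regime_def split_def)

lemma ev_basic: "eventually (\<lambda>i. 1 \<le> num i \<and> num i \<le> fst i \<and> 3 \<le> num i \<and> 3 \<le> res i) F"
proof -
  have "eventually (\<lambda>i. 3 \<le> num i) F" "eventually (\<lambda>i. 3 \<le> res i) F"
    using num_at_top res_at_top by (auto simp: filterlim_at_top)
  moreover have "eventually (\<lambda>i. 1 \<le> num i \<and> num i \<le> fst i) F"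
    using regime by (simp add: regime_def split_def)
  ultimately show ?thesis by eventually_elim auto
qed

lemma ev_mesh: "eventually (\<lambda>i. step i \<le> 1 / real (num i) \<and> 1 / (2 * real (num i)) \<le> step i \<and> 0 < step i \<and> real (num i) * step i \<le> 1) F"
  using ev_basic
proof eventually_elim
  case (elim i)
  obtain N M n where i: "i = (N, M, n)" by (cases i)
  from elim have "1 \<le> n" "n \<le> N" by (auto simp: i)
  then show ?case using mesh_bounds[of n N] by (simp add: i)
qed

lemma inverse_num_tendsto: "((\<lambda>i. 1 / real (num i)) \<longlongrightarrow> 0) F"
  using tendsto_inverse_0_at_top[OF num_real_at_top] by (simp add: inverse_eq_divide)

lemma step_tendsto: "(step \<longlongrightarrow> 0) F"
proof (rule tendsto_sandwich[OF _ _ tendsto_const inverse_num_tendsto])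
  show "eventually (\<lambda>i. 0 \<le> step i) F" "eventually (\<lambda>i. step i \<le> 1 / real (num i)) F"
    using ev_mesh by (eventually_elim, simp)+
qed

lemma to_obs_filter: "filterlim (\<lambda>i. (fst i, fst (snd i))) obs_filter F"
  unfolding obs_filter_def
proof (rule filterlim_Pair)
  show "filterlim fst at_top F"
    by (rule filterlim_at_top_mono[OF num_at_top]) (use ev_basic in \<open>eventually_elim, simp\<close>)
  show "filterlim (\<lambda>i. fst (snd i)) (filtercomap min_comp at_top) F"
    using res_at_top by (simp add: filterlim_filtercomap_iff o_def split_def)
qed

lemma rate_pos: "eventually (\<lambda>i. 0 < rate i) F"
  using ev_basic
proof eventually_elim
  case (elim i)
  obtain N M n where i: "i = (N, M, n)" by (cases i)
  have "M \<in> multi_idx" using elim by (intro min_comp_multi_idx) (simp add: i)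
  moreover have "1 \<le> N" using elim by (simp add: i)
  ultimately show ?case using A2 by (simp add: cond_A2_def i)
qed

text \<open>The mesh is at least \<open>1/(2n)\<close>, so \<open>n\<^sup>2 \<Delta> \<ge> n/2\<close>, and the numerator in \<^const>\<open>cond_A3\<close> is at least
  \<open>n\<^sup>2 \<Delta>\<close>.\<close>

lemma num_over_rate: "((\<lambda>i. real (num i) / (rate i)\<^sup>2) \<longlongrightarrow> 0) F"
proof (rule tendsto_sandwich[OF _ _ tendsto_const])
  let ?a = "1 + \<alpha> - real CARD('d) / 2"
  have a: "0 < ?a" using alpha_gt by simp
  have "((\<lambda>i. 2 * ((real (num i))\<^sup>2 * wedge_small (step i) ?a 1 / (rate i)\<^sup>2)) \<longlongrightarrow> 2 * 0) F"
    using A3 by (intro tendsto_mult tendsto_const) (simp add: cond_A3_def split_def)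
  then show "((\<lambda>i. 2 * ((real (num i))\<^sup>2 * wedge_small (step i) ?a 1 / (rate i)\<^sup>2)) \<longlongrightarrow> 0) F" by simp
  show "eventually (\<lambda>i. 0 \<le> real (num i) / (rate i)\<^sup>2) F" by simp
  show "eventually (\<lambda>i. real (num i) / (rate i)\<^sup>2 \<le> 2 * ((real (num i))\<^sup>2 * wedge_small (step i) ?a 1 / (rate i)\<^sup>2)) F"
    using ev_basic ev_mesh
  proof eventually_elim
    case (elim i)
    have n: "3 \<le> real (num i)" using elim by linarith
    have "1 / real (num i) \<le> 1 / 3" using n by (intro divide_left_mono) auto
    then have "step i \<le> 1 / 3" using elim by linarith
    then have "step i \<le> wedge_small (step i) ?a 1" using elim a by (intro wedge_small_ge) auto
    then have "1 / (2 * real (num i)) \<le> wedge_small (step i) ?a 1" using elim by linarith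
    then have "2 * (real (num i))\<^sup>2 * (1 / (2 * real (num i))) \<le> 2 * (real (num i))\<^sup>2 * wedge_small (step i) ?a 1"
      by (intro mult_left_mono) auto
    then have "real (num i) \<le> 2 * (real (num i))\<^sup>2 * wedge_small (step i) ?a 1"
      using n by (simp add: power2_eq_square)
    then have "real (num i) / (rate i)\<^sup>2 \<le> (2 * (real (num i))\<^sup>2 * wedge_small (step i) ?a 1) / (rate i)\<^sup>2"
      by (intro divide_right_mono) auto
    then show ?case by (simp add: mult.assoc)
  qed
qed

text \<open>Convergence of the series over \<open>l\<close> requires an exponent strictly below \<open>(2(1+\<alpha>)-d)/2\<close>, and
  interpolation with the Lipschitz bound one of at most \<open>1\<close>. Two thirds of the smaller of these
  bounds satisfy both, and they turn the power \<open>n\<^sup>3\<^sup>/\<^sup>2\<close> in \<^const>\<open>cond_A3\<close> into \<open>n\<close>.\<close>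

definition "hoelder_exp = min (2 * (1 + \<alpha>) - real CARD('d)) 2 / 3"

lemma hoelder_exp: "0 \<le> hoelder_exp" "hoelder_exp \<le> 1" "real CARD('d) < 2 * (1 + \<alpha> - hoelder_exp)"
proof -
  define a where "a = 2 * (1 + \<alpha>) - real CARD('d)"
  define b where "b = min a 2"
  have a: "0 < a" using alpha_gt by (simp add: a_def)
  have b: "0 < b" "b \<le> 2" "b \<le> a" using a by (auto simp: b_def)
  have h: "hoelder_exp = b / 3" by (simp add: hoelder_exp_def b_def a_def)
  show "0 \<le> hoelder_exp" "hoelder_exp \<le> 1" using b by (simp_all add: h)
  have "real CARD('d) = 2 * (1 + \<alpha>) - a" by (simp add: a_def)
  then show "real CARD('d) < 2 * (1 + \<alpha> - hoelder_exp)" using a b by (simp add: h)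
qed

lemma num_times_res: "((\<lambda>i. real (num i) * real (res i) powr (- (2 * hoelder_exp))) \<longlongrightarrow> 0) F"
proof -
  let ?a = "2 * (1 + \<alpha>) - real CARD('d)"
  let ?b = "min ?a 2"
  have a: "0 < ?a" using alpha_gt by simp
  have "((\<lambda>i. real (num i) powr (3/2) * real (res i) powr (- ?b)) \<longlongrightarrow> 0) F"
  proof (rule tendsto_sandwich[OF _ _ tendsto_const])
    show "((\<lambda>i. real (num i) powr (3/2) / wedge_large (real (res i)) ?a 2) \<longlongrightarrow> 0) F"
      using A3 by (simp add: cond_A3_def split_def)
    show "eventually (\<lambda>i. 0 \<le> real (num i) powr (3/2) * real (res i) powr (- ?b)) F" by simp
    show "eventually (\<lambda>i. real (num i) powr (3/2) * real (res i) powr (- ?b)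
        \<le> real (num i) powr (3/2) / wedge_large (real (res i)) ?a 2) F"
      using ev_basic
    proof eventually_elim
      case (elim i)
      then have L: "3 \<le> real (res i)" by linarith
      have "real (num i) powr (3/2) * real (res i) powr (- ?b) = real (num i) powr (3/2) / real (res i) powr ?b"
        by (simp only: powr_minus_divide) simp
      also have "\<dots> \<le> real (num i) powr (3/2) / wedge_large (real (res i)) ?a 2"
        using wedge_large_le[OF L a] L by (intro divide_left_mono mult_pos_pos) auto
      finally show ?case .
    qed
  qed
  then have "((\<lambda>i. (real (num i) powr (3/2) * real (res i) powr (- ?b)) powr (2/3)) \<longlongrightarrow> 0) F"
    by (rule tendsto_zero_powrI[OF _ tendsto_const]) auto
  moreover have "(real n powr (3/2) * real m powr (- ?b)) powr (2/3) = real n * real m powr (- (2 * hoelder_exp))" for n m :: nat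
  proof -
    have "(real n powr (3/2) * real m powr (- ?b)) powr (2/3) = (real n powr (3/2)) powr (2/3) * (real m powr (- ?b)) powr (2/3)"
      by (rule powr_mult)
    also have "\<dots> = real n powr 1 * real m powr (- ?b * (2/3))" by (simp only: powr_powr) simp
    also have "- ?b * (2/3) = - (2 * hoelder_exp)" by (simp add: hoelder_exp_def)
    finally show ?thesis by simp
  qed
  ultimately show ?thesis by simp
qed

section \<open>Measurability of the estimators and the statistic\<close>

lemma obs_measurable: "obs X N M \<in> measurable P (obs_space N M)"
  unfolding obs_def obs_space_def
proof (rule measurable_restrict)
  fix p assume p: "p \<in> obs_idx N M"
  obtain i j where ij: "p = (i, j)" by (cases p)
  have "real i / real N \<in> {0..1}" using p by (auto simp: obs_idx_def ij divide_le_eq_1)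
  moreover have "space_pt M j \<in> cube" using p by (intro space_pt_cube) (auto simp: obs_idx_def ij)
  ultimately show "(\<lambda>\<omega>. case p of (i, j) \<Rightarrow> X (real i / real N) \<omega> (space_pt M j)) \<in> borel_measurable P"
    by (simp add: ij point_measurable)
qed

lemma estimator_measurable:
  assumes "f \<in> measurable (obs_space N M) A" shows "(\<lambda>\<omega>. f (obs X N M \<omega>)) \<in> measurable P A"
  by (rule measurable_compose[OF obs_measurable assms])

lemma kappa_measurable: "(\<lambda>\<omega>. \<kappa>hat N M (obs X N M \<omega>)) \<in> borel_measurable P"
  using A2 by (intro estimator_measurable) (simp add: cond_A2_def)

lemma approx_coord_hat_measurable:
  assumes "t \<in> {0..1}"
  shows "(\<lambda>\<omega>. approx_coord M l0 (\<kappa>hat N M (obs X N M \<omega>)) (X t \<omega>)) \<in> borel_measurable P"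
  unfolding approx_coord_eq
  by (rule borel_measurable_sum)
     (rule borel_measurable_times[OF point_measurable[OF assms space_pt_grid_cube]
        measurable_compose[OF kappa_measurable measurable_cell_coef]])

lemma sq_incr_measurable:
  assumes "real i * mesh N n \<in> {0..1}" "(real i - 1) * mesh N n \<in> {0..1}"
  shows "sq_incr X \<kappa>hat l0 N M n i \<in> borel_measurable P"
  unfolding sq_incr_def
  by (intro borel_measurable_power borel_measurable_diff approx_coord_hat_measurable assms)

section \<open>The estimation error of the drift parameter\<close>

text \<open>An explicit, slowly growing bound replaces the unspecified constants of boundedness in
  probability, which depend on the error level.\<close>

lemma bounded_in_prob_whp:
  fixes Z :: "nat \<Rightarrow> nat ^ 'd \<Rightarrow> 'w \<Rightarrow> 'b::{real_normed_vector, second_countable_topology}"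
  assumes bd: "bounded_in_prob P obs_filter (\<lambda>(N, M). Z N M)" and m: "\<And>N M. Z N M \<in> borel_measurable P"
    and L: "filterlim L at_top F"
  shows "whp P F (\<lambda>i \<omega>. norm (Z (fst i) (fst (snd i)) \<omega>) \<le> L i)"
  unfolding whp_def
proof (intro allI impI)
  fix e :: real assume "e > 0"
  then obtain K where "eventually (\<lambda>p. measure P {\<omega>\<in>space P. norm (Z (fst p) (snd p) \<omega>) > K} < e) obs_filter"
    using bd unfolding bounded_in_prob_def split_def by blast
  then have "eventually (\<lambda>i. measure P {\<omega>\<in>space P. norm (Z (fst i) (fst (snd i)) \<omega>) > K} < e) F"
    using to_obs_filter unfolding filterlim_iff by fastforce
  moreover have "eventually (\<lambda>i. K \<le> L i) F" using L by (simp add: filterlim_at_top)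
  ultimately show "eventually (\<lambda>i. \<exists>B\<in>sets P. measure P B \<le> e \<and> (\<forall>\<omega>\<in>space P - B. norm (Z (fst i) (fst (snd i)) \<omega>) \<le> L i)) F"
  proof eventually_elim
    case (elim i)
    let ?B = "{\<omega>\<in>space P. norm (Z (fst i) (fst (snd i)) \<omega>) > K}"
    have "?B \<in> sets P" using m[of "fst i" "fst (snd i)"] by measurable
    then show ?case using elim by (intro bexI[of _ ?B]) auto
  qed
qed

definition "dkappa i \<omega> = norm (\<kappa>hat (fst i) (fst (snd i)) (obs X (fst i) (fst (snd i)) \<omega>) - kap)"

text \<open>This tends to infinity. Its power \<open>1/4\<close>, used as the bound for \<open>R (\<kappa>hat - \<kappa>)\<close>, still leaves
  \<open>n \<bar>\<kappa>hat - \<kappa>\<bar>\<^sup>2\<close> at most \<open>slow_seq\<close> to the power \<open>-1/2\<close>.\<close>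

definition "slow_seq i = (rate i)\<^sup>2 / real (num i)"

lemma slow_at_top: "filterlim slow_seq at_top F"
proof -
  have "eventually (\<lambda>i. 0 < real (num i) / (rate i)\<^sup>2) F"
    using ev_basic rate_pos by eventually_elim (auto intro!: divide_pos_pos)
  then have "filterlim (\<lambda>i. inverse (real (num i) / (rate i)\<^sup>2)) at_top F"
    using num_over_rate by (intro filterlim_inverse_at_top) auto
  then show ?thesis by (simp add: slow_seq_def[abs_def])
qed

lemma dkappa_whp: "whp P F (\<lambda>i \<omega>. dkappa i \<omega> \<le> slow_seq i powr (1/4) / rate i)"
proof -
  have bd: "bounded_in_prob P obs_filter (\<lambda>(N, M). \<lambda>\<omega>. R N M *\<^sub>R (\<kappa>hat N M (obs X N M \<omega>) - kap))"
    using A2 by (simp add: cond_A2_def kap_def case_prod_beta' split_def)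
  have m: "(\<lambda>\<omega>. R N M *\<^sub>R (\<kappa>hat N M (obs X N M \<omega>) - kap)) \<in> borel_measurable P" for N M
    by (intro borel_measurable_scaleR borel_measurable_diff borel_measurable_const kappa_measurable)
  have L: "filterlim (\<lambda>i. slow_seq i powr (1/4)) at_top F"
  proof -
    have "((\<lambda>i. slow_seq i powr (- (1/4))) \<longlongrightarrow> 0) F" by (rule tendsto_neg_powr[OF _ slow_at_top]) simp
    moreover have "eventually (\<lambda>i. 0 < slow_seq i powr (- (1/4))) F"
      using filterlim_at_top_dense[THEN iffD1, OF slow_at_top, rule_format, of 0] by eventually_elim simp
    ultimately have "filterlim (\<lambda>i. inverse (slow_seq i powr (- (1/4)))) at_top F" by (rule filterlim_inverse_at_top)
    then show ?thesis by (simp add: powr_minus)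
  qed
  have ev: "eventually (\<lambda>i. \<forall>\<omega>\<in>space P. norm (R (fst i) (fst (snd i)) *\<^sub>R (\<kappa>hat (fst i) (fst (snd i)) (obs X (fst i) (fst (snd i)) \<omega>) - kap)) \<le> slow_seq i powr (1/4)
      \<longrightarrow> dkappa i \<omega> \<le> slow_seq i powr (1/4) / rate i) F"
    using rate_pos
  proof eventually_elim
    case (elim i)
    then show ?case by (auto simp: dkappa_def split_def le_divide_eq mult.commute)
  qed
  show ?thesis by (rule whp_mono[OF bounded_in_prob_whp[OF bd m L] ev])
qed

lemma slow_times_tendsto: "((\<lambda>i. (slow_seq i powr (1/4) / rate i)\<^sup>2 * real (num i)) \<longlongrightarrow> 0) F"
proof -
  have "((\<lambda>i. slow_seq i powr (- (1/2))) \<longlongrightarrow> 0) F"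
    by (rule tendsto_neg_powr[OF _ slow_at_top]) simp
  moreover have "eventually (\<lambda>i. slow_seq i powr (- (1/2)) = (slow_seq i powr (1/4) / rate i)\<^sup>2 * real (num i)) F"
    using ev_basic rate_pos
  proof eventually_elim
    case (elim i)
    then have s: "0 < slow_seq i" unfolding slow_seq_def by (intro divide_pos_pos) auto
    have "(slow_seq i powr (1/4) / rate i)\<^sup>2 * real (num i) = (slow_seq i powr (1/4))\<^sup>2 / slow_seq i"
      by (simp add: slow_seq_def power_divide)
    also have "(slow_seq i powr (1/4))\<^sup>2 = slow_seq i powr (1/2)"
      by (simp add: power2_eq_square powr_add[symmetric])
    also have "slow_seq i powr (1/2) / slow_seq i = slow_seq i powr (1/2 - 1)" using s by (simp only: powr_diff) simp
    finally show ?case by simp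
  qed
  ultimately show ?thesis by (rule Lim_transform_eventually)
qed

text \<open>The coefficients change by at most \<open>L \<bar>\<kappa>' - \<kappa>\<bar>\<close> times the cell volumes, which add up to one;
  the Cauchy-Schwarz inequality with the volumes as weights gives a spatial root mean square of
  \<open>u\<close>, whose second moment is under control even though the estimator and the solution are
  dependent.\<close>

lemma approx_coord_kappa_diff:
  shows "\<exists>L\<ge>0. \<forall>M \<kappa>' u. M \<in> multi_idx \<longrightarrow> norm (\<kappa>' - kap) \<le> 1 \<longrightarrow>
    \<bar>approx_coord M l0 \<kappa>' u - approx_coord M l0 kap u\<bar>
      \<le> L * norm (\<kappa>' - kap) * sqrt (\<Sum>j\<in>grid M. measure lborel (cell M j) * (u (space_pt M j))\<^sup>2)"
proof -
  obtain L where L: "L \<ge> 0" "\<And>M \<kappa>' j. M \<in> multi_idx \<Longrightarrow> norm (\<kappa>' - kap) \<le> 1 \<Longrightarrow> j \<in> grid M \<Longrightarrow>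
    \<bar>cell_coef M l0 \<kappa>' j - cell_coef M l0 kap j\<bar> \<le> L * norm (\<kappa>' - kap) * measure lborel (cell M j)"
    using cell_coef_lipschitz[of kap l0] by blast
  have "\<bar>approx_coord M l0 \<kappa>' u - approx_coord M l0 kap u\<bar>
      \<le> L * norm (\<kappa>' - kap) * sqrt (\<Sum>j\<in>grid M. measure lborel (cell M j) * (u (space_pt M j))\<^sup>2)"
    if M: "M \<in> multi_idx" and k: "norm (\<kappa>' - kap) \<le> 1" for M \<kappa>' u
  proof -
    let ?v = "\<lambda>j. measure lborel (cell M j)" and ?u = "\<lambda>j. u (space_pt M j)"
    have "(\<Sum>j\<in>grid M. ?v j * \<bar>?u j\<bar>)\<^sup>2 = (\<Sum>j\<in>grid M. sqrt (?v j) * (sqrt (?v j) * \<bar>?u j\<bar>))\<^sup>2"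
      by (simp add: mult.assoc[symmetric])
    also have "\<dots> \<le> (\<Sum>j\<in>grid M. (sqrt (?v j))\<^sup>2) * (\<Sum>j\<in>grid M. (sqrt (?v j) * \<bar>?u j\<bar>)\<^sup>2)"
      by (rule Cauchy_Schwarz_ineq_sum)
    also have "\<dots> = (\<Sum>j\<in>grid M. ?v j * (?u j)\<^sup>2)"
      by (simp add: power_mult_distrib sum_measure_cell[OF M])
    finally have cs: "(\<Sum>j\<in>grid M. ?v j * \<bar>?u j\<bar>) \<le> sqrt (\<Sum>j\<in>grid M. ?v j * (?u j)\<^sup>2)"
      by (rule real_le_rsqrt)
    have "\<bar>approx_coord M l0 \<kappa>' u - approx_coord M l0 kap u\<bar>
        = \<bar>\<Sum>j\<in>grid M. ?u j * (cell_coef M l0 \<kappa>' j - cell_coef M l0 kap j)\<bar>"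
      by (simp add: approx_coord_eq sum_subtractf right_diff_distrib)
    also have "\<dots> \<le> (\<Sum>j\<in>grid M. \<bar>?u j * (cell_coef M l0 \<kappa>' j - cell_coef M l0 kap j)\<bar>)" by (rule sum_abs)
    also have "\<dots> \<le> (\<Sum>j\<in>grid M. (L * norm (\<kappa>' - kap)) * (?v j * \<bar>?u j\<bar>))"
    proof (rule sum_mono)
      fix j assume "j \<in> grid M"
      then have "\<bar>?u j\<bar> * \<bar>cell_coef M l0 \<kappa>' j - cell_coef M l0 kap j\<bar> \<le> \<bar>?u j\<bar> * (L * norm (\<kappa>' - kap) * ?v j)"
        by (intro mult_left_mono L M k) auto
      then show "\<bar>?u j * (cell_coef M l0 \<kappa>' j - cell_coef M l0 kap j)\<bar> \<le> (L * norm (\<kappa>' - kap)) * (?v j * \<bar>?u j\<bar>)"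
        by (simp add: abs_mult mult_ac)
    qed
    also have "\<dots> \<le> (L * norm (\<kappa>' - kap)) * sqrt (\<Sum>j\<in>grid M. ?v j * (?u j)\<^sup>2)"
      unfolding sum_distrib_left[symmetric] using L(1) cs by (intro mult_left_mono) auto
    finally show ?thesis .
  qed
  note bound = this
  show ?thesis
  proof (intro exI[of _ L] conjI allI impI)
    show "0 \<le> L" by (rule L)
  qed (rule bound)
qed

text \<open>The temporal increment is simply bounded by the two values of the solution: the rate of the
  drift estimator compensates for the loss.\<close>

lemma spatial_energy_sq_mom:
  "\<exists>C\<ge>0. \<forall>s\<in>{0..1}. \<forall>t\<in>{0..1}. \<forall>M\<in>multi_idx.
    sq_mom P (\<lambda>\<omega>. sqrt (\<Sum>j\<in>grid M. measure lborel (cell M j) * (X t \<omega> (space_pt M j) - X s \<omega> (space_pt M j))\<^sup>2)) \<le> ennreal C"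
proof -
  obtain C where C: "C \<ge> 0" "\<And>t y. t \<in> {0..1} \<Longrightarrow> y \<in> cube \<Longrightarrow> sq_mom P (\<lambda>\<omega>. X t \<omega> y) \<le> ennreal C"
    using point_sq_mom[OF A1 sigma_bound] by blast
  have "sq_mom P (\<lambda>\<omega>. sqrt (\<Sum>j\<in>grid M. measure lborel (cell M j) * (X t \<omega> (space_pt M j) - X s \<omega> (space_pt M j))\<^sup>2)) \<le> ennreal (4 * C)"
    if s: "s \<in> {0..1}" and t: "t \<in> {0..1}" and M: "M \<in> multi_idx" for s t M
  proof -
    let ?v = "\<lambda>j. measure lborel (cell M j)" and ?U = "\<lambda>j \<omega>. X t \<omega> (space_pt M j) - X s \<omega> (space_pt M j)"
    have m: "?U j \<in> borel_measurable P" if "j \<in> grid M" for j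
      by (intro borel_measurable_diff point_measurable s t space_pt_grid_cube that)
    have U: "sq_mom P (?U j) \<le> ennreal (4 * C)" if "j \<in> grid M" for j
    proof -
      note c = space_pt_grid_cube[OF that]
      have "sq_mom P (\<lambda>\<omega>. X t \<omega> (space_pt M j) + (- 1) * X s \<omega> (space_pt M j))
        \<le> 2 * sq_mom P (\<lambda>\<omega>. X t \<omega> (space_pt M j)) + 2 * sq_mom P (\<lambda>\<omega>. (- 1) * X s \<omega> (space_pt M j))"
        by (intro sq_mom_add_le borel_measurable_times borel_measurable_const point_measurable s t c)
      also have "sq_mom P (\<lambda>\<omega>. (- 1) * X s \<omega> (space_pt M j)) = sq_mom P (\<lambda>\<omega>. X s \<omega> (space_pt M j))"
        by (simp add: sq_mom_def)
      also have "2 * sq_mom P (\<lambda>\<omega>. X t \<omega> (space_pt M j)) + 2 * sq_mom P (\<lambda>\<omega>. X s \<omega> (space_pt M j)) \<le> 2 * ennreal C + 2 * ennreal C"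
        by (intro add_mono mult_left_mono C s t c) auto
      also have "\<dots> = (2 + 2) * ennreal C" by (simp only: distrib_right)
      also have "\<dots> = ennreal (4 * C)" using C(1) by (simp add: ennreal_mult)
      finally show ?thesis by simp
    qed
    have "sq_mom P (\<lambda>\<omega>. sqrt (\<Sum>j\<in>grid M. ?v j * (?U j \<omega>)\<^sup>2)) = (\<integral>\<^sup>+\<omega>. (\<Sum>j\<in>grid M. ennreal (?v j) * ennreal ((?U j \<omega>)\<^sup>2)) \<partial>P)"
      unfolding sq_mom_def
      by (intro nn_integral_cong) (simp add: sum_nonneg ennreal_mult[symmetric])
    also have "\<dots> = (\<Sum>j\<in>grid M. ennreal (?v j) * sq_mom P (?U j))"
      unfolding sq_mom_def using m
      by (subst nn_integral_sum) (auto intro!: sum.cong nn_integral_cmult borel_measurable_times_ennreal measurable_compose[OF _ measurable_ennreal] borel_measurable_power)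
    also have "\<dots> \<le> (\<Sum>j\<in>grid M. ennreal (?v j) * ennreal (4 * C))"
      by (intro sum_mono mult_left_mono U) auto
    also have "\<dots> = ennreal ((\<Sum>j\<in>grid M. ?v j) * (4 * C))"
      using C(1) unfolding sum_distrib_right by (subst sum_ennreal[symmetric]) (auto simp: ennreal_mult intro!: mult_nonneg_nonneg)
    also have "\<dots> = ennreal (4 * C)" by (simp add: sum_measure_cell[OF M])
    finally show ?thesis .
  qed
  then show ?thesis using C(1) by (intro exI[of _ "4 * C"]) auto
qed

text \<open>The blocks below have at most \<open>n\<close> elements, so error terms of size \<open>o(1/n)\<close> sum to \<open>o(1)\<close>.\<close>

lemma card_times_tendsto:
  assumes x: "((\<lambda>i. real (num i) * x i) \<longlongrightarrow> 0) F" and x0: "eventually (\<lambda>i. 0 \<le> x i) F"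
    and m: "eventually (\<lambda>i. m i \<le> num i) F" and K: "0 \<le> K"
  shows "((\<lambda>i. real (card {..<m i}) * (K * x i)) \<longlongrightarrow> 0) F"
proof (rule tendsto_sandwich[OF _ _ tendsto_const])
  have "((\<lambda>i. K * (real (num i) * x i)) \<longlongrightarrow> K * 0) F" by (intro tendsto_mult tendsto_const x)
  then show "((\<lambda>i. K * (real (num i) * x i)) \<longlongrightarrow> 0) F" by simp
  show "eventually (\<lambda>i. 0 \<le> real (card {..<m i}) * (K * x i)) F"
    using x0 by eventually_elim (use K in auto)
  show "eventually (\<lambda>i. real (card {..<m i}) * (K * x i) \<le> K * (real (num i) * x i)) F"
    using x0 m
  proof eventually_elim
    case (elim i)
    then have "real (m i) * (K * x i) \<le> real (num i) * (K * x i)" using K by (intro mult_right_mono) auto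
    then show ?case by (simp add: mult_ac)
  qed
qed

section \<open>Sums of squares over a block of constant volatility\<close>

text \<open>The times of the block that starts at grid index \<open>b i\<close>; increment number \<open>k\<close> of the block is
  the one with index \<open>b i + 1 + k\<close> in the statistic.\<close>

definition "tgrid b i k = real (b i + k) * step i"

context
  fixes b m :: "nat \<times> (nat ^ 'd) \<times> nat \<Rightarrow> nat" and v :: real
  assumes block: "eventually (\<lambda>i. m i \<le> num i \<and> tgrid b i (m i) \<le> 1 \<and> (\<forall>u\<in>{tgrid b i 0<..<tgrid b i (m i)}. \<sigma> u = v)) F"
begin

abbreviation "tt \<equiv> tgrid b"
abbreviation "vol \<equiv> v * \<gamma> l0 powr (- \<alpha> / 2)"
abbreviation "dw i k \<omega> \<equiv> w l0 (tt i (Suc k)) \<omega> - w l0 (tt i k) \<omega>"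
abbreviation "ou_rest i k \<omega> \<equiv> coord l0 (tt i (Suc k)) \<omega> - coord l0 (tt i k) \<omega> - vol * dw i k \<omega>"
abbreviation "disc i k \<omega> \<equiv> approx_coord (fst (snd i)) l0 kap (X (tt i k) \<omega>) - coord l0 (tt i k) \<omega>"
abbreviation "khat i \<omega> \<equiv> \<kappa>hat (fst i) (fst (snd i)) (obs X (fst i) (fst (snd i)) \<omega>)"
abbreviation "est i k \<omega> \<equiv> approx_coord (fst (snd i)) l0 (khat i \<omega>) (X (tt i k) \<omega>) - approx_coord (fst (snd i)) l0 kap (X (tt i k) \<omega>)"

lemma ev_block: "eventually (\<lambda>i. m i \<le> num i \<and> 0 < step i \<and> step i \<le> 1 / real (num i) \<and> 1 \<le> num i \<and> real (num i) * step i \<le> 1 \<and>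
    1 \<le> res i \<and> fst (snd i) \<in> multi_idx \<and>
    (\<forall>k<m i. tt i k \<in> {0..1} \<and> tt i (Suc k) \<in> {0..1} \<and> 0 \<le> tt i k \<and> tt i k < tt i (Suc k) \<and> tt i (Suc k) \<le> 1 \<and>
      tt i (Suc k) - tt i k = step i \<and> (\<forall>u\<in>{tt i k<..<tt i (Suc k)}. \<sigma> u = v)) \<and> tt i (m i) \<le> 1 \<and> 0 \<le> tt i 0) F"
  using block ev_mesh ev_basic
proof eventually_elim
  case (elim i)
  then have s: "0 < step i" by simp
  have mono: "tt i k \<le> tt i k'" if "k \<le> k'" for k k'
    unfolding tgrid_def using that s by (intro mult_right_mono) auto
  have "tt i k \<in> {0..1} \<and> tt i (Suc k) \<in> {0..1} \<and> 0 \<le> tt i k \<and> tt i k < tt i (Suc k) \<and> tt i (Suc k) \<le> 1 \<and>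
      tt i (Suc k) - tt i k = step i \<and> (\<forall>u\<in>{tt i k<..<tt i (Suc k)}. \<sigma> u = v)" if "k < m i" for k
  proof -
    have z: "0 \<le> tt i k" using s by (simp add: tgrid_def)
    have d: "tt i (Suc k) - tt i k = step i" by (simp add: tgrid_def algebra_simps)
    have o: "tt i (Suc k) \<le> tt i (m i)" "tt i 0 \<le> tt i k" using that by (auto intro: mono)
    have "tt i (m i) \<le> 1" "\<forall>u\<in>{tt i 0<..<tt i (m i)}. \<sigma> u = v" using elim by auto
    moreover have "{tt i k<..<tt i (Suc k)} \<subseteq> {tt i 0<..<tt i (m i)}" using o by auto
    ultimately show ?thesis using z d s o by auto
  qed
  moreover have "0 \<le> tt i 0" using s by (simp add: tgrid_def)
  moreover have "fst (snd i) \<in> multi_idx" using elim by (intro min_comp_multi_idx) linarith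
  ultimately show ?case using elim by auto
qed

lemma ev_m: "eventually (\<lambda>i. m i \<le> num i) F"
  using ev_block by eventually_elim simp

text \<open>The squares of the Brownian increments concentrate: the variance of the sum is of order
  \<open>m \<Delta>\<^sup>2 \<le> 1/n\<close>.\<close>

lemma main_part:
  assumes e: "0 < e"
  shows "whp P F (\<lambda>i \<omega>. \<bar>(\<Sum>k<m i. (vol * dw i k \<omega>)\<^sup>2) - vol\<^sup>2 * (real (m i) * step i)\<bar> \<le> e)"
proof -
  let ?Z = "\<lambda>i (k::nat) \<omega>. vol\<^sup>2 * ((\<Sum>k<m i. (dw i k \<omega>)\<^sup>2) - real (m i) * step i)"
  let ?C = "\<lambda>i. (vol\<^sup>2)\<^sup>2 * 2 * (1 / real (num i))"
  note bm = brownian[OF l0]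
  have "whp P F (\<lambda>i \<omega>. (\<Sum>k\<in>{0}. (?Z i k \<omega>)\<^sup>2) \<le> e\<^sup>2)"
  proof (rule whp_sum_squares)
    have "(?C \<longlongrightarrow> (vol\<^sup>2)\<^sup>2 * 2 * 0) F" by (intro tendsto_mult tendsto_const inverse_num_tendsto)
    then show "((\<lambda>i. real (card {0::nat}) * ?C i) \<longlongrightarrow> 0) F" by simp
    show "eventually (\<lambda>i. finite {0::nat} \<and> 0 \<le> ?C i \<and> (\<forall>k\<in>{0}. ?Z i k \<in> borel_measurable P \<and> sq_mom P (?Z i k) \<le> ennreal (?C i))) F"
      using ev_block
    proof eventually_elim
      case (elim i)
      let ?Y = "\<lambda>\<omega>. (\<Sum>k<m i. (dw i k \<omega>)\<^sup>2) - real (m i) * step i"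
      have Ym: "?Y \<in> borel_measurable P"
        using elim by (intro borel_measurable_diff borel_measurable_sum borel_measurable_power borel_measurable_const brownian_measurable[OF bm]) auto
      have tt: "tt i k = tt i 0 + real k * step i" for k by (simp add: tgrid_def algebra_simps)
      have "tt i 0 + real (m i) * step i \<le> 1" using elim tt[of "m i"] by simp
      from brownian_quadratic_variation[OF bm _ _ this]
      have "sq_mom P ?Y \<le> ennreal (2 * real (m i) * (step i)\<^sup>2)"
        using elim by (simp only: tt[symmetric])
      also have "\<dots> \<le> ennreal (2 * (1 / real (num i)))"
      proof (rule ennreal_leI)
        have "real (m i) * step i \<le> real (num i) * step i" using elim by (intro mult_right_mono) auto
        then have "real (m i) * step i \<le> 1" using elim by linarith
        then have "(real (m i) * step i) * step i \<le> 1 * (1 / real (num i))"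
          using elim by (intro mult_mono) auto
        then show "2 * real (m i) * (step i)\<^sup>2 \<le> 2 * (1 / real (num i))" by (simp add: power2_eq_square)
      qed
      finally have Y: "sq_mom P ?Y \<le> ennreal (2 * (1 / real (num i)))" .
      have "sq_mom P (\<lambda>\<omega>. vol\<^sup>2 * ?Y \<omega>) = ennreal ((vol\<^sup>2)\<^sup>2) * sq_mom P ?Y" by (rule sq_mom_cmult[OF Ym])
      also have "\<dots> \<le> ennreal ((vol\<^sup>2)\<^sup>2) * ennreal (2 * (1 / real (num i)))" by (intro mult_left_mono Y) auto
      also have "\<dots> = ennreal (?C i)" by (subst ennreal_mult[symmetric]) (auto simp: mult.assoc)
      finally have "sq_mom P (\<lambda>\<omega>. vol\<^sup>2 * ?Y \<omega>) \<le> ennreal (?C i)" .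
      moreover have "(\<lambda>\<omega>. vol\<^sup>2 * ?Y \<omega>) \<in> borel_measurable P" by (intro borel_measurable_times borel_measurable_const Ym)
      moreover have "0 \<le> ?C i" by (intro mult_nonneg_nonneg zero_le_power2) simp_all
      ultimately show ?case by blast
    qed
  qed (use e in simp)
  then show ?thesis
  proof (rule whp_mono, intro always_eventually allI ballI impI)
    have abs_le: "\<bar>z\<bar> \<le> e" if "(\<Sum>k\<in>{0::nat}. z\<^sup>2) \<le> e\<^sup>2" for z
      using that e by (simp add: abs_le_square_iff[symmetric])
    have scale: "(\<Sum>k\<in>A. (c * f k)\<^sup>2) - c\<^sup>2 * y = c\<^sup>2 * ((\<Sum>k\<in>A. (f k)\<^sup>2) - y)" for c y :: real and f and A :: "nat set"
      by (simp add: power_mult_distrib sum_distrib_left right_diff_distrib)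
    fix i \<omega> assume z: "(\<Sum>k\<in>{0}. (?Z i k \<omega>)\<^sup>2) \<le> e\<^sup>2"
    show "\<bar>(\<Sum>k<m i. (vol * dw i k \<omega>)\<^sup>2) - vol\<^sup>2 * (real (m i) * step i)\<bar> \<le> e"
      unfolding scale by (rule abs_le[OF z])
  qed
qed

lemma ou_rest_part:
  assumes e: "0 < e"
  shows "whp P F (\<lambda>i \<omega>. (\<Sum>k<m i. (ou_rest i k \<omega>)\<^sup>2) \<le> e)"
proof -
  obtain C where C0: "C \<ge> 0" and C1: "\<forall>s t v. 0 \<le> s \<longrightarrow> s < t \<longrightarrow> t \<le> 1 \<longrightarrow> (\<forall>u\<in>{s<..<t}. \<sigma> u = v) \<longrightarrow>
    sq_mom P (\<lambda>\<omega>. coord l0 t \<omega> - coord l0 s \<omega> - v * \<gamma> l0 powr (- \<alpha> / 2) * (w l0 t \<omega> - w l0 s \<omega>)) \<le> ennreal (C * (t - s)\<^sup>2)"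
    using coord_increment_sq_mom[OF A1 sigma_bound] by (elim exE conjE) (rule that)
  show ?thesis
  proof (rule whp_sum_squares[OF _ _ e])
    have "((\<lambda>i. real (num i) * (step i)\<^sup>2) \<longlongrightarrow> 0) F"
    proof (rule tendsto_sandwich[OF _ _ tendsto_const step_tendsto])
      show "eventually (\<lambda>i. 0 \<le> real (num i) * (step i)\<^sup>2) F" by simp
      show "eventually (\<lambda>i. real (num i) * (step i)\<^sup>2 \<le> step i) F"
        using ev_mesh
      proof eventually_elim
        case (elim i)
        then have "(real (num i) * step i) * step i \<le> 1 * step i" by (intro mult_right_mono) auto
        then show ?case by (simp add: power2_eq_square)
      qed
    qed
    then show "((\<lambda>i. real (card {..<m i}) * (C * (step i)\<^sup>2)) \<longlongrightarrow> 0) F"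
      by (rule card_times_tendsto) (use ev_m C0 in auto)
    show "eventually (\<lambda>i. finite {..<m i} \<and> 0 \<le> C * (step i)\<^sup>2 \<and>
        (\<forall>k\<in>{..<m i}. ou_rest i k \<in> borel_measurable P \<and> sq_mom P (ou_rest i k) \<le> ennreal (C * (step i)\<^sup>2))) F"
      using ev_block
    proof eventually_elim
      case (elim i)
      have "ou_rest i k \<in> borel_measurable P \<and> sq_mom P (ou_rest i k) \<le> ennreal (C * (step i)\<^sup>2)" if k: "k < m i" for k
      proof -
        have t: "tt i k \<in> {0..1}" "tt i (Suc k) \<in> {0..1}" "0 \<le> tt i k" "tt i k < tt i (Suc k)" "tt i (Suc k) \<le> 1"
          "tt i (Suc k) - tt i k = step i" "\<forall>u\<in>{tt i k<..<tt i (Suc k)}. \<sigma> u = v"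
          using elim k by blast+
        have "sq_mom P (ou_rest i k) \<le> ennreal (C * (tt i (Suc k) - tt i k)\<^sup>2)"
          using C1[rule_format, OF t(3,4,5)] t(7) by blast
        moreover have "ou_rest i k \<in> borel_measurable P"
          by (intro borel_measurable_diff borel_measurable_times borel_measurable_const coord_measurable t brownian_measurable[OF brownian[OF l0]])
        ultimately show ?thesis by (simp only: t(6))
      qed
      then show ?case using C0 by auto
    qed
  qed
qed

text \<open>The increments of the discretisation error are bounded by its values at the two times;
  uniformity in time suffices.\<close>

lemma disc_part:
  assumes e: "0 < e"
  shows "whp P F (\<lambda>i \<omega>. (\<Sum>k<m i. (disc i (Suc k) \<omega> - disc i k \<omega>)\<^sup>2) \<le> e)"
proof -
  obtain C where C0: "C \<ge> 0" and C1: "\<forall>t\<in>{0..1}. \<forall>M. 1 \<le> min_comp M \<longrightarrow>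
    sq_mom P (\<lambda>\<omega>. approx_coord M l0 kap (X t \<omega>) - coord l0 t \<omega>) \<le> ennreal (C * real (min_comp M) powr (- (2 * hoelder_exp)))"
    using discretisation_sq_mom[OF A1 sigma_bound hoelder_exp] by (elim exE conjE) (rule that)
  let ?x = "\<lambda>i. real (res i) powr (- (2 * hoelder_exp))"
  show ?thesis
  proof (rule whp_sum_squares[OF _ _ e])
    show "((\<lambda>i. real (card {..<m i}) * (4 * C * ?x i)) \<longlongrightarrow> 0) F"
      by (rule card_times_tendsto[OF num_times_res]) (use ev_m C0 in auto)
    show "eventually (\<lambda>i. finite {..<m i} \<and> 0 \<le> 4 * C * ?x i \<and>
        (\<forall>k\<in>{..<m i}. (\<lambda>\<omega>. disc i (Suc k) \<omega> - disc i k \<omega>) \<in> borel_measurable P \<and>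
          sq_mom P (\<lambda>\<omega>. disc i (Suc k) \<omega> - disc i k \<omega>) \<le> ennreal (4 * C * ?x i))) F"
      using ev_block
    proof eventually_elim
      case (elim i)
      have "(\<lambda>\<omega>. disc i (Suc k) \<omega> - disc i k \<omega>) \<in> borel_measurable P \<and>
          sq_mom P (\<lambda>\<omega>. disc i (Suc k) \<omega> - disc i k \<omega>) \<le> ennreal (4 * C * ?x i)" if k: "k < m i" for k
      proof -
        have t: "tt i k \<in> {0..1}" "tt i (Suc k) \<in> {0..1}" using elim k by blast+
        have r: "1 \<le> res i" using elim by blast
        have mm: "disc i k' \<in> borel_measurable P" if "tt i k' \<in> {0..1}" for k'
          by (intro borel_measurable_diff approx_coord_measurable coord_measurable that)
        have "sq_mom P (\<lambda>\<omega>. disc i (Suc k) \<omega> + (- 1) * disc i k \<omega>)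
            \<le> 2 * sq_mom P (disc i (Suc k)) + 2 * sq_mom P (\<lambda>\<omega>. (- 1) * disc i k \<omega>)"
          by (intro sq_mom_add_le borel_measurable_times borel_measurable_const mm t)
        also have "sq_mom P (\<lambda>\<omega>. (- 1) * disc i k \<omega>) = sq_mom P (disc i k)"
          by (simp add: sq_mom_def power2_commute)
        also have "2 * sq_mom P (disc i (Suc k)) + 2 * sq_mom P (disc i k) \<le> 2 * ennreal (C * ?x i) + 2 * ennreal (C * ?x i)"
          using C1[rule_format, OF t(1) r] C1[rule_format, OF t(2) r] by (intro add_mono mult_left_mono) auto
        also have "\<dots> = ennreal (4 * C * ?x i)"
        proof -
          have "2 * ennreal a + 2 * ennreal a = ennreal (4 * a)" if "0 \<le> a" for a
          proof -
            have "2 * ennreal a + 2 * ennreal a = (2 + 2) * ennreal a" by (simp only: distrib_right)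
            then show ?thesis using that by (simp add: ennreal_mult)
          qed
          from this[of "C * ?x i"] C0 show ?thesis by (simp add: mult.assoc)
        qed
        finally have "sq_mom P (\<lambda>\<omega>. disc i (Suc k) \<omega> - disc i k \<omega>) \<le> ennreal (4 * C * ?x i)"
          by (simp only: mult_minus1 add_uminus_conv_diff)
        moreover have "(\<lambda>\<omega>. disc i (Suc k) \<omega> - disc i k \<omega>) \<in> borel_measurable P"
          by (intro borel_measurable_diff[OF mm mm] t)
        ultimately show ?thesis by blast
      qed
      then show ?case using C0 by auto
    qed
  qed
qed

text \<open>On the event that the drift estimator is close to the true parameter, each increment is at
  most the deterministic bound on the estimation error times the spatial root mean square of the
  increment of the solution.\<close>

lemma est_part:
  assumes e: "0 < e"
  shows "whp P F (\<lambda>i \<omega>. (\<Sum>k<m i. (est i (Suc k) \<omega> - est i k \<omega>)\<^sup>2) \<le> e)"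
proof -
  obtain L where L0: "L \<ge> 0" and L1: "\<forall>M \<kappa>' u. M \<in> multi_idx \<longrightarrow> norm (\<kappa>' - kap) \<le> 1 \<longrightarrow>
    \<bar>approx_coord M l0 \<kappa>' u - approx_coord M l0 kap u\<bar>
      \<le> L * norm (\<kappa>' - kap) * sqrt (\<Sum>j\<in>grid M. measure lborel (cell M j) * (u (space_pt M j))\<^sup>2)"
    using approx_coord_kappa_diff by (elim exE conjE) (rule that)
  obtain C where C0: "C \<ge> 0" and C1: "\<forall>s\<in>{0..1}. \<forall>t\<in>{0..1}. \<forall>M\<in>multi_idx.
    sq_mom P (\<lambda>\<omega>. sqrt (\<Sum>j\<in>grid M. measure lborel (cell M j) * (X t \<omega> (space_pt M j) - X s \<omega> (space_pt M j))\<^sup>2)) \<le> ennreal C"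
    using spatial_energy_sq_mom by (elim exE conjE) (rule that)
  define a where "a i = slow_seq i powr (1/4) / rate i" for i
  define En where "En i k \<omega> = sqrt (\<Sum>j\<in>grid (fst (snd i)). measure lborel (cell (fst (snd i)) j) *
     (X (tt i (Suc k)) \<omega> (space_pt (fst (snd i)) j) - X (tt i k) \<omega> (space_pt (fst (snd i)) j))\<^sup>2)" for i k \<omega>
  have lim: "((\<lambda>i. real (num i) * (a i)\<^sup>2) \<longlongrightarrow> 0) F"
    using slow_times_tendsto by (simp add: a_def mult.commute)
  have small: "whp P F (\<lambda>i \<omega>. (\<Sum>k<m i. (L * a i * En i k \<omega>)\<^sup>2) \<le> e)"
  proof (rule whp_sum_squares[OF _ _ e])
    show "((\<lambda>i. real (card {..<m i}) * (L\<^sup>2 * C * (a i)\<^sup>2)) \<longlongrightarrow> 0) F"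
      by (rule card_times_tendsto[OF lim]) (use ev_m C0 in auto)
    show "eventually (\<lambda>i. finite {..<m i} \<and> 0 \<le> L\<^sup>2 * C * (a i)\<^sup>2 \<and>
        (\<forall>k\<in>{..<m i}. (\<lambda>\<omega>. L * a i * En i k \<omega>) \<in> borel_measurable P \<and>
          sq_mom P (\<lambda>\<omega>. L * a i * En i k \<omega>) \<le> ennreal (L\<^sup>2 * C * (a i)\<^sup>2))) F"
      using ev_block
    proof eventually_elim
      case (elim i)
      have "(\<lambda>\<omega>. L * a i * En i k \<omega>) \<in> borel_measurable P \<and>
          sq_mom P (\<lambda>\<omega>. L * a i * En i k \<omega>) \<le> ennreal (L\<^sup>2 * C * (a i)\<^sup>2)" if k: "k < m i" for k
      proof -
        have t: "tt i k \<in> {0..1}" "tt i (Suc k) \<in> {0..1}" and M: "fst (snd i) \<in> multi_idx" using elim k by blast+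
        have m: "En i k \<in> borel_measurable P"
          unfolding En_def
        proof (rule measurable_compose[OF _ borel_measurable_sqrt], rule borel_measurable_sum)
          fix j assume "j \<in> grid (fst (snd i))"
          then show "(\<lambda>\<omega>. measure lborel (cell (fst (snd i)) j) *
             (X (tt i (Suc k)) \<omega> (space_pt (fst (snd i)) j) - X (tt i k) \<omega> (space_pt (fst (snd i)) j))\<^sup>2) \<in> borel_measurable P"
            by (intro borel_measurable_times borel_measurable_const borel_measurable_power borel_measurable_diff point_measurable t space_pt_grid_cube)
        qed
        have "sq_mom P (\<lambda>\<omega>. L * a i * En i k \<omega>) = ennreal ((L * a i)\<^sup>2) * sq_mom P (En i k)"
          by (rule sq_mom_cmult[OF m])
        also have "\<dots> \<le> ennreal ((L * a i)\<^sup>2) * ennreal C"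
          using C1[rule_format, OF t M] by (intro mult_left_mono) (simp_all add: En_def[abs_def])
        also have "\<dots> = ennreal (L\<^sup>2 * C * (a i)\<^sup>2)"
          using C0 by (subst ennreal_mult[symmetric]) (auto simp: power_mult_distrib mult_ac)
        finally show ?thesis using m by (auto intro!: borel_measurable_times)
      qed
      then show ?case using C0 by auto
    qed
  qed
  have a1: "eventually (\<lambda>i. (a i)\<^sup>2 \<le> 1) F"
  proof -
    have "eventually (\<lambda>i. real (num i) * (a i)\<^sup>2 < 1) F" using lim by (rule order_tendstoD) simp
    with ev_basic show ?thesis
    proof eventually_elim
      case (elim i)
      then have "1 * (a i)\<^sup>2 \<le> real (num i) * (a i)\<^sup>2" by (intro mult_right_mono) auto
      with elim show ?case by linarith
    qed
  qed
  show ?thesis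
  proof (rule whp_mono[OF whp_conj[OF small dkappa_whp[folded a_def]]])
    show "eventually (\<lambda>i. \<forall>\<omega>\<in>space P. (\<Sum>k<m i. (L * a i * En i k \<omega>)\<^sup>2) \<le> e \<and> dkappa i \<omega> \<le> a i \<longrightarrow>
        (\<Sum>k<m i. (est i (Suc k) \<omega> - est i k \<omega>)\<^sup>2) \<le> e) F"
      using ev_block a1
    proof eventually_elim
      case (elim i)
      have M: "fst (snd i) \<in> multi_idx" using elim by blast
      show ?case
      proof (intro ballI impI)
        fix \<omega> assume "\<omega> \<in> space P" and h: "(\<Sum>k<m i. (L * a i * En i k \<omega>)\<^sup>2) \<le> e \<and> dkappa i \<omega> \<le> a i"
        have dn: "norm (khat i \<omega> - kap) = dkappa i \<omega>" by (simp add: dkappa_def)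
        have da: "0 \<le> dkappa i \<omega>" "dkappa i \<omega> \<le> a i" using h by (auto simp: dkappa_def)
        have "a i \<le> 1" using elim(2) da by (simp add: abs_square_le_1)
        then have d1: "norm (khat i \<omega> - kap) \<le> 1" unfolding dn using da by linarith
        have "(est i (Suc k) \<omega> - est i k \<omega>)\<^sup>2 \<le> (L * a i * En i k \<omega>)\<^sup>2" for k
        proof -
          let ?u = "\<lambda>y. X (tt i (Suc k)) \<omega> y - X (tt i k) \<omega> y"
          have "est i (Suc k) \<omega> - est i k \<omega> = approx_coord (fst (snd i)) l0 (khat i \<omega>) ?u - approx_coord (fst (snd i)) l0 kap ?u"
            by (simp add: approx_coord_eq left_diff_distrib sum_subtractf)
          then have "\<bar>est i (Suc k) \<omega> - est i k \<omega>\<bar> \<le> L * dkappa i \<omega> * En i k \<omega>"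
            using L1[rule_format, OF M d1, of ?u] by (simp add: En_def dn)
          also have "\<dots> \<le> L * a i * En i k \<omega>"
            using da L0 by (intro mult_right_mono mult_left_mono) (auto simp: En_def intro!: sum_nonneg)
          finally have "\<bar>est i (Suc k) \<omega> - est i k \<omega>\<bar> \<le> \<bar>L * a i * En i k \<omega>\<bar>" by linarith
          then show ?thesis by (simp only: abs_le_square_iff)
        qed
        then have "(\<Sum>k<m i. (est i (Suc k) \<omega> - est i k \<omega>)\<^sup>2) \<le> (\<Sum>k<m i. (L * a i * En i k \<omega>)\<^sup>2)"
          by (intro sum_mono) auto
        then show "(\<Sum>k<m i. (est i (Suc k) \<omega> - est i k \<omega>)\<^sup>2) \<le> e" using h by linarith
      qed
    qed
  qed
qed

text \<open>On the intersection of the four events the Brownian increments and the three errors satisfy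
  the hypotheses of \<open>sum_squares_perturb\<close>.\<close>

lemma block_whp:
  assumes e: "0 < e"
  shows "whp P F (\<lambda>i \<omega>. \<bar>(\<Sum>k<m i. sq_incr X \<kappa>hat l0 (fst i) (fst (snd i)) (num i) (b i + 1 + k) \<omega>)
     - vol\<^sup>2 * (real (m i) * step i)\<bar> \<le> e)"
proof -
  \<comment> \<open>The limit is at most \<open>vol\<^sup>2\<close>, because the block has length at most one; this is the choice
    that \<open>sum_squares_perturb\<close> asks for. The square of a sum of three errors costs a factor \<open>3\<close>
    and there are three of them, whence \<open>d\<^sup>2 / 9\<close>.\<close>
  define d where "d = min 1 (e / (vol\<^sup>2 + 4))"
  have V: "0 < vol\<^sup>2 + 4" using zero_le_power2[of vol] by linarith
  have d: "0 < d" "d \<le> 1" "d * (vol\<^sup>2 + 4) \<le> e"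
  proof -
    have "0 < e / (vol\<^sup>2 + 4)" using e V by (rule divide_pos_pos)
    then show "0 < d" "d \<le> 1" unfolding d_def by linarith+
    have "d \<le> e / (vol\<^sup>2 + 4)" unfolding d_def by linarith
    then show "d * (vol\<^sup>2 + 4) \<le> e" by (simp only: pos_le_divide_eq[OF V])
  qed
  have d9: "0 < d\<^sup>2 / 9" using d by simp
  show ?thesis
  proof (rule whp_mono[OF whp_conj[OF whp_conj[OF main_part[OF d(1)] ou_rest_part[OF d9]] whp_conj[OF disc_part[OF d9] est_part[OF d9]]]])
    show "eventually (\<lambda>i. \<forall>\<omega>\<in>space P.
        (\<bar>(\<Sum>k<m i. (vol * dw i k \<omega>)\<^sup>2) - vol\<^sup>2 * (real (m i) * step i)\<bar> \<le> d \<and> (\<Sum>k<m i. (ou_rest i k \<omega>)\<^sup>2) \<le> d\<^sup>2 / 9) \<and>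
        (\<Sum>k<m i. (disc i (Suc k) \<omega> - disc i k \<omega>)\<^sup>2) \<le> d\<^sup>2 / 9 \<and> (\<Sum>k<m i. (est i (Suc k) \<omega> - est i k \<omega>)\<^sup>2) \<le> d\<^sup>2 / 9 \<longrightarrow>
        \<bar>(\<Sum>k<m i. sq_incr X \<kappa>hat l0 (fst i) (fst (snd i)) (num i) (b i + 1 + k) \<omega>) - vol\<^sup>2 * (real (m i) * step i)\<bar> \<le> e) F"
      using ev_block
    proof eventually_elim
      case (elim i)
      show ?case
      proof (intro ballI impI, elim conjE)
        fix \<omega>
        assume h: "\<bar>(\<Sum>k<m i. (vol * dw i k \<omega>)\<^sup>2) - vol\<^sup>2 * (real (m i) * step i)\<bar> \<le> d"
          "(\<Sum>k<m i. (ou_rest i k \<omega>)\<^sup>2) \<le> d\<^sup>2 / 9" "(\<Sum>k<m i. (disc i (Suc k) \<omega> - disc i k \<omega>)\<^sup>2) \<le> d\<^sup>2 / 9"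
          "(\<Sum>k<m i. (est i (Suc k) \<omega> - est i k \<omega>)\<^sup>2) \<le> d\<^sup>2 / 9"
        let ?\<rho> = "\<lambda>k. ou_rest i k \<omega> + (disc i (Suc k) \<omega> - disc i k \<omega>) + (est i (Suc k) \<omega> - est i k \<omega>)"
        have inc: "sq_incr X \<kappa>hat l0 (fst i) (fst (snd i)) (num i) (b i + 1 + k) \<omega> = (vol * dw i k \<omega> + ?\<rho> k)\<^sup>2" for k
        proof -
          have q: "real (b i + 1 + k) * step i = tt i (Suc k)" "(real (b i + 1 + k) - 1) * step i = tt i k"
            by (simp_all add: tgrid_def)
          have split: "x - x' = g + ((c - c' - g) + ((a - c) - (a' - c')) + ((x - a) - (x' - a')))"
            for x x' g c c' a a' :: real by simp
          show ?thesis unfolding sq_incr_def q by (rule arg_cong[where f="\<lambda>x. x\<^sup>2"], rule split)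
        qed
        have three: "(x + y + z)\<^sup>2 \<le> 3 * x\<^sup>2 + 3 * y\<^sup>2 + 3 * z\<^sup>2" for x y z :: real
        proof -
          have "3 * x\<^sup>2 + 3 * y\<^sup>2 + 3 * z\<^sup>2 - (x + y + z)\<^sup>2 = (x - y)\<^sup>2 + (y - z)\<^sup>2 + (x - z)\<^sup>2"
            by (simp add: power2_eq_square algebra_simps)
          then show ?thesis using zero_le_power2[of "x - y"] zero_le_power2[of "y - z"] zero_le_power2[of "x - z"] by linarith
        qed
        have sum3: "3 * x + 3 * y + 3 * z \<le> d\<^sup>2" if "x \<le> d\<^sup>2 / 9" "y \<le> d\<^sup>2 / 9" "z \<le> d\<^sup>2 / 9" for x y z
          using that by linarith
        have "(\<Sum>k<m i. (?\<rho> k)\<^sup>2) \<le> (\<Sum>k<m i. 3 * (ou_rest i k \<omega>)\<^sup>2 + 3 * (disc i (Suc k) \<omega> - disc i k \<omega>)\<^sup>2 + 3 * (est i (Suc k) \<omega> - est i k \<omega>)\<^sup>2)"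
          by (intro sum_mono three)
        also have "\<dots> = 3 * (\<Sum>k<m i. (ou_rest i k \<omega>)\<^sup>2) + 3 * (\<Sum>k<m i. (disc i (Suc k) \<omega> - disc i k \<omega>)\<^sup>2) + 3 * (\<Sum>k<m i. (est i (Suc k) \<omega> - est i k \<omega>)\<^sup>2)"
          by (simp only: sum.distrib sum_distrib_left)
        also have "\<dots> \<le> d\<^sup>2" by (rule sum3[OF h(2,3,4)])
        finally have rho: "(\<Sum>k<m i. (?\<rho> k)\<^sup>2) \<le> d\<^sup>2" .
        have "real (m i) * step i \<le> real (num i) * step i" using elim by (intro mult_right_mono) auto
        then have "real (m i) * step i \<le> 1" using elim by linarith
        then have "vol\<^sup>2 * (real (m i) * step i) \<le> vol\<^sup>2 * 1" by (intro mult_left_mono) auto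
        then have "vol\<^sup>2 * (real (m i) * step i) \<le> vol\<^sup>2" by simp
        from sum_squares_perturb[OF d(1,2) h(1) this rho]
        show "\<bar>(\<Sum>k<m i. sq_incr X \<kappa>hat l0 (fst i) (fst (snd i)) (num i) (b i + 1 + k) \<omega>) - vol\<^sup>2 * (real (m i) * step i)\<bar> \<le> e"
          unfolding inc by (rule order_trans[OF _ d(3)])
      qed
    qed
  qed
qed

end

end

section \<open>Divergence of the statistic\<close>

lemma H1_sigma:
  assumes H1: "H1 \<sigma> r \<tau> \<sigma>d"
  shows "0 < \<tau> 1" "\<tau> 1 < \<tau> 2" "\<tau> 2 \<le> 1" "0 < \<sigma>d 1" "0 < \<sigma>d 2" "\<sigma>d 1 \<noteq> \<sigma>d 2"
    and "\<And>u. 0 < u \<Longrightarrow> u < \<tau> 1 \<Longrightarrow> \<sigma> u = \<sigma>d 1" "\<And>u. \<tau> 1 < u \<Longrightarrow> u < \<tau> 2 \<Longrightarrow> \<sigma> u = \<sigma>d 2"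
    and "\<And>t. t \<in> {0..1} \<Longrightarrow> \<sigma> t \<le> (\<Sum>j=1..r+1. \<sigma>d j)"
proof -
  have r: "1 \<le> r" and \<tau>0: "\<tau> 0 = 0" and \<tau>1: "\<tau> (r + 1) = 1" and inc: "\<And>j. j \<le> r \<Longrightarrow> \<tau> j < \<tau> (j + 1)"
    and pos: "\<And>j. j \<in> {1..r+1} \<Longrightarrow> 0 < \<sigma>d j" and ne: "\<And>j. j \<in> {1..r} \<Longrightarrow> \<sigma>d j \<noteq> \<sigma>d (j + 1)"
    and \<sigma>: "\<And>t. t \<in> {0..1} \<Longrightarrow> \<sigma> t = (\<Sum>j=1..r+1. \<sigma>d j *
         indicator (if j = r + 1 then {\<tau> r..1} else {\<tau> (j - 1)..<\<tau> j}) t)"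
    using H1 unfolding H1_def by blast+
  have mono: "\<tau> i \<le> \<tau> j" if "i \<le> j" "j \<le> r + 1" for i j
    using that
  proof (induction j rule: dec_induct)
    case (step n)
    then show ?case using inc[of n] by simp
  qed simp
  have piece: "\<sigma> u = \<sigma>d j" if j: "1 \<le> j" "j \<le> r + 1" and u: "\<tau> (j - 1) < u" "u < \<tau> j" for j u
  proof -
    have "0 \<le> \<tau> (j - 1)" "\<tau> j \<le> 1" using mono[of 0 "j - 1"] mono[of j "r + 1"] \<tau>0 \<tau>1 j by auto
    then have u01: "u \<in> {0..1}" using u by auto
    have "\<sigma> u = (\<Sum>i=1..r+1. if i = j then \<sigma>d j else 0)"
      unfolding \<sigma>[OF u01]
    proof (rule sum.cong[OF refl])
      fix i assume i: "i \<in> {1..r+1}"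
      consider "i = j" | "i < j" | "j < i" by linarith
      then show "\<sigma>d i * indicator (if i = r + 1 then {\<tau> r..1} else {\<tau> (i - 1)..<\<tau> i}) u = (if i = j then \<sigma>d j else 0)"
      proof cases
        case 1
        then show ?thesis using u u01 by (auto simp: indicator_def)
      next
        case 2
        then have "\<tau> i \<le> \<tau> (j - 1)" using j by (intro mono) auto
        then show ?thesis using 2 u j by (auto simp: indicator_def)
      next
        case 3
        then have "\<tau> j \<le> \<tau> (i - 1)" using i by (intro mono) auto
        then show ?thesis using 3 u by (auto simp: indicator_def)
      qed
    qed
    also have "\<dots> = \<sigma>d j" using j by simp
    finally show ?thesis .
  qed
  show "0 < \<tau> 1" using inc[of 0] \<tau>0 by simp
  show "\<tau> 1 < \<tau> 2" using inc[of 1] r by (simp add: numeral_2_eq_2)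
  show "\<tau> 2 \<le> 1" using mono[of 2 "r + 1"] \<tau>1 r by simp
  show "0 < \<sigma>d 1" "0 < \<sigma>d 2" using pos r by auto
  show "\<sigma>d 1 \<noteq> \<sigma>d 2" using ne[of 1] r by (simp add: numeral_2_eq_2)
  show "\<sigma> u = \<sigma>d 1" if "0 < u" "u < \<tau> 1" for u using piece[of 1 u] that \<tau>0 by simp
  show "\<sigma> u = \<sigma>d 2" if "\<tau> 1 < u" "u < \<tau> 2" for u using piece[of 2 u] that r by (simp add: numeral_2_eq_2)
  show "\<sigma> t \<le> (\<Sum>j=1..r+1. \<sigma>d j)" if "t \<in> {0..1}" for t
    unfolding \<sigma>[OF that] using pos by (intro sum_mono) (auto simp: indicator_def less_imp_le)
qed

context observation_scheme begin

lemma T_stat_measurable: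
  assumes "bhat N M n \<in> borel_measurable (obs_space N M)" "1 \<le> n" "n \<le> N"
  shows "T_stat X \<kappa>hat bhat l0 N M n \<in> borel_measurable P"
proof -
  note mb = mesh_bounds[OF assms(2,3)]
  have Y: "sq_incr X \<kappa>hat l0 N M n i \<in> borel_measurable P" if i: "i \<in> {1..n}" for i
  proof (rule sq_incr_measurable)
    have le: "real i * mesh N n \<le> real n * mesh N n" using i mb(3) by (intro mult_right_mono) auto
    then have le1: "real i * mesh N n \<le> 1" using mb(4) by linarith
    then show "real i * mesh N n \<in> {0..1}" using mb(3) by auto
    have "(real i - 1) * mesh N n \<le> real i * mesh N n" using mb(3) by (intro mult_right_mono) auto
    then have "(real i - 1) * mesh N n \<le> 1" using le1 by linarith
    then show "(real i - 1) * mesh N n \<in> {0..1}" using mb(3) i by auto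
  qed
  have b: "(\<lambda>\<omega>. bhat N M n (obs X N M \<omega>)) \<in> borel_measurable P"
    by (rule estimator_measurable[OF assms(1)])
  have D: "(\<lambda>\<omega>. \<bar>(\<Sum>i=1..k. sq_incr X \<kappa>hat l0 N M n i \<omega>) - real k / real n * (\<Sum>i=1..n. sq_incr X \<kappa>hat l0 N M n i \<omega>)\<bar>)
      \<in> borel_measurable P" if k: "k \<in> {1..n}" for k
    using k by (intro borel_measurable_abs borel_measurable_diff borel_measurable_times borel_measurable_const borel_measurable_sum Y) auto
  show ?thesis
    unfolding T_stat_def[abs_def]
    by (intro borel_measurable_times borel_measurable_divide borel_measurable_const b borel_measurable_Max D) auto
qed

text \<open>The two block sums around \<open>\<tau>1\<close> converge to different multiples of the same length, so the
  maximum in the statistic stays bounded away from zero, while \<open>sqrt (n/2)\<close> tends to infinity and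
  \<open>bhat\<close> stays bounded. The blocks must lie in the intervals of constant volatility and before the
  end \<open>n \<Delta>\<close> of the time grid; the latter is where the distance \<open>\<delta>\<close> is used.\<close>

lemma T_stat_diverges:
  assumes bhat: "\<And>N M n. bhat N M n \<in> borel_measurable (obs_space N M)"
    and C: "cond_C P X bhat F"
    and \<tau>: "0 < \<tau>1" "\<tau>1 < \<tau>2" "\<tau>2 \<le> 1"
    and v1: "\<And>u. 0 < u \<Longrightarrow> u < \<tau>1 \<Longrightarrow> \<sigma> u = v1" and v2: "\<And>u. \<tau>1 < u \<Longrightarrow> u < \<tau>2 \<Longrightarrow> \<sigma> u = v2"
    and v: "0 < v1" "0 < v2" "v1 \<noteq> v2"
    and \<delta>: "0 < \<delta>" "eventually (\<lambda>(N, M, n). \<tau>1 + \<delta> \<le> real n * mesh N n) F" and \<epsilon>: "0 < \<epsilon>"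
  shows "whp P F (\<lambda>i \<omega>. T_stat X \<kappa>hat bhat l0 (fst i) (fst (snd i)) (num i) \<omega> \<ge> \<epsilon>)"
proof -
  \<comment> \<open>Half of the available room: the blocks have length at most \<open>\<eta>\<close>, and rounding costs one more
    step, which is at most \<open>\<eta>\<close>.\<close>
  define \<eta> where "\<eta> = min \<tau>1 (min (\<tau>2 - \<tau>1) \<delta>) / 2"
  have \<eta>: "0 < \<eta>" "2 * \<eta> \<le> \<tau>1" "2 * \<eta> \<le> \<tau>2 - \<tau>1" "2 * \<eta> \<le> \<delta>" using \<tau> \<delta>(1) by (auto simp: \<eta>_def)
  define m where "m i = nat \<lfloor>\<eta> / step i\<rfloor>" for i
  \<comment> \<open>\<open>\<tau>1\<close> lies in increment \<open>a + 1\<close>, which neither block contains.\<close>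
  define a where "a i = nat \<lfloor>\<tau>1 / step i\<rfloor>" for i
  have ev: "eventually (\<lambda>i. 0 < step i \<and> m i \<le> a i \<and> a i + 1 + m i \<le> num i \<and> 1 \<le> num i \<and>
      real (a i) * step i \<le> \<tau>1 \<and> \<tau>1 < real (a i + 1) * step i \<and> real (a i + 1 + m i) * step i \<le> \<tau>2 \<and>
      real (m i) * step i \<le> \<eta> \<and> \<eta> / 2 \<le> real (m i) * step i) F"
  proof -
    have "eventually (\<lambda>i. step i < \<eta> / 2) F" using step_tendsto \<eta>(1) by (intro order_tendstoD(2)[of _ 0]) auto
    moreover have "eventually (\<lambda>i. \<tau>1 + \<delta> \<le> real (num i) * step i) F" using \<delta>(2) by (simp add: split_def)
    ultimately show ?thesis using ev_mesh ev_basic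
    proof eventually_elim
      case (elim i)
      define s where "s = step i"
      have s: "0 < s" "s < \<eta> / 2" using elim by (auto simp: s_def)
      have floor: "real (nat \<lfloor>x / s\<rfloor>) * s \<le> x \<and> x < (real (nat \<lfloor>x / s\<rfloor>) + 1) * s" if "0 < x" for x
      proof -
        have "real (nat \<lfloor>x / s\<rfloor>) = of_int \<lfloor>x / s\<rfloor>" using that s by simp
        moreover have "of_int \<lfloor>x / s\<rfloor> * s \<le> x" unfolding pos_le_divide_eq[OF s(1), symmetric] by linarith
        moreover have "x < (of_int \<lfloor>x / s\<rfloor> + 1) * s" unfolding pos_divide_less_eq[OF s(1), symmetric] by linarith
        ultimately show ?thesis by (simp only:)
      qed
      have m: "real (m i) * s \<le> \<eta>" "\<eta> < real (m i) * s + s" using floor[OF \<eta>(1)] by (auto simp: m_def s_def distrib_right)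
      have a: "real (a i) * s \<le> \<tau>1" "\<tau>1 < real (a i) * s + s" using floor[OF \<tau>(1)] by (auto simp: a_def s_def distrib_right)
      have ma: "m i \<le> a i"
        unfolding m_def a_def using \<eta> s by (intro nat_mono floor_mono divide_right_mono) (auto simp: s_def)
      have last: "real (a i + 1 + m i) * s \<le> \<tau>1 + 2 * \<eta>" using m(1) a(1) s by (simp add: distrib_right)
      have "real (a i + 1 + m i) * s \<le> real (num i) * s" using last \<eta>(4) elim(2)[folded s_def] by linarith
      then have "real (a i + 1 + m i) \<le> real (num i)" by (rule mult_right_le_imp_le[OF _ s(1)])
      then have "a i + 1 + m i \<le> num i" by linarith
      then show ?case
        using s m a ma last \<eta> elim(4) by (simp add: s_def[symmetric] distrib_right)
    qed
  qed
  let ?b1 = "\<lambda>i. a i - m i" and ?b2 = "\<lambda>i. a i + 1"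
  let ?g = "\<gamma> l0 powr (- \<alpha> / 2)"
  let ?Y = "\<lambda>i k \<omega>. sq_incr X \<kappa>hat l0 (fst i) (fst (snd i)) (num i) k \<omega>"
  have bl1: "eventually (\<lambda>i. m i \<le> num i \<and> tgrid ?b1 i (m i) \<le> 1 \<and> (\<forall>u\<in>{tgrid ?b1 i 0<..<tgrid ?b1 i (m i)}. \<sigma> u = v1)) F"
    using ev
  proof eventually_elim
    case (elim i)
    have "tgrid ?b1 i (m i) = real (a i) * step i" using elim by (simp add: tgrid_def)
    moreover have "0 \<le> tgrid ?b1 i 0" using elim by (simp add: tgrid_def)
    ultimately show ?case using elim \<tau> by (auto intro!: v1)
  qed
  have bl2: "eventually (\<lambda>i. m i \<le> num i \<and> tgrid ?b2 i (m i) \<le> 1 \<and> (\<forall>u\<in>{tgrid ?b2 i 0<..<tgrid ?b2 i (m i)}. \<sigma> u = v2)) F"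
    using ev
  proof eventually_elim
    case (elim i)
    have e: "tgrid ?b2 i (m i) = real (a i + 1 + m i) * step i" "tgrid ?b2 i 0 = real (a i + 1) * step i" by (simp_all add: tgrid_def)
    have "\<sigma> u = v2" if "u \<in> {tgrid ?b2 i 0<..<tgrid ?b2 i (m i)}" for u
      using that elim unfolding e by (intro v2) auto
    moreover have "tgrid ?b2 i (m i) \<le> 1" unfolding e using elim \<tau> by linarith
    ultimately show ?case using elim by auto
  qed
  define q where "q = \<bar>(v2 * ?g)\<^sup>2 - (v1 * ?g)\<^sup>2\<bar>"
  have q: "0 < q"
  proof -
    have "?g \<noteq> 0" using gamma_pos[OF l0] by simp
    moreover have "v1\<^sup>2 \<noteq> v2\<^sup>2" using v by (simp add: power2_eq_iff)
    ultimately have "(v2 * ?g)\<^sup>2 \<noteq> (v1 * ?g)\<^sup>2" by (simp add: power_mult_distrib)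
    then show ?thesis by (simp add: q_def)
  qed
  \<comment> \<open>The limits differ by at least \<open>q \<eta> / 2 = 4 c\<close>, so errors of size \<open>c\<close> leave a gap of \<open>2 c\<close>.\<close>
  define c where "c = q * \<eta> / 8"
  have c: "0 < c" using q \<eta> by (simp add: c_def)
  obtain \<beta> where \<beta>: "0 < \<beta>" "conv_in_prob P F (\<lambda>(N, M, n) \<omega>. bhat N M n (obs X N M \<omega>)) (\<beta>\<^sup>2)"
    using C unfolding cond_C_def by blast
  have bw: "whp P F (\<lambda>i \<omega>. \<bar>bhat (fst i) (fst (snd i)) (num i) (obs X (fst i) (fst (snd i)) \<omega>) - \<beta>\<^sup>2\<bar> \<le> \<beta>\<^sup>2 / 2)"
    using \<beta> by (intro whp_conv_in_prob estimator_measurable bhat) (auto simp: split_def)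
  have big: "eventually (\<lambda>i. 16 * \<beta>\<^sup>2 * \<epsilon> / (2 * c) \<le> sqrt (real (num i) / 2)) F"
  proof -
    have "filterlim (\<lambda>i. 1 / 2 * real (num i)) at_top F"
      by (rule filterlim_tendsto_pos_mult_at_top[OF tendsto_const _ num_real_at_top]) simp
    from filterlim_compose[OF sqrt_at_top this] show ?thesis by (simp add: filterlim_at_top)
  qed
  show ?thesis
  proof (rule whp_mono[OF whp_conj[OF bw whp_conj[OF block_whp[OF bl1 c] block_whp[OF bl2 c]]]])
    show "eventually (\<lambda>i. \<forall>\<omega>\<in>space P.
       \<bar>bhat (fst i) (fst (snd i)) (num i) (obs X (fst i) (fst (snd i)) \<omega>) - \<beta>\<^sup>2\<bar> \<le> \<beta>\<^sup>2 / 2 \<and>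
       \<bar>(\<Sum>k<m i. ?Y i (?b1 i + 1 + k) \<omega>) - (v1 * ?g)\<^sup>2 * (real (m i) * step i)\<bar> \<le> c \<and>
       \<bar>(\<Sum>k<m i. ?Y i (?b2 i + 1 + k) \<omega>) - (v2 * ?g)\<^sup>2 * (real (m i) * step i)\<bar> \<le> c \<longrightarrow>
       T_stat X \<kappa>hat bhat l0 (fst i) (fst (snd i)) (num i) \<omega> \<ge> \<epsilon>) F"
      using ev big
    proof eventually_elim
      case (elim i)
      show ?case
      proof (intro ballI impI, elim conjE)
        fix \<omega>
        assume h: "\<bar>bhat (fst i) (fst (snd i)) (num i) (obs X (fst i) (fst (snd i)) \<omega>) - \<beta>\<^sup>2\<bar> \<le> \<beta>\<^sup>2 / 2"
          "\<bar>(\<Sum>k<m i. ?Y i (?b1 i + 1 + k) \<omega>) - (v1 * ?g)\<^sup>2 * (real (m i) * step i)\<bar> \<le> c"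
          "\<bar>(\<Sum>k<m i. ?Y i (?b2 i + 1 + k) \<omega>) - (v2 * ?g)\<^sup>2 * (real (m i) * step i)\<bar> \<le> c"
        define B where "B = bhat (fst i) (fst (snd i)) (num i) (obs X (fst i) (fst (snd i)) \<omega>)"
        define V1 V2 \<mu> where "V1 = (\<Sum>k<m i. ?Y i (?b1 i + 1 + k) \<omega>)" and "V2 = (\<Sum>k<m i. ?Y i (?b2 i + 1 + k) \<omega>)"
          and "\<mu> = real (m i) * step i"
        define D where "D = (MAX k\<in>{1..num i}. \<bar>(\<Sum>j=1..k. ?Y i j \<omega>) - real k / real (num i) * (\<Sum>j=1..num i. ?Y i j \<omega>)\<bar>)"
        have VD: "\<bar>V2 - V1\<bar> \<le> 4 * D"
          unfolding V1_def V2_def D_def by (rule max_bridge_ge_second_difference) (use elim in auto)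
        have "q * (\<eta> / 2) \<le> q * \<mu>" using q elim by (intro mult_left_mono) (auto simp: \<mu>_def)
        also have "q * \<mu> = \<bar>(v2 * ?g)\<^sup>2 * \<mu> - (v1 * ?g)\<^sup>2 * \<mu>\<bar>"
          using elim by (simp add: q_def left_diff_distrib[symmetric] abs_mult \<mu>_def)
        also have "\<dots> \<le> \<bar>V2 - V1\<bar> + 2 * c"
          using h(2,3)[folded V1_def V2_def \<mu>_def] by linarith
        finally have "q * (\<eta> / 2) \<le> \<bar>V2 - V1\<bar> + 2 * c" .
        moreover have "q * (\<eta> / 2) = 4 * c" by (simp add: c_def)
        ultimately have "2 * c \<le> \<bar>V2 - V1\<bar>" by linarith
        then have D: "c / 2 \<le> D" using VD by linarith
        have B: "0 < B" "B \<le> 2 * \<beta>\<^sup>2"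
        proof -
          have "0 < \<beta>\<^sup>2" using \<beta>(1) by simp
          then show "0 < B" "B \<le> 2 * \<beta>\<^sup>2" using h(1)[folded B_def] by linarith+
        qed
        have "\<epsilon> * B \<le> \<epsilon> * (2 * \<beta>\<^sup>2)" using B \<epsilon> by (intro mult_left_mono) auto
        also have "\<dots> \<le> (16 * \<beta>\<^sup>2 * \<epsilon> / (2 * c)) * (c / 2)" using c \<epsilon> by simp
        also have "\<dots> \<le> sqrt (real (num i) / 2) * D" using elim(2) D c by (intro mult_mono) auto
        finally have "\<epsilon> \<le> sqrt (real (num i) / 2) * D / B" using B(1) by (simp add: pos_le_divide_eq)
        then show "T_stat X \<kappa>hat bhat l0 (fst i) (fst (snd i)) (num i) \<omega> \<ge> \<epsilon>"
          unfolding T_stat_def B_def[symmetric] D_def[symmetric] by (simp add: mult.commute)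
      qed
    qed
  qed
qed

end

theorem theorem2p2:
  fixes P :: "'w measure"
    and \<theta>0 :: real and \<theta>1 :: "real ^ 'd::finite" and \<theta>2 :: real and \<alpha> :: real
    and \<gamma> :: "nat ^ 'd \<Rightarrow> real" and \<sigma> :: "real \<Rightarrow> real"
    and w :: "nat ^ 'd \<Rightarrow> real \<Rightarrow> 'w \<Rightarrow> real"
    and X :: "real \<Rightarrow> 'w \<Rightarrow> real ^ 'd \<Rightarrow> real"
    and \<Xi> :: "(real ^ 'd) set" and l0 :: "nat ^ 'd"
    and R :: "nat \<Rightarrow> nat ^ 'd \<Rightarrow> real"
    and \<kappa>hat :: "nat \<Rightarrow> nat ^ 'd \<Rightarrow> (nat \<times> (nat ^ 'd) \<Rightarrow> real) \<Rightarrow> real ^ 'd"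
    and bhat :: "nat \<Rightarrow> nat ^ 'd \<Rightarrow> nat \<Rightarrow> (nat \<times> (nat ^ 'd) \<Rightarrow> real) \<Rightarrow> real"
    and F :: "(nat \<times> (nat ^ 'd) \<times> nat) filter"
    and r :: nat and \<tau> \<sigma>d :: "nat \<Rightarrow> real" and \<epsilon> :: real
  assumes "spde_model P \<theta>0 \<theta>1 \<theta>2 \<alpha> \<gamma> \<sigma> w X"
    and "compact \<Xi>" and "convex \<Xi>" and "\<theta>1 /\<^sub>R \<theta>2 \<in> interior \<Xi>"
    and "regime F"
    and "cond_A1 P \<theta>0 \<theta>1 \<theta>2 \<alpha> (X 0) l0"
    and "cond_A2 P (\<theta>1 /\<^sub>R \<theta>2) X R \<kappa>hat"
    and "cond_A3 \<alpha> R F"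
    and "\<And>N M n. bhat N M n \<in> borel_measurable (obs_space N M)"
    and "consistent_under_H0 TYPE('w) \<theta>0 \<theta>1 \<theta>2 \<alpha> \<gamma> l0 R \<kappa>hat bhat F"
    and "cond_C P X bhat F"
    and "H1 \<sigma> r \<tau> \<sigma>d"
    and "\<exists>\<delta>>0. eventually (\<lambda>(N, M, n). \<tau> 1 + \<delta> \<le> real n * mesh N n) F"
    and "0 < \<epsilon>"
  shows "((\<lambda>(N, M, n). measure P {\<omega>\<in>space P. T_stat X \<kappa>hat bhat l0 N M n \<omega> \<ge> \<epsilon>}) \<longlongrightarrow> 1) F"
proof -
  note \<sigma> = H1_sigma[OF assms(12)]
  interpret observation_scheme P \<theta>0 \<theta>1 \<theta>2 \<alpha> \<gamma> \<sigma> w X l0 R \<kappa>hat F "\<Sum>j=1..r+1. \<sigma>d j"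
    by (rule observation_scheme.intro[OF assms(1)], unfold_locales) (use assms(5-8) \<sigma>(9) in auto)
  from assms(13) obtain \<delta> where \<delta>: "0 < \<delta>" "eventually (\<lambda>(N, M, n). \<tau> 1 + \<delta> \<le> real n * mesh N n) F" by blast
  have "whp P F (\<lambda>i \<omega>. T_stat X \<kappa>hat bhat l0 (fst i) (fst (snd i)) (num i) \<omega> \<ge> \<epsilon>)"
    by (rule T_stat_diverges[OF assms(9,11) \<sigma>(1,2,3) \<sigma>(7,8) \<sigma>(4,5,6) \<delta> assms(14)])
  moreover have "eventually (\<lambda>i. T_stat X \<kappa>hat bhat l0 (fst i) (fst (snd i)) (num i) \<in> borel_measurable P) F"
    using ev_basic by eventually_elim (intro T_stat_measurable assms(9); simp)
  ultimately have "((\<lambda>i. measure P {\<omega>\<in>space P. T_stat X \<kappa>hat bhat l0 (fst i) (fst (snd i)) (num i) \<omega> \<ge> \<epsilon>}) \<longlongrightarrow> 1) F"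
    by (rule whp_tendsto)
  then show ?thesis by (simp only: split_def)
qed

end
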